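(* Suppose that $A,B\ge 0$ and $$A+B<\kappa_*:=1+\frac{1}{2\pi+1}.$$ Then for every environment $\eta\in\mathcal{E}_{A,B}$ and every starting point $x\in\mathbb{Z}^2$, the balanced excited random walk in the cookie environment $\eta$ started at $x$ visits every vertex of $\mathbb{Z}^2$ infinitely often, $\mathbb{P}_x^\eta$-almost surely.
   Context: A cookie environment is a deterministic family $\eta=(\beta_{z,j}: z\in\mathbb{Z}^2, j\ge 1)$ with $\beta_{z,j}\in[-1,1]$. Given $\eta$ and $x\in\mathbb{Z}^2$, the walk $S=(S_n)_{n\ge0}$ is the nearest-neighbour process on $\mathbb{Z}^2$ with $S_0=x$, law $\mathbb{P}_x^\eta$, and conditional step law as follows. Put $e_1=(1,0)$, $e_2=(0,1)$, $\mathcal{F}_n=\sigma(S_0,\ldots,S_n)$, $L_n(z)=\sum_{k<n}\mathbf{1}_{\{S_k=z\}}$ (number of departures from $z$ before time $n$), and $b_n=\beta_{S_n,L_n(S_n)+1}$. Then $$\mathbb{P}_x^\eta(S_{n+1}-S_n=e\mid\mathcal{F}_n)=\begin{cases}(1+b_n)/4,& e=\pm e_1,\\(1-b_n)/4,& e=\pm e_2.\end{cases}$$ With $t_+=\max(t,0)$, $t_-=\max(-t,0)$, for $A,B\ge0$ the set $\mathcal{E}_{A,B}$ consists of all environments with $$\sum_{j\ge1}(\beta_{z,j})_+\le A,\qquad \sum_{j\ge1}(\beta_{z,j})_-\le B\qquad\text{for every }z\in\mathbb{Z}^2.$$ *)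

theory Defs
  imports "HOL-Probability.Probability"
begin

text \<open>
  A family \<open>\<beta> z j\<close> carries its cookies at the indices \<open>j \<ge> 1\<close>;
  the value at \<open>j = 0\<close> is never used and is left unconstrained.
\<close>

definition cookie_environment :: "(int \<times> int \<Rightarrow> nat \<Rightarrow> real) \<Rightarrow> bool" where
  "cookie_environment \<beta> \<longleftrightarrow> (\<forall>z. \<forall>j\<ge>1. \<beta> z j \<in> {-1..1})"

text \<open>
  Summability is demanded explicitly because \<open>infsum\<close> is 0 on divergent families.
\<close>

definition env_class :: "real \<Rightarrow> real \<Rightarrow> (int \<times> int \<Rightarrow> nat \<Rightarrow> real) set" where
  "env_class A B = {\<beta>. cookie_environment \<beta> \<and>
     (\<forall>z. (\<lambda>j. max (\<beta> z j) 0) summable_on {1..} \<and>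
          (\<Sum>\<^sub>\<infinity>j\<in>{1..}. max (\<beta> z j) 0) \<le> A \<and>
          (\<lambda>j. max (- \<beta> z j) 0) summable_on {1..} \<and>
          (\<Sum>\<^sub>\<infinity>j\<in>{1..}. max (- \<beta> z j) 0) \<le> B)}"

definition departures :: "(nat \<Rightarrow> 'a \<Rightarrow> int \<times> int) \<Rightarrow> nat \<Rightarrow> int \<times> int \<Rightarrow> 'a \<Rightarrow> nat" where
  "departures S n z \<omega> = card {k. k < n \<and> S k \<omega> = z}"

definition current_cookie ::
  "(int \<times> int \<Rightarrow> nat \<Rightarrow> real) \<Rightarrow> (nat \<Rightarrow> 'a \<Rightarrow> int \<times> int) \<Rightarrow> nat \<Rightarrow> 'a \<Rightarrow> real" where
  "current_cookie \<beta> S n \<omega> = \<beta> (S n \<omega>) (departures S n (S n \<omega>) \<omega> + 1)"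

definition natural_sigma :: "'a measure \<Rightarrow> (nat \<Rightarrow> 'a \<Rightarrow> int \<times> int) \<Rightarrow> nat \<Rightarrow> 'a measure" where
  "natural_sigma M S n = sigma (space M) {S k -` C \<inter> space M | k C. k \<le> n}"

definition cond_step_prob ::
  "'a measure \<Rightarrow> (nat \<Rightarrow> 'a \<Rightarrow> int \<times> int) \<Rightarrow> nat \<Rightarrow> int \<times> int \<Rightarrow> 'a \<Rightarrow> real" where
  "cond_step_prob M S n e =
     real_cond_exp M (natural_sigma M S n) (indicator {\<omega> \<in> space M. S (Suc n) \<omega> - S n \<omega> = e})"

text \<open>
  The process \<open>S\<close> on the probability space \<open>M\<close> is a balanced excited random walk in the
  environment \<open>\<beta>\<close> started at \<open>x\<close>, i.e. its distribution under \<open>M\<close> is the law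
  of the walk. The four step probabilities sum to 1, so nearest-neighbour steps are automatic
  almost surely.
\<close>

definition balanced_excited_walk ::
  "(int \<times> int \<Rightarrow> nat \<Rightarrow> real) \<Rightarrow> int \<times> int \<Rightarrow> 'a measure \<Rightarrow> (nat \<Rightarrow> 'a \<Rightarrow> int \<times> int) \<Rightarrow> bool" where
  "balanced_excited_walk \<beta> x M S \<longleftrightarrow>
     prob_space M \<and>
     (\<forall>n. S n \<in> M \<rightarrow>\<^sub>M count_space UNIV) \<and>
     (AE \<omega> in M. S 0 \<omega> = x) \<and>
     (\<forall>n. \<forall>e\<in>{(1, 0), (-1, 0)}.
        AE \<omega> in M. cond_step_prob M S n e \<omega> = (1 + current_cookie \<beta> S n \<omega>) / 4) \<and>
     (\<forall>n. \<forall>e\<in>{(0, 1), (0, -1)}.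
        AE \<omega> in M. cond_step_prob M S n e \<omega> = (1 - current_cookie \<beta> S n \<omega>) / 4)"

definition kappa_star :: real where
  "kappa_star = 1 + 1 / (2 * pi + 1)"

end

theory Submission
  imports Defs
begin

text \<open>
  Run the walk from an arbitrary history until it enters a fixed small box or leaves a large box
  of radius \<open>R\<close>. Since \<open>super_log\<close> is superharmonic away from the origin, escaping requires
  cookies to push outward with total expected strength at least \<open>2 ln R\<close> times the escape
  probability. A cookie \<open>b\<close> used at \<open>y\<close> pushes with strength close to \<open>b * kern y\<close>, where
  \<open>kern y = - Re (1 / y\<^sup>2)\<close>, and the cookies at visited sites suffice for at most
  \<open>(A + B) * (2 ln R + O(1))\<close>.

  Not all sites can be visited, however. Stopping the subharmonic function \<open>sub_log (S - z)\<close> at the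
  first visit to \<open>z\<close> bounds from below the probability that \<open>z\<close> is missed, up to the pushes
  towards \<open>z\<close> before that visit. Average over \<open>z\<close> with weights \<open>target_mass\<close> proportional to the
  available budget. When \<open>z\<close> is much closer to the origin than \<open>y\<close>, a push at \<open>y\<close> towards \<open>z\<close> is also
  a push towards the origin and was already a loss. When \<open>y\<close> and \<open>z\<close> are comparably placed, the kernel
  is symmetric in \<open>y\<close> and \<open>z\<close>, and only the site of the pair that is visited first contributes, which
  halves the trivial bound. The remaining pairs contribute \<open>O(1)\<close>. The escape probability is thus at
  most \<open>(A + B) - (1 - (A + B) / 2) / 2 + o(1)\<close> if \<open>A + B \<ge> 1\<close>, which is below 1 for \<open>A + B < 6/5\<close>.
  Enlarging \<open>A\<close>, one may take \<open>A + B = 8/7 \<ge> kappa_star\<close>.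

  As this holds after every history, the small box is visited infinitely often. The cookies of a
  site tend to 0, so infinitely many visits to a site force infinitely many visits to its neighbours.
\<close>

section \<open>Lattice sums\<close>

type_synonym site = "int \<times> int"

text \<open>Counting cookies alone stops exactly at \<open>A + B = 1\<close>, where the available
  push \<open>2 ln R * (A + B)\<close> equals the push that certain escape needs. Passing this
  threshold requires coefficients of \<open>ln R\<close> that are free of loss, which is why the
  shell sums of \<open>kern\<close> are computed exactly to leading order, while every bounded error
  is estimated crudely.

  The two halves in \<open>(1 - (A + B) / 2) / 2\<close> have different origins. The outer one
  arises because \<open>target_mass\<close> is spread evenly over logarithmic scales, so that its
  mean of \<open>ln norm_sq\<close> is about \<open>ln R\<close> and not the maximal
  \<open>2 ln R\<close>. The inner one is the gain from near pairs. The total target mass is close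
  to 1 so that the loss from inward pushes pays for the far pairs with coefficient 1.

  The position alone is not a Markov chain, since the past determines the cookies that are left.
  Hence the estimate starts from an arbitrary history: its past contributes a constant independent
  of \<open>R\<close>, and \<open>R\<close> is chosen after the history. The value
  \<open>8 / 7\<close> is \<open>kappa_star\<close> with \<open>pi\<close> replaced by 3, and it
  gives escape probability at most \<open>13 / 14 + o(1)\<close>.\<close>

definition sup_norm :: "site \<Rightarrow> nat" where
  "sup_norm z = nat (max \<bar>fst z\<bar> \<bar>snd z\<bar>)"

definition norm_sq :: "site \<Rightarrow> real" where
  "norm_sq z = (of_int (fst z))\<^sup>2 + (of_int (snd z))\<^sup>2"

text \<open>One quarter of \<open>(d_xx - d_yy) ln |z|^2\<close>, the continuum form of
  \<open>anisotropy\<close>. At the origin the quotient is \<open>0 / 0 = 0\<close>.\<close>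

definition kern :: "site \<Rightarrow> real" where
  "kern z = ((of_int (snd z))\<^sup>2 - (of_int (fst z))\<^sup>2) / (norm_sq z)\<^sup>2"

text \<open>The shift by 1 keeps all negative powers finite and at most 1, the origin
  included.\<close>

definition bracket :: "site \<Rightarrow> real" where
  "bracket z = 1 + real (sup_norm z)"

definition box :: "nat \<Rightarrow> site set" where
  "box n = {z. sup_norm z \<le> n}"

lemma sup_norm_le_iff: "sup_norm z \<le> n \<longleftrightarrow> \<bar>fst z\<bar> \<le> int n \<and> \<bar>snd z\<bar> \<le> int n"
  by (auto simp: sup_norm_def)

lemma box_eq: "box n = {- int n..int n} \<times> {- int n..int n}"
  by (auto simp: box_def sup_norm_le_iff)

lemma finite_box [simp]: "finite (box n)"
  by (simp add: box_eq)

lemma card_box: "card (box n) = (2 * n + 1)\<^sup>2"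
proof -
  have "nat (2 * int n + 1) = 2 * n + 1" by simp
  then show ?thesis by (simp add: box_eq card_cartesian_product power2_eq_square)
qed

lemma sup_norm_eq_0 [simp]: "sup_norm z = 0 \<longleftrightarrow> z = 0"
  by (auto simp: sup_norm_def zero_prod_def prod_eq_iff)

lemma sup_norm_zero [simp]: "sup_norm 0 = 0" by simp

lemma sup_norm_minus [simp]: "sup_norm (- z) = sup_norm z"
  by (simp add: sup_norm_def)

lemma sup_norm_minus_commute: "sup_norm (y - z) = sup_norm (z - y)"
  by (metis minus_diff_eq sup_norm_minus)

lemma sup_norm_triangle: "sup_norm (y + z) \<le> sup_norm y + sup_norm z"
proof -
  have "\<bar>fst u\<bar> \<le> int (sup_norm u)" "\<bar>snd u\<bar> \<le> int (sup_norm u)" for u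
    using sup_norm_le_iff[of u "sup_norm u"] by auto
  from this[of y] this[of z] show ?thesis by (auto simp: sup_norm_le_iff)
qed

lemma sup_norm_triangle_diff: "sup_norm (y - z) \<le> sup_norm y + sup_norm z"
  using sup_norm_triangle[of y "- z"] by simp

lemma sup_norm_le_diff: "sup_norm y \<le> sup_norm z + sup_norm (y - z)"
  using sup_norm_triangle[of z "y - z"] by simp

lemma bracket_ge_1 [simp]: "bracket z \<ge> 1" by (simp add: bracket_def)
lemma bracket_pos [simp]: "bracket z > 0" using bracket_ge_1[of z] by linarith
lemma bracket_neq_0 [simp]: "bracket z \<noteq> 0" using bracket_pos[of z] by linarith

lemma norm_sq_ge_sup_norm: "(real (sup_norm z))\<^sup>2 \<le> norm_sq z"
proof -
  have "real (sup_norm z) = \<bar>of_int (fst z)\<bar> \<or> real (sup_norm z) = \<bar>of_int (snd z)\<bar>"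
    by (auto simp: sup_norm_def max_def)
  then show ?thesis by (auto simp: norm_sq_def)
qed

lemma norm_sq_le_sup_norm: "norm_sq z \<le> 2 * (real (sup_norm z))\<^sup>2"
proof -
  have "\<bar>of_int (fst z)\<bar> \<le> real (sup_norm z)" "\<bar>of_int (snd z)\<bar> \<le> real (sup_norm z)"
    by (auto simp: sup_norm_def)
  then have "(of_int (fst z))\<^sup>2 \<le> (real (sup_norm z))\<^sup>2" "(of_int (snd z))\<^sup>2 \<le> (real (sup_norm z))\<^sup>2"
    by (metis abs_le_square_iff abs_of_nat)+
  then show ?thesis by (simp add: norm_sq_def)
qed

lemma norm_sq_nonneg [simp]: "norm_sq z \<ge> 0" by (simp add: norm_sq_def)

lemma norm_sq_eq_0 [simp]: "norm_sq z = 0 \<longleftrightarrow> z = 0"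
  by (auto simp: norm_sq_def zero_prod_def prod_eq_iff add_nonneg_eq_0_iff)

lemma norm_sq_ge_1: "z \<noteq> 0 \<Longrightarrow> norm_sq z \<ge> 1"
proof -
  assume "z \<noteq> 0"
  then have "sup_norm z \<ge> 1" using sup_norm_eq_0[of z] by linarith
  then have "(real (sup_norm z))\<^sup>2 \<ge> 1" by simp
  then show ?thesis using norm_sq_ge_sup_norm[of z] by linarith
qed

lemma kern_zero [simp]: "kern 0 = 0" by (simp add: kern_def)

lemma kern_minus [simp]: "kern (- z) = kern z" by (simp add: kern_def norm_sq_def)

lemma abs_kern_le_norm_sq: "\<bar>kern z\<bar> \<le> 1 / norm_sq z"
proof (cases "z = 0")
  case False
  then have r: "norm_sq z > 0" using norm_sq_ge_1[of z] by linarith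
  have "\<bar>(of_int (snd z))\<^sup>2 - (of_int (fst z))\<^sup>2\<bar> \<le> norm_sq z"
    by (auto simp: norm_sq_def abs_le_iff)
  then have "\<bar>kern z\<bar> \<le> norm_sq z / (norm_sq z)\<^sup>2"
    unfolding kern_def abs_divide by (simp add: divide_right_mono)
  also have "\<dots> = 1 / norm_sq z" using r by (simp add: power2_eq_square)
  finally show ?thesis .
qed simp

lemma abs_kern_le_bracket: "\<bar>kern z\<bar> \<le> 4 / (bracket z)\<^sup>2"
proof (cases "z = 0")
  case False
  then have n: "sup_norm z \<ge> 1" using sup_norm_eq_0[of z] by linarith
  then have "bracket z \<le> 2 * real (sup_norm z)" by (simp add: bracket_def)
  then have "(bracket z)\<^sup>2 \<le> (2 * real (sup_norm z))\<^sup>2"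
    using bracket_pos[of z] by (intro power_mono) linarith+
  then have "(bracket z)\<^sup>2 \<le> 4 * norm_sq z" using norm_sq_ge_sup_norm[of z] by (simp add: power_mult_distrib)
  moreover have "norm_sq z > 0" using False norm_sq_ge_1[of z] by linarith
  ultimately have "1 / norm_sq z \<le> 4 / (bracket z)\<^sup>2"
    using divide_left_mono[of "(bracket z)\<^sup>2 / 4" "norm_sq z" 1] by simp
  then show ?thesis using abs_kern_le_norm_sq[of z] by linarith
qed simp

lemma abs_kern_le_1: "\<bar>kern z\<bar> \<le> 1"
proof (cases "z = 0")
  case False
  then have "1 / norm_sq z \<le> 1" using norm_sq_ge_1[of z] by simp
  then show ?thesis using abs_kern_le_norm_sq[of z] by linarith
qed simp

definition as_complex :: "site \<Rightarrow> complex" where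
  "as_complex z = Complex (of_int (fst z)) (of_int (snd z))"

lemma norm_as_complex: "(cmod (as_complex z))\<^sup>2 = norm_sq z"
  by (simp add: as_complex_def norm_sq_def cmod_power2)

lemma as_complex_eq_0 [simp]: "as_complex z = 0 \<longleftrightarrow> z = 0"
  by (auto simp: as_complex_def complex_eq_iff zero_prod_def prod_eq_iff)

lemma kern_as_complex: "kern z = - Re (inverse ((as_complex z)\<^sup>2))"
proof -
  have "kern z = - Re ((as_complex z)\<^sup>2) / ((Re ((as_complex z)\<^sup>2))\<^sup>2 + (Im ((as_complex z)\<^sup>2))\<^sup>2)"
    unfolding kern_def norm_sq_def as_complex_def by (simp add: power2_eq_square algebra_simps)
  then show ?thesis by simp
qed

lemma norm_as_complex_le: "cmod (as_complex z) \<le> 2 * real (sup_norm z)"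
proof -
  have "(cmod (as_complex z))\<^sup>2 \<le> (2 * real (sup_norm z))\<^sup>2"
    unfolding norm_as_complex power_mult_distrib using norm_sq_le_sup_norm[of z] zero_le_power2[of "real (sup_norm z)"]
    by (auto intro: order_trans)
  then show ?thesis by (rule power2_le_imp_le) simp
qed

lemma norm_as_complex_ge: "z \<noteq> 0 \<Longrightarrow> bracket z \<le> 2 * cmod (as_complex z)"
proof -
  assume "z \<noteq> 0"
  then have "sup_norm z \<ge> 1" using sup_norm_eq_0[of z] by linarith
  then have "bracket z \<le> 2 * real (sup_norm z)" by (simp add: bracket_def)
  moreover have "real (sup_norm z) \<le> cmod (as_complex z)"
    using norm_sq_ge_sup_norm[of z] unfolding norm_as_complex[symmetric] by (rule power2_le_imp_le) simp
  ultimately show ?thesis by linarith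
qed

lemma as_complex_diff: "as_complex (y - z) = as_complex y - as_complex z"
  by (simp add: as_complex_def complex_eq_iff)

text \<open>Factor \<open>1 / b^2 - 1 / a^2 = (a - b) (a + b) / (a^2 b^2)\<close> in the complex
  plane. If one site is the origin, where \<open>kern\<close> is 0, the pointwise bound
  suffices.\<close>

lemma kern_lipschitz:
  "\<bar>kern y - kern z\<bar> \<le> 64 * real (sup_norm (y - z)) * (bracket y + bracket z) / ((bracket y)\<^sup>2 * (bracket z)\<^sup>2)"
proof -
  have aux: "\<bar>kern u\<bar> \<le> 64 * real (sup_norm u) * (bracket u + 1) / (bracket u)\<^sup>2" for u
  proof (cases "u = 0")
    case False
    then have "sup_norm u \<ge> 1" using sup_norm_eq_0[of u] by linarith
    then have "real (sup_norm u) * (bracket u + 1) \<ge> 1 * 1"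
      by (intro mult_mono) (auto simp: bracket_def)
    then have "4 / (bracket u)\<^sup>2 \<le> 64 * real (sup_norm u) * (bracket u + 1) / (bracket u)\<^sup>2"
      by (intro divide_right_mono) auto
    then show ?thesis using abs_kern_le_bracket[of u] by linarith
  qed simp
  consider "z = 0" | "y = 0" | "y \<noteq> 0" "z \<noteq> 0" by blast
  then show ?thesis
  proof cases
    case 1 then show ?thesis using aux[of y] by (simp add: bracket_def)
  next
    case 2 then show ?thesis using aux[of z] sup_norm_minus[of z] by (simp add: bracket_def add.commute)
  next
    case 3
    define a b where "a = as_complex y" and "b = as_complex z"
    have ab: "a \<noteq> 0" "b \<noteq> 0" using 3 by (auto simp: a_def b_def)
    have "\<bar>kern y - kern z\<bar> = \<bar>Re (inverse (b\<^sup>2) - inverse (a\<^sup>2))\<bar>"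
      by (simp add: kern_as_complex a_def b_def)
    also have "\<dots> \<le> cmod (inverse (b\<^sup>2) - inverse (a\<^sup>2))" by (rule abs_Re_le_cmod)
    also have "inverse (b\<^sup>2) - inverse (a\<^sup>2) = (a - b) * (a + b) / (a\<^sup>2 * b\<^sup>2)"
      using ab by (simp add: field_simps power2_eq_square)
    also have "cmod \<dots> = cmod (a - b) * cmod (a + b) / ((cmod a)\<^sup>2 * (cmod b)\<^sup>2)"
      by (simp add: norm_mult norm_divide norm_power)
    also have "\<dots> \<le> (2 * real (sup_norm (y - z)) * (2 * (bracket y + bracket z))) / ((bracket y / 2)\<^sup>2 * (bracket z / 2)\<^sup>2)"
    proof (intro frac_le mult_mono power_mono)
      show "cmod (a - b) \<le> 2 * real (sup_norm (y - z))"
        using norm_as_complex_le[of "y - z"] by (simp add: a_def b_def as_complex_diff)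
      have "cmod (a + b) \<le> cmod a + cmod b" by (rule norm_triangle_ineq)
      also have "\<dots> \<le> 2 * real (sup_norm y) + 2 * real (sup_norm z)"
        unfolding a_def b_def by (intro add_mono norm_as_complex_le)
      finally show "cmod (a + b) \<le> 2 * (bracket y + bracket z)" by (simp add: bracket_def)
      show "bracket y / 2 \<le> cmod a" "bracket z / 2 \<le> cmod b"
        using norm_as_complex_ge[of y] norm_as_complex_ge[of z] 3 by (auto simp: a_def b_def)
    qed (use bracket_pos[of y] bracket_pos[of z] in \<open>auto simp: less_imp_le intro!: mult_pos_pos zero_less_power\<close>)
    also have "\<dots> = 64 * real (sup_norm (y - z)) * (bracket y + bracket z) / ((bracket y)\<^sup>2 * (bracket z)\<^sup>2)"
      by (simp add: power_divide)
    finally show ?thesis .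
  qed
qed

section \<open>Sums over sup-norm shells\<close>

lemma finite_shell [simp]: "finite {z. sup_norm z = k}"
proof (rule finite_subset)
  show "{z. sup_norm z = k} \<subseteq> box k" by (auto simp: box_def)
qed simp

lemma sum_box_shell:
  fixes \<phi> :: "site \<Rightarrow> real"
  shows "sum \<phi> (box n) = \<phi> 0 + (\<Sum>k=1..n. sum \<phi> {z. sup_norm z = k})"
proof (induction n)
  case 0
  have "box 0 = {0}" by (auto simp: box_def)
  then show ?case by simp
next
  case (Suc n)
  have "box (Suc n) = box n \<union> {z. sup_norm z = Suc n}" by (auto simp: box_def)
  moreover have "box n \<inter> {z. sup_norm z = Suc n} = {}" by (auto simp: box_def)
  ultimately have "sum \<phi> (box (Suc n)) = sum \<phi> (box n) + sum \<phi> {z. sup_norm z = Suc n}"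
    by (simp add: sum.union_disjoint)
  then show ?case using Suc by simp
qed

lemma card_shell: "k \<ge> 1 \<Longrightarrow> card {z. sup_norm z = k} = 8 * k"
proof -
  assume k: "k \<ge> 1"
  then obtain n where n: "k = Suc n" by (cases k) auto
  have "{z. sup_norm z = k} = box k - box n" by (auto simp: box_def n)
  moreover have "box n \<subseteq> box k" by (auto simp: box_def n)
  ultimately have "card {z. sup_norm z = k} = (2 * k + 1)\<^sup>2 - (2 * n + 1)\<^sup>2"
    by (simp add: card_Diff_subset card_box)
  also have "\<dots> = 8 * k" by (simp add: n power2_eq_square)
  finally show ?thesis .
qed

lemma sum_box_radial:
  fixes \<phi> :: "nat \<Rightarrow> real"
  shows "(\<Sum>z\<in>box n. \<phi> (sup_norm z)) = \<phi> 0 + (\<Sum>k=1..n. 8 * real k * \<phi> k)"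
proof -
  have "(\<Sum>z | sup_norm z = k. \<phi> (sup_norm z)) = 8 * real k * \<phi> k" if "k \<in> {1..n}" for k
    using that card_shell[of k] by simp
  then show ?thesis
    by (subst sum_box_shell) (auto intro!: sum.cong)
qed

lemma sum_inverse_le_ln:
  "n \<ge> 1 \<Longrightarrow> (\<Sum>k=1..n. 1 / real k) \<le> 1 + ln n"
proof (induction n rule: nat_induct_at_least)
  case (Suc n)
  have "ln (real n / real (Suc n)) \<le> real n / real (Suc n) - 1"
    using Suc by (intro ln_le_minus_one) auto
  then have "1 / real (Suc n) \<le> ln (Suc n) - ln n"
    using Suc by (simp add: ln_div field_simps)
  then show ?case using Suc by simp
qed auto

lemma sum_inverse_square_le: "(\<Sum>k=1..n. 1 / (real k)\<^sup>2) \<le> 2"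
proof -
  have "(\<Sum>k=1..n. 1 / (real k)\<^sup>2) \<le> 2 - 1 / n" if "n \<ge> 1"
    using that
  proof (induction n rule: nat_induct_at_least)
    case (Suc n)
    have "1 / (real (Suc n))\<^sup>2 \<le> 1 / (real n * real (Suc n))"
      using Suc by (intro divide_left_mono) (auto simp: power2_eq_square)
    also have "\<dots> = 1 / n - 1 / Suc n"
      using Suc by (simp add: field_simps)
    finally have "1 / (real (Suc n))\<^sup>2 \<le> 1 / n - 1 / Suc n" .
    then show ?case using Suc by simp
  qed auto
  then show ?thesis
    by (cases "n \<ge> 1") (auto intro: order_trans)
qed


text \<open>Each term is at most the increment \<open>2 / k^2 - 2 / (k + 1)^2\<close>, and these
  telescope.\<close>

lemma sum_inverse_cube_tail:
  "t \<ge> 1 \<Longrightarrow> (\<Sum>k=t..n. 1 / (real k) ^ 3) \<le> 2 / (real t)\<^sup>2"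
proof (cases "n \<ge> t")
  case True
  assume t: "t \<ge> 1"
  from True have "(\<Sum>k=t..n. 1 / (real k) ^ 3) \<le> 2 / (real t)\<^sup>2 - 2 / (real (Suc n))\<^sup>2"
  proof (induction n rule: nat_induct_at_least)
    case base
    have "1 / (real k) ^ 3 \<le> 2 / (real k)\<^sup>2 - 2 / (real (Suc k))\<^sup>2" if "k \<ge> 1" for k
    proof -
      have "1 * (real k + 1)\<^sup>2 \<le> 2 * real k * (2 * real k + 1)"
      proof -
        have "1 * 1 \<le> real k * real k" "1 \<le> real k" using that mult_mono[of 1 "real k" 1 "real k"] by auto
        then show ?thesis by (simp add: power2_eq_square algebra_simps)
      qed
      moreover have "2 / (real k)\<^sup>2 - 2 / (real (Suc k))\<^sup>2 = (2 * real k * (2 * real k + 1)) / ((real k)^3 * (real k + 1)\<^sup>2)"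
      proof -
        define x where "x = real k"
        have x: "x > 0" using that by (simp add: x_def)
        have "2 / x\<^sup>2 - 2 / (x + 1)\<^sup>2 = (2 * x * (2 * x + 1)) / (x ^ 3 * (x + 1)\<^sup>2)"
          using x by (simp add: divide_simps) (simp add: algebra_simps power2_eq_square power3_eq_cube)
        then show ?thesis by (simp add: x_def add.commute)
      qed
      moreover have "1 / (real k) ^ 3 = (1 * (real k + 1)\<^sup>2) / ((real k)^3 * (real k + 1)\<^sup>2)"
        using that by (simp add: field_simps)
      ultimately show ?thesis by (simp only: divide_right_mono) (rule divide_right_mono, auto)
    qed
    note telescope = this
    show ?case using telescope[OF t] by simp
    case (Suc n)
    show ?case using Suc telescope[of "Suc n"] by simp
  qed
  also have "\<dots> \<le> 2 / (real t)\<^sup>2" by simp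
  finally show ?thesis .
qed auto

section \<open>Positive and negative part of the kernel, with sharp leading terms\<close>

definition kern_pos :: "site \<Rightarrow> real" where "kern_pos z = max (kern z) 0"
definition kern_neg :: "site \<Rightarrow> real" where "kern_neg z = max (- kern z) 0"

lemma kern_pos_minus [simp]: "kern_pos (- z) = kern_pos z" and kern_neg_minus [simp]: "kern_neg (- z) = kern_neg z"
  by (simp_all add: kern_pos_def kern_neg_def)

lemma kern_parts_nonneg [simp]: "kern_pos z \<ge> 0" "kern_neg z \<ge> 0"
  by (simp_all add: kern_pos_def kern_neg_def)

lemma kern_parts_le: "kern_pos z \<le> \<bar>kern z\<bar>" "kern_neg z \<le> \<bar>kern z\<bar>"
  by (simp_all add: kern_pos_def kern_neg_def)

lemma kern_eq: "kern z = kern_pos z - kern_neg z"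
  by (simp add: kern_pos_def kern_neg_def)

lemma kern_parts_zero [simp]: "kern_pos 0 = 0" "kern_neg 0 = 0"
  by (simp_all add: kern_pos_def kern_neg_def)

lemma bij_swap_box: "bij_betw prod.swap (box n) (box n)"
  by (rule bij_betwI[of _ _ _ prod.swap]) (auto simp: box_def sup_norm_def max.commute)

lemma norm_sq_swap [simp]: "norm_sq (prod.swap z) = norm_sq z" by (simp add: norm_sq_def)
lemma kern_pos_swap: "kern_pos (prod.swap z) = kern_neg z"
proof -
  have "kern (prod.swap z) = - kern z"
    unfolding kern_def norm_sq_swap by (simp add: minus_divide_left)
  then show ?thesis by (simp add: kern_pos_def kern_neg_def)
qed

text \<open>Exchanging the coordinates preserves the box and swaps the two parts of the kernel, so
  only \<open>kern_neg\<close> has to be summed explicitly.\<close>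

lemma sum_kern_pos_eq_kern_neg:
  assumes "\<And>z. f (prod.swap z) = f z"
  shows "(\<Sum>z\<in>box n. kern_pos z * f z) = (\<Sum>z\<in>box n. kern_neg z * f z)"
proof -
  have "(\<Sum>z\<in>box n. kern_neg z * f z) = (\<Sum>z\<in>box n. kern_pos (prod.swap z) * f (prod.swap z))"
    by (simp add: assms kern_pos_swap)
  also have "\<dots> = (\<Sum>z\<in>box n. kern_pos z * f z)"
    by (rule sum.reindex_bij_betw[OF bij_swap_box])
  finally show ?thesis by simp
qed

text \<open>The value of \<open>kern_neg\<close> at \<open>(k, j)\<close> for
  \<open>j \<le> k\<close>, that is, on a vertical side of the shell of radius \<open>k\<close>;
  \<open>kern_neg\<close> vanishes on the rest of the shell.\<close>

definition edge :: "nat \<Rightarrow> nat \<Rightarrow> real" where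
  "edge k j = ((real k)\<^sup>2 - (real j)\<^sup>2) / ((real k)\<^sup>2 + (real j)\<^sup>2)\<^sup>2"

lemma sum_symmetric_interval:
  fixes F :: "nat \<Rightarrow> real"
  shows "(\<Sum>j\<in>{- int n..int n}. F (nat \<bar>j\<bar>)) = F 0 + 2 * (\<Sum>j=1..n. F j)"
proof (induction n)
  case (Suc n)
  have "{- int (Suc n)..int (Suc n)} = insert (int (Suc n)) (insert (- int (Suc n)) {- int n..int n})"
    by auto
  moreover have "nat (1 + int n) = Suc n" "nat (int n + 1) = Suc n" by auto
  ultimately show ?case using Suc by simp
qed auto

lemma sum_kern_neg_shell:
  assumes "k \<ge> 1"
  shows "(\<Sum>z | sup_norm z = k. kern_neg z) = 2 * (edge k 0 + 2 * (\<Sum>j=1..k. edge k j))"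
proof -
  define S where "S = {int k, - int k} \<times> {- int k..int k}"
  have "(\<Sum>z | sup_norm z = k. kern_neg z) = (\<Sum>z\<in>S. kern_neg z)"
  proof (rule sum.mono_neutral_right)
    show "S \<subseteq> {z. sup_norm z = k}" by (auto simp: S_def sup_norm_def)
    show "\<forall>z\<in>{z. sup_norm z = k} - S. kern_neg z = 0"
    proof
      fix z assume z: "z \<in> {z. sup_norm z = k} - S"
      obtain a b where ab: "z = (a, b)" by force
      from z have "\<bar>a\<bar> \<le> \<bar>b\<bar>" unfolding ab S_def sup_norm_def by (auto simp: max_def split: if_splits)
      then have "(of_int a :: real)\<^sup>2 \<le> (of_int b)\<^sup>2"
        by (metis abs_le_square_iff of_int_abs of_int_le_iff)
      then have "kern z \<ge> 0" by (simp add: kern_def ab)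
      then show "kern_neg z = 0" by (simp add: kern_neg_def)
    qed
  qed simp
  also have "\<dots> = (\<Sum>a\<in>{int k, - int k}. \<Sum>b\<in>{- int k..int k}. kern_neg (a, b))"
    by (simp only: S_def sum.cartesian_product) (simp add: case_prod_unfold)
  also have "\<dots> = (\<Sum>a\<in>{int k, - int k}. \<Sum>b\<in>{- int k..int k}. edge k (nat \<bar>b\<bar>))"
  proof (intro sum.cong refl)
    fix a b assume ab: "a \<in> {int k, - int k}" "b \<in> {- int k..int k}"
    have 1: "(of_int a :: real)\<^sup>2 = (real k)\<^sup>2" using ab by auto
    have 2: "(real (nat \<bar>b\<bar>))\<^sup>2 = (of_int b)\<^sup>2" by simp
    have "\<bar>b\<bar> \<le> int k" using ab by auto
    then have 3: "(of_int b :: real)\<^sup>2 \<le> (real k)\<^sup>2"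
      by (metis abs_le_square_iff abs_of_nat of_int_abs of_int_le_iff of_int_of_nat_eq)
    have "- kern (a, b) = edge k (nat \<bar>b\<bar>)"
      unfolding kern_def norm_sq_def edge_def 2 using 1 by (simp add: minus_divide_left)
    moreover have "edge k (nat \<bar>b\<bar>) \<ge> 0"
      unfolding edge_def 2 using 3 by simp
    ultimately show "kern_neg (a, b) = edge k (nat \<bar>b\<bar>)" by (simp add: kern_neg_def)
  qed
  also have "\<dots> = 2 * (edge k 0 + 2 * (\<Sum>j=1..k. edge k j))"
    using assms by (simp add: sum_symmetric_interval)
  finally show ?thesis .
qed

text \<open>Comparison with the antiderivative \<open>j / (k\<^sup>2 + j\<^sup>2)\<close> of the decreasing function \<open>edge k\<close>.\<close>

lemma edge_antiderivative:
  assumes "j < k"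
  defines "\<psi> \<equiv> \<lambda>j. real j / ((real k)\<^sup>2 + (real j)\<^sup>2)"
  shows "edge k (Suc j) \<le> \<psi> (Suc j) - \<psi> j" "\<psi> (Suc j) - \<psi> j \<le> edge k j"
proof -
  define a b where "a = (real k)\<^sup>2" and "b = real j"
  have b: "b \<ge> 0" by (simp add: b_def)
  have ab: "(b + 1)\<^sup>2 \<le> a" unfolding a_def b_def using assms(1) by (intro power_mono) auto
  have "0 < (b + 1)\<^sup>2" using b by simp
  then have a0: "a > 0" using ab by linarith
  have p: "a + b\<^sup>2 > 0" "a + (b+1)\<^sup>2 > 0" using a0 by (auto intro: add_pos_nonneg)
  have d: "\<psi> (Suc j) - \<psi> j = (a - b * (b + 1)) / ((a + b\<^sup>2) * (a + (b+1)\<^sup>2))"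
  proof -
    have "\<psi> (Suc j) - \<psi> j = (b + 1) / (a + (b+1)\<^sup>2) - b / (a + b\<^sup>2)"
      by (simp add: \<psi>_def a_def b_def add.commute)
    also have "\<dots> = ((b+1) * (a + b\<^sup>2) - b * (a + (b+1)\<^sup>2)) / ((a + b\<^sup>2) * (a + (b+1)\<^sup>2))"
      using p by (simp add: diff_frac_eq mult.commute)
    also have "(b+1) * (a + b\<^sup>2) - b * (a + (b+1)\<^sup>2) = a - b * (b + 1)"
      by (simp add: power2_eq_square algebra_simps)
    finally show ?thesis .
  qed
  have e0: "edge k j = (a - b\<^sup>2) / (a + b\<^sup>2)\<^sup>2" by (simp add: edge_def a_def b_def)
  have e1: "edge k (Suc j) = (a - (b+1)\<^sup>2) / (a + (b+1)\<^sup>2)\<^sup>2"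
    by (simp add: edge_def a_def b_def add.commute)
  have "(a - (b+1)\<^sup>2) * (a + b\<^sup>2) \<le> (a - b * (b + 1)) * (a + (b+1)\<^sup>2)"
    using ab b a0 by (intro mult_mono) (auto simp: power2_eq_square algebra_simps)
  then show "edge k (Suc j) \<le> \<psi> (Suc j) - \<psi> j"
    unfolding d e1 using p by (simp add: divide_simps power2_eq_square mult.assoc mult.commute mult.left_commute) 
  have "(a - b * (b + 1)) * (a + b\<^sup>2) \<le> (a - b\<^sup>2) * (a + (b+1)\<^sup>2)"
  proof -
    have "(a - b\<^sup>2) * (a + (b+1)\<^sup>2) - (a - b * (b + 1)) * (a + b\<^sup>2)
      = (a - b\<^sup>2) * (2 * b + 1) + b * (a + b\<^sup>2)"
      by (simp add: power2_eq_square algebra_simps)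
    moreover have "a - b\<^sup>2 \<ge> 0" using ab b by (simp add: power2_eq_square algebra_simps)
    ultimately show ?thesis using b p by (smt (verit) mult_nonneg_nonneg)
  qed
  then show "\<psi> (Suc j) - \<psi> j \<le> edge k j"
    unfolding d e0 using p by (simp add: divide_simps power2_eq_square mult.assoc mult.commute mult.left_commute) 
qed

text \<open>The antiderivative equals \<open>1 / (2 k)\<close> at \<open>j = k\<close>; two sides
  and two signs of \<open>j\<close> make the leading term \<open>4 / (2 k)\<close>. The upper bound
  limits the total budget, the lower bound feeds the mean logarithm of the targets.\<close>

lemma sum_kern_neg_shell_bounds:
  assumes "k \<ge> 1"
  shows "(\<Sum>z | sup_norm z = k. kern_neg z) \<le> 2 / k + 2 / (real k)\<^sup>2"
    and "(\<Sum>z | sup_norm z = k. kern_neg z) \<ge> 2 / k - 2 / (real k)\<^sup>2"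
proof -
  define \<psi> where "\<psi> = (\<lambda>j. real j / ((real k)\<^sup>2 + (real j)\<^sup>2))"
  have tel: "(\<Sum>j<k. \<psi> (Suc j) - \<psi> j) = 1 / (2 * k)"
    using assms by (subst sum_lessThan_telescope) (simp add: \<psi>_def power2_eq_square field_simps)
  have e0: "edge k 0 = 1 / (real k)\<^sup>2" using assms by (simp add: edge_def power2_eq_square)
  have ek: "edge k k = 0" by (simp add: edge_def)
  have s: "(\<Sum>j=1..k. edge k j) = (\<Sum>j<k. edge k (Suc j))"
    by (simp add: sum.shift_bounds_cl_Suc_ivl lessThan_atLeast0 sum.atLeast1_atMost_eq)
  have "(\<Sum>j<k. edge k (Suc j)) \<le> (\<Sum>j<k. \<psi> (Suc j) - \<psi> j)"
    by (intro sum_mono) (use edge_antiderivative(1)[of _ k] in \<open>auto simp: \<psi>_def\<close>)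
  then show "(\<Sum>z | sup_norm z = k. kern_neg z) \<le> 2 / k + 2 / (real k)\<^sup>2"
    unfolding sum_kern_neg_shell[OF assms] s e0 tel using assms by (simp add: field_simps)
  have "(\<Sum>j<k. \<psi> (Suc j) - \<psi> j) \<le> (\<Sum>j<k. edge k j)"
    by (intro sum_mono) (use edge_antiderivative(2)[of _ k] in \<open>auto simp: \<psi>_def\<close>)
  \<comment> \<open>Shifting the index by one costs only the first term, because
    \<open>edge k k = 0\<close>.\<close>
  also have "\<dots> = edge k 0 + (\<Sum>j<k. edge k (Suc j))"
    using sum.lessThan_Suc_shift[of "edge k" k] ek by simp
  finally have "1 / (2 * real k) \<le> 1 / (real k)\<^sup>2 + (\<Sum>j<k. edge k (Suc j))"
    using tel e0 by simp
  moreover have "u - v \<le> 2 * (b + 2 * S)" if "a \<le> b + S" "u = 4 * a" "v = 2 * b" for a b u v S :: real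
    using that by (simp add: algebra_simps)
  ultimately show "(\<Sum>z | sup_norm z = k. kern_neg z) \<ge> 2 / k - 2 / (real k)\<^sup>2"
    unfolding sum_kern_neg_shell[OF assms] s e0 by simp
qed

lemma sum_kern_neg_box_le:
  assumes "n \<ge> 1"
  shows "(\<Sum>z\<in>box n. kern_neg z) \<le> 2 * ln n + 6"
proof -
  have "(\<Sum>z\<in>box n. kern_neg z) = (\<Sum>k=1..n. \<Sum>z | sup_norm z = k. kern_neg z)"
    by (simp add: sum_box_shell)
  also have "\<dots> \<le> (\<Sum>k=1..n. 2 * (1 / k) + 2 * (1 / (real k)\<^sup>2))"
    by (intro sum_mono) (use sum_kern_neg_shell_bounds(1) in auto)
  also have "\<dots> = 2 * (\<Sum>k=1..n. 1 / real k) + 2 * (\<Sum>k=1..n. 1 / (real k)\<^sup>2)"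
    by (simp only: sum.distrib sum_distrib_left)
  finally show ?thesis
    using sum_inverse_le_ln[OF assms] sum_inverse_square_le[of n] by linarith
qed

lemma sum_kern_pos_box_le:
  assumes "n \<ge> 1"
  shows "(\<Sum>z\<in>box n. kern_pos z) \<le> 2 * ln n + 6"
  using sum_kern_neg_box_le[OF assms] sum_kern_pos_eq_kern_neg[of "\<lambda>_. 1" n] by simp


text \<open>Compare with the increments of \<open>(ln k)^2 / 2\<close>, the antiderivative of
  \<open>ln k / k\<close>. The second-order errors \<open>1 / (2 k^2)\<close> sum to at most
  1.\<close>

lemma sum_ln_over_ge: "(\<Sum>k=1..n. ln (real k) / real k) \<ge> (ln (real n + 1))\<^sup>2 / 2 - 1"
proof -
  have telescope: "(ln (real k + 1))\<^sup>2 / 2 - (ln (real k))\<^sup>2 / 2 \<le> ln (real k) / real k + 1 / (2 * (real k)\<^sup>2)"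
    if "k \<ge> 1" for k
  proof -
    define d where "d = ln (real k + 1) - ln (real k)"
    have "ln ((real k + 1) / real k) \<le> (real k + 1) / real k - 1"
      using that by (intro ln_le_minus_one) auto
    then have d: "d \<le> 1 / real k"
      using that by (simp add: d_def ln_div field_simps)
    have d0: "d \<ge> 0" "ln (real k) \<ge> 0" using that by (auto simp: d_def)
    have "(ln (real k + 1))\<^sup>2 / 2 - (ln (real k))\<^sup>2 / 2 = d * ln (real k) + d\<^sup>2 / 2"
      by (simp add: d_def power2_eq_square field_simps)
    also have "\<dots> \<le> 1 / real k * ln (real k) + (1 / real k)\<^sup>2 / 2"
      using d d0 by (intro add_mono mult_right_mono divide_right_mono power_mono) auto
    finally show ?thesis by (simp add: power_divide)
  qed
  have "(ln (real n + 1))\<^sup>2 / 2 = (\<Sum>k=1..n. (ln (real k + 1))\<^sup>2 / 2 - (ln (real k))\<^sup>2 / 2)"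
    by (induction n) (auto simp: add.commute)
  also have "\<dots> \<le> (\<Sum>k=1..n. ln (real k) / real k + 1 / 2 * (1 / (real k)\<^sup>2))"
    by (intro sum_mono) (use telescope in auto)
  also have "\<dots> = (\<Sum>k=1..n. ln (real k) / real k) + 1 / 2 * (\<Sum>k=1..n. 1 / (real k)\<^sup>2)"
    by (simp only: sum.distrib sum_distrib_left)
  finally show ?thesis using sum_inverse_square_le[of n] by linarith
qed

lemma ln_norm_sq_ge: "2 * ln (real (sup_norm z)) \<le> ln (norm_sq z)" if "z \<noteq> 0"
proof -
  have n: "sup_norm z \<ge> 1" using sup_norm_eq_0[of z] that by linarith
  then have "2 * ln (real (sup_norm z)) = ln ((real (sup_norm z))\<^sup>2)" by (simp add: ln_realpow)
  also have "\<dots> \<le> ln (norm_sq z)" 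
    using n norm_sq_ge_sup_norm[of z] norm_sq_ge_1[OF that] by (subst ln_le_cancel_iff) auto
  finally show ?thesis .
qed

text \<open>Shell \<open>k\<close> carries kernel mass about \<open>2 / k\<close> at logarithm at
  least \<open>2 ln k\<close>. The result \<open>2 (ln n)^2\<close> is half of total mass times
  largest logarithm.\<close>

lemma sum_kern_neg_ln_ge:
  assumes "n \<ge> 1"
  shows "(\<Sum>z\<in>box n. kern_neg z * ln (norm_sq z)) \<ge> 2 * (ln n)\<^sup>2 - 8 * ln n - 4"
proof -
  have "(\<Sum>z | sup_norm z = k. kern_neg z * ln (norm_sq z)) \<ge> 4 * (ln (real k) / real k) - 4 * ln n * (1 / (real k)\<^sup>2)"
    if k: "k \<in> {1..n}" for k
  proof -
    have "0 \<le> ln (real k)" "ln (real k) \<le> ln n" using k by auto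
    have "4 * (ln (real k) / real k) - 4 * ln n * (1 / (real k)\<^sup>2)
        \<le> 4 * (ln (real k) / real k) - 4 * ln (real k) * (1 / (real k)\<^sup>2)"
      using \<open>ln (real k) \<le> ln n\<close> by (simp add: divide_right_mono)
    also have "\<dots> = (2 / k - 2 / (real k)\<^sup>2) * (2 * ln (real k))" by (simp add: algebra_simps)
    also have "\<dots> \<le> (\<Sum>z | sup_norm z = k. kern_neg z) * (2 * ln (real k))"
      using sum_kern_neg_shell_bounds(2)[of k] k \<open>0 \<le> ln (real k)\<close> by (intro mult_right_mono) auto
    also have "\<dots> = (\<Sum>z | sup_norm z = k. kern_neg z * (2 * ln (sup_norm z)))"
      by (simp add: sum_distrib_right)
    also have "\<dots> \<le> (\<Sum>z | sup_norm z = k. kern_neg z * ln (norm_sq z))"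
      using k ln_norm_sq_ge by (intro sum_mono mult_left_mono) force+
    finally show ?thesis .
  qed
  then have "(\<Sum>k=1..n. 4 * (ln (real k) / real k) - 4 * ln n * (1 / (real k)\<^sup>2))
      \<le> (\<Sum>z\<in>box n. kern_neg z * ln (norm_sq z))"
    unfolding sum_box_shell by (auto intro!: sum_mono)
  moreover have "(\<Sum>k=1..n. 4 * (ln (real k) / real k) - 4 * ln n * (1 / (real k)\<^sup>2))
      = 4 * (\<Sum>k=1..n. ln (real k) / real k) - 4 * ln n * (\<Sum>k=1..n. 1 / (real k)\<^sup>2)"
    by (simp only: sum_subtractf sum_distrib_left)
  moreover have "4 * ln n * (\<Sum>k=1..n. 1 / (real k)\<^sup>2) \<le> 4 * ln n * 2"
    using assms by (intro mult_left_mono sum_inverse_square_le) auto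
  moreover have "(ln n)\<^sup>2 \<le> (ln (real n + 1))\<^sup>2"
    using assms by (intro power_mono) auto
  ultimately show ?thesis using sum_ln_over_ge[of n] by linarith
qed

section \<open>Sums of powers of the bracket\<close>

lemma sum_inverse_bracket2_le:
  assumes "n \<ge> 1"
  shows "(\<Sum>z\<in>box n. 1 / (bracket z)\<^sup>2) \<le> 9 + 8 * ln n"
proof -
  have "(\<Sum>z\<in>box n. 1 / (bracket z)\<^sup>2) = 1 + (\<Sum>k=1..n. 8 * real k * (1 / (1 + real k)\<^sup>2))"
    unfolding bracket_def using sum_box_radial[of "\<lambda>k. 1 / (1 + real k)\<^sup>2" n] by simp
  also have "(\<Sum>k=1..n. 8 * real k * (1 / (1 + real k)\<^sup>2)) \<le> (\<Sum>k=1..n. 8 * (1 / real k))"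
  proof (intro sum_mono)
    fix k assume "k \<in> {1..n}"
    then have k: "real k > 0" by auto
    have "real k / (1 + real k)\<^sup>2 \<le> real k / (real k)\<^sup>2"
      using k by (intro divide_left_mono) (auto simp: power2_eq_square intro!: mult_mono)
    then show "8 * real k * (1 / (1 + real k)\<^sup>2) \<le> 8 * (1 / real k)"
      using k by (simp add: power2_eq_square)
  qed
  also have "\<dots> = 8 * (\<Sum>k=1..n. 1 / real k)" by (simp only: sum_distrib_left)
  finally show ?thesis using sum_inverse_le_ln[OF assms] by linarith
qed

lemma sum_inverse_bracket3_le: "(\<Sum>z\<in>box n. 1 / (bracket z) ^ 3) \<le> 17"
proof -
  have "(\<Sum>z\<in>box n. 1 / (bracket z) ^ 3) = 1 + (\<Sum>k=1..n. 8 * real k * (1 / (1 + real k) ^ 3))"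
    unfolding bracket_def using sum_box_radial[of "\<lambda>k. 1 / (1 + real k) ^ 3" n] by simp
  also have "(\<Sum>k=1..n. 8 * real k * (1 / (1 + real k) ^ 3)) \<le> (\<Sum>k=1..n. 8 * (1 / (real k)\<^sup>2))"
  proof (intro sum_mono)
    fix k assume "k \<in> {1..n}"
    then have k: "real k > 0" by auto
    have "real k / (1 + real k)^3 \<le> real k / (real k)^3"
      using k by (intro divide_left_mono power_mono) auto
    then show "8 * real k * (1 / (1 + real k) ^ 3) \<le> 8 * (1 / (real k)\<^sup>2)"
      using k by (simp add: power2_eq_square power3_eq_cube)
  qed
  also have "\<dots> = 8 * (\<Sum>k=1..n. 1 / (real k)\<^sup>2)" by (simp only: sum_distrib_left)
  finally show ?thesis using sum_inverse_square_le[of n] by linarith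
qed

lemma sum_inverse_bracket_le: "(\<Sum>z\<in>box n. 1 / bracket z) \<le> 1 + 8 * real n"
proof -
  have "(\<Sum>z\<in>box n. 1 / bracket z) = 1 + (\<Sum>k=1..n. 8 * real k * (1 / (1 + real k)))"
    unfolding bracket_def using sum_box_radial[of "\<lambda>k. 1 / (1 + real k)" n] by simp
  also have "(\<Sum>k=1..n. 8 * real k * (1 / (1 + real k))) \<le> (\<Sum>k=1..n. 8)"
    by (intro sum_mono) (auto simp: field_simps)
  finally show ?thesis by simp
qed

lemma sum_inverse_bracket4_tail:
  "(\<Sum>z | z \<in> box n \<and> bracket y \<le> 3 * bracket z. 1 / (bracket z) ^ 4) \<le> 153 / (bracket y)\<^sup>2"
proof -
  \<comment> \<open>This is \<open>bracket y / 3\<close> rounded up, the least value of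
    \<open>k + 1\<close> that the filter admits.\<close>
  define t where "t = (sup_norm y + 3) div 3"
  have t1: "t \<ge> 1" by (simp add: t_def)
  have tJ: "bracket y \<le> 3 * real t" unfolding bracket_def t_def by linarith
  define \<phi> where "\<phi> = (\<lambda>k. if t \<le> k + 1 then 1 / (1 + real k) ^ 4 else 0)"
  have "(\<Sum>z | z \<in> box n \<and> bracket y \<le> 3 * bracket z. 1 / (bracket z) ^ 4) = (\<Sum>z\<in>box n. if bracket y \<le> 3 * bracket z then 1 / (bracket z) ^ 4 else 0)"
    by (simp add: sum.inter_filter)
  also have "\<dots> \<le> (\<Sum>z\<in>box n. \<phi> (sup_norm z))"
  proof (intro sum_mono)
    fix z
    have "t \<le> sup_norm z + 1" if "bracket y \<le> 3 * bracket z"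
    proof -
      have "sup_norm y \<le> 3 * sup_norm z + 2" using that by (simp add: bracket_def)
      then show ?thesis by (simp add: t_def)
    qed
    then show "(if bracket y \<le> 3 * bracket z then 1 / (bracket z) ^ 4 else 0) \<le> \<phi> (sup_norm z)"
      by (auto simp: \<phi>_def bracket_def)
  qed
  also have "\<dots> = \<phi> 0 + (\<Sum>k=1..n. 8 * real k * \<phi> k)" by (rule sum_box_radial)
  also have "(\<Sum>k=1..n. 8 * real k * \<phi> k) \<le> (\<Sum>k\<in>{1..n}. if t \<le> k + 1 then 8 * (1 / (real (k + 1)) ^ 3) else 0)"
  proof (intro sum_mono)
    fix k
    have "real k / (1 + real k) ^ 4 \<le> (1 + real k) / (1 + real k) ^ 4"
      by (intro divide_right_mono) auto
    also have "\<dots> = 1 / (1 + real k) ^ 3" by (simp add: power4_eq_xxxx power3_eq_cube)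
    finally show "8 * real k * \<phi> k \<le> (if t \<le> k + 1 then 8 * (1 / (real (k + 1)) ^ 3) else 0)"
      by (auto simp: \<phi>_def add.commute)
  qed
  also have "\<dots> = (\<Sum>k | k \<in> {1..n} \<and> t \<le> k + 1. 8 * (1 / (real (k + 1)) ^ 3))"
    by (rule sum.inter_filter[symmetric]) simp
  also have "\<dots> = (\<Sum>j\<in>Suc ` {k \<in> {1..n}. t \<le> k + 1}. 8 * (1 / (real j) ^ 3))"
    by (subst sum.reindex) auto
  also have "\<dots> \<le> (\<Sum>j=t..Suc n. 8 * (1 / (real j) ^ 3))"
    by (rule sum_mono2) auto
  also have "\<dots> = 8 * (\<Sum>j=t..Suc n. 1 / (real j) ^ 3)" by (simp only: sum_distrib_left)
  also have "\<dots> \<le> 8 * (2 / (real t)\<^sup>2)"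
    by (rule mult_left_mono[OF sum_inverse_cube_tail[OF t1]]) simp
  also have "\<phi> 0 \<le> 1 / (real t)\<^sup>2" using t1 by (auto simp: \<phi>_def)
  finally have "(\<Sum>z | z \<in> box n \<and> bracket y \<le> 3 * bracket z. 1 / (bracket z) ^ 4) \<le> 17 / (real t)\<^sup>2" by simp
  \<comment> \<open>The 17 consists of 1 from the origin and 16 from the tail; the factor 9 comes
    from \<open>bracket y \<le> 3 * real t\<close>.\<close>
  also have "\<dots> = 153 / (3 * real t)\<^sup>2" by (simp add: power_mult_distrib)
  also have "\<dots> \<le> 153 / (bracket y)\<^sup>2"
    using tJ t1 bracket_pos[of y] less_imp_le[OF bracket_pos[of y]]
    by (intro divide_left_mono power_mono mult_pos_pos zero_less_power) (simp_all del: bracket_pos)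
  finally show ?thesis .
qed

section \<open>Logarithmic test functions\<close>

text \<open>On the lattice \<open>ln norm_sq\<close> is neither super- nor subharmonic: its defect
  has order \<open>|z|^-4\<close> and takes both signs. Shifting the argument adds a term of the
  same order and of fixed sign; the shift is \<open>-1\<close> here and \<open>1 / 2\<close> in
  \<open>sub_log\<close>.\<close>

definition super_log :: "site \<Rightarrow> real" where "super_log z = ln (norm_sq z - 1)"
text \<open>The factor 2 normalises the value at the origin to 0, so that
  \<open>sub_log (S - z)\<close> vanishes at a visit to \<open>z\<close> and is nonnegative
  elsewhere.\<close>

definition sub_log :: "site \<Rightarrow> real" where "sub_log z = ln (2 * norm_sq z + 1)"

definition nbr_avg :: "(site \<Rightarrow> real) \<Rightarrow> site \<Rightarrow> real" where
  "nbr_avg f z = (f (z + (1,0)) + f (z + (-1,0)) + f (z + (0,1)) + f (z + (0,-1))) / 4"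

text \<open>The coefficient of the cookie in the one-step expectation of \<open>f\<close>, as
  \<open>step_hd\<close> shows.\<close>

definition anisotropy :: "(site \<Rightarrow> real) \<Rightarrow> site \<Rightarrow> real" where
  "anisotropy f z = (f (z + (1,0)) + f (z + (-1,0)) - f (z + (0,1)) - f (z + (0,-1))) / 4"

text \<open>Cut off on the box where the walk is stopped; near the origin \<open>super_log\<close>
  would take logarithms of nonpositive numbers.\<close>

definition super_kernel :: "site \<Rightarrow> real" where "super_kernel z = (if sup_norm z \<le> 3 then 0 else anisotropy super_log z)"
definition sub_kernel :: "site \<Rightarrow> real" where "sub_kernel = anisotropy sub_log"

lemma norm_sq_neighbours:
  "norm_sq (z + (1,0)) = norm_sq z + 1 + 2 * of_int (fst z)"
  "norm_sq (z + (-1,0)) = norm_sq z + 1 - 2 * of_int (fst z)"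
  "norm_sq (z + (0,1)) = norm_sq z + 1 + 2 * of_int (snd z)"
  "norm_sq (z + (0,-1)) = norm_sq z + 1 - 2 * of_int (snd z)"
  by (simp_all add: norm_sq_def power2_eq_square algebra_simps)

lemma sup_norm_unit: "e \<in> {(1,0), (-1,0), (0,1), (0,-1)} \<Longrightarrow> sup_norm e = 1"
  by (auto simp: sup_norm_def)

lemma sup_norm_neighbour:
  assumes "e \<in> {(1,0), (-1,0), (0,1), (0,-1)}"
  shows "sup_norm (z + e) \<le> sup_norm z + 1" "sup_norm z \<le> sup_norm (z + e) + 1"
  using sup_norm_triangle[of z e] sup_norm_triangle_diff[of "z + e" e] sup_norm_unit[OF assms] by simp_all

lemma nbr_avg_norm_sq: "nbr_avg norm_sq z = norm_sq z + 1"
  by (simp add: nbr_avg_def norm_sq_neighbours)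

lemma anisotropy_norm_sq: "anisotropy norm_sq z = 0"
  by (simp add: anisotropy_def norm_sq_neighbours)

section \<open>Discrete Laplacian of the shifted logarithms\<close>

lemma four_ln:
  assumes "s + 2 * x > 0" "s - 2 * x > 0" "s + 2 * y > 0" "s - 2 * y > (0::real)"
  shows "ln (s + 2 * x) + ln (s - 2 * x) + ln (s + 2 * y) + ln (s - 2 * y)
    = ln ((s\<^sup>2 - 4 * x\<^sup>2) * (s\<^sup>2 - 4 * y\<^sup>2))"
proof -
  have "(s\<^sup>2 - 4 * x\<^sup>2) * (s\<^sup>2 - 4 * y\<^sup>2) = (s + 2 * x) * (s - 2 * x) * (s + 2 * y) * (s - 2 * y)"
    by (simp add: power2_eq_square algebra_simps)
  then show ?thesis using assms by (simp add: ln_mult)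
qed

text \<open>After exponentiating, the product of the four neighbouring arguments is compared with
  the fourth power of the central one. The difference is a sum of squares up to lower order. Radius
  3 keeps the neighbours at \<open>norm_sq \<ge> 4\<close>, where all arguments are
  positive.\<close>

lemma super_log_superharmonic:
  assumes "sup_norm z \<ge> 3"
  shows "nbr_avg super_log z \<le> super_log z"
proof -
  define s x y where "s = norm_sq z" and "x = (of_int (fst z) :: real)" and "y = (of_int (snd z) :: real)"
  have s: "s = x\<^sup>2 + y\<^sup>2" by (simp add: s_def x_def y_def norm_sq_def)
  have big: "norm_sq u \<ge> 4" if "sup_norm u \<ge> 2" for u
    using norm_sq_ge_sup_norm[of u] power_mono[of 2 "real (sup_norm u)" 2] that by simp
  have "norm_sq (z + e) \<ge> 4" if "e \<in> {(1,0), (-1,0), (0,1), (0,-1)}" for e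
    using sup_norm_neighbour[OF that, of z] assms by (intro big) linarith
  from this[of "(1,0)"] this[of "(-1,0)"] this[of "(0,1)"] this[of "(0,-1)"]
  have p: "s + 2 * x > 0" "s - 2 * x > 0" "s + 2 * y > 0" "s - 2 * y > 0"
    by (auto simp: norm_sq_neighbours s_def x_def y_def)
  have s4: "s \<ge> 4" unfolding s_def by (rule big) (use assms in simp)
  have "0 < (s + 2 * x) * (s - 2 * x) * ((s + 2 * y) * (s - 2 * y))" using p by simp
  also have "\<dots> = (s\<^sup>2 - 4 * x\<^sup>2) * (s\<^sup>2 - 4 * y\<^sup>2)" by (simp add: power2_eq_square algebra_simps)
  finally have pos: "0 < (s\<^sup>2 - 4 * x\<^sup>2) * (s\<^sup>2 - 4 * y\<^sup>2)" .
  have "(s - 1) ^ 4 - (s\<^sup>2 - 4 * x\<^sup>2) * (s\<^sup>2 - 4 * y\<^sup>2)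
      = 4 * (x\<^sup>2 - y\<^sup>2)\<^sup>2 + 2 * s\<^sup>2 - 4 * s + 1"
    unfolding s by (simp add: power2_eq_square power4_eq_xxxx algebra_simps)
  moreover have "2 * s\<^sup>2 - 4 * s \<ge> 0" using s4 by (simp add: power2_eq_square)
  ultimately have "(s\<^sup>2 - 4 * x\<^sup>2) * (s\<^sup>2 - 4 * y\<^sup>2) \<le> (s - 1) ^ 4"
    using zero_le_power2[of "x\<^sup>2 - y\<^sup>2"] by linarith
  then have "ln ((s\<^sup>2 - 4 * x\<^sup>2) * (s\<^sup>2 - 4 * y\<^sup>2)) \<le> ln ((s - 1) ^ 4)"
    using pos by (subst ln_le_cancel_iff) auto
  also have "\<dots> = 4 * ln (s - 1)" using s4 by (simp add: ln_realpow)
  finally show ?thesis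
    unfolding nbr_avg_def super_log_def norm_sq_neighbours using four_ln[OF p]
    by (simp add: s_def x_def y_def)
qed

text \<open>The same comparison of products. The shift \<open>1 / 2\<close> is the one at which the
  pure \<open>s^2\<close> term of the difference cancels; the remainder
  \<open>4 s - 1 + 16 (x y)^2\<close> is nonnegative at every site, the origin included.\<close>

lemma sub_log_subharmonic: "sub_log z \<le> nbr_avg sub_log z"
proof -
  define s x y where "s = norm_sq z + 3 / 2" and "x = (of_int (fst z) :: real)" and "y = (of_int (snd z) :: real)"
  have s: "s = x\<^sup>2 + y\<^sup>2 + 3 / 2" by (simp add: s_def x_def y_def norm_sq_def)
  have p: "s + 2 * x > 0" "s - 2 * x > 0" "s + 2 * y > 0" "s - 2 * y > 0"
  proof -
    have *: "2 * t \<le> t\<^sup>2 + 1" "- (2 * t) \<le> t\<^sup>2 + 1" for t :: real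
      using zero_le_power2[of "t - 1"] zero_le_power2[of "t + 1"]
      by (simp_all add: power2_sum power2_diff)
    show "s + 2 * x > 0" "s - 2 * x > 0" "s + 2 * y > 0" "s - 2 * y > 0"
      unfolding s using *[of x] *[of y] zero_le_power2[of x] zero_le_power2[of y] by linarith+
  qed
  have s1: "s \<ge> 3 / 2" by (simp add: s)
  have "(s\<^sup>2 - 4 * x\<^sup>2) * (s\<^sup>2 - 4 * y\<^sup>2) - (s - 1) ^ 4 = 4 * s - 1 + 16 * (x * y)\<^sup>2"
  proof -
    have "(s\<^sup>2 - 4 * x\<^sup>2) * (s\<^sup>2 - 4 * y\<^sup>2) = s ^ 4 - s\<^sup>2 * (4 * (x\<^sup>2 + y\<^sup>2)) + 16 * (x * y)\<^sup>2"
      by (simp add: power2_eq_square power4_eq_xxxx algebra_simps)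
    also have "4 * (x\<^sup>2 + y\<^sup>2) = 4 * s - 6" by (simp add: s)
    finally show ?thesis by (simp only:) (simp add: power2_eq_square power4_eq_xxxx algebra_simps)
  qed
  moreover have "4 * s - 1 \<ge> 0" "16 * (x * y)\<^sup>2 \<ge> 0" using s1 by simp_all
  ultimately have "(s - 1) ^ 4 \<le> (s\<^sup>2 - 4 * x\<^sup>2) * (s\<^sup>2 - 4 * y\<^sup>2)"
    by linarith
  then have "ln ((s - 1) ^ 4) \<le> ln ((s\<^sup>2 - 4 * x\<^sup>2) * (s\<^sup>2 - 4 * y\<^sup>2))"
    using s1 by (subst ln_le_cancel_iff) (auto intro: less_le_trans[of _ "(s - 1) ^ 4"])
  moreover have "ln ((s - 1) ^ 4) = 4 * ln (s - 1)" using s1 by (simp add: ln_realpow)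
  ultimately have main: "4 * ln (s - 1) \<le> ln (s + 2 * x) + ln (s - 2 * x) + ln (s + 2 * y) + ln (s - 2 * y)"
    using four_ln[OF p] by simp
  have "sub_log z = ln (2 * (s - 1))" by (simp add: sub_log_def s_def algebra_simps)
  also have "\<dots> = ln 2 + ln (s - 1)" using s1 by (intro ln_mult_pos) auto
  finally have 0: "sub_log z = ln 2 + ln (s - 1)" .
  have "sub_log (z + (1,0)) = ln (2 * (s + 2 * x))" "sub_log (z + (-1,0)) = ln (2 * (s - 2 * x))"
    "sub_log (z + (0,1)) = ln (2 * (s + 2 * y))" "sub_log (z + (0,-1)) = ln (2 * (s - 2 * y))"
    by (simp_all add: sub_log_def s_def x_def y_def norm_sq_neighbours algebra_simps)
  then have "sub_log (z + (1,0)) = ln 2 + ln (s + 2 * x)" "sub_log (z + (-1,0)) = ln 2 + ln (s - 2 * x)"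
    "sub_log (z + (0,1)) = ln 2 + ln (s + 2 * y)" "sub_log (z + (0,-1)) = ln 2 + ln (s - 2 * y)"
    using p by (simp_all only: ln_mult_pos zero_less_numeral)
  then show ?thesis unfolding nbr_avg_def 0 using main by simp
qed

section \<open>Anisotropy of the shifted logarithms\<close>

text \<open>Expand \<open>ln (1 - 4 t^2 / s^2)\<close> to first order for \<open>t = x\<close> and
  \<open>t = y\<close>; the common \<open>2 ln s\<close> cancels in the difference. The two
  expansion errors contribute \<open>2 * 32 / 4 = 16\<close>, and replacing \<open>s\<close> by
  \<open>\<rho>\<close> contributes 4.\<close>

lemma ln_anisotropy_estimate:
  fixes x y s \<rho> :: real
  assumes \<rho>: "\<rho> = x\<^sup>2 + y\<^sup>2" and "\<rho> \<ge> 8" and s: "\<rho> \<le> s" "s \<le> \<rho> + 2"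
  shows "\<bar>(ln (s\<^sup>2 - 4 * x\<^sup>2) - ln (s\<^sup>2 - 4 * y\<^sup>2)) / 4 - (y\<^sup>2 - x\<^sup>2) / \<rho>\<^sup>2\<bar> \<le> 20 / \<rho>\<^sup>2"
proof -
  have s8: "s \<ge> 8" using assms by linarith
  have key: "\<bar>ln (s\<^sup>2 - 4 * t\<^sup>2) - 2 * ln s + 4 * t\<^sup>2 / s\<^sup>2\<bar> \<le> 32 / s\<^sup>2" if "t\<^sup>2 \<le> \<rho>" for t
  proof -
    define \<alpha> where "\<alpha> = 4 * t\<^sup>2 / s\<^sup>2"
    have "t\<^sup>2 \<le> s" using that s by linarith
    then have "4 * t\<^sup>2 / s\<^sup>2 \<le> 4 * s / s\<^sup>2" by (intro divide_right_mono) auto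
    then have a: "\<alpha> \<le> 4 / s" using s8 by (simp add: \<alpha>_def power2_eq_square)
    have a0: "\<alpha> \<ge> 0" by (simp add: \<alpha>_def)
    have "4 / s \<le> 1 / 2" using s8 by simp
    then have a2: "\<alpha> \<le> 1 / 2" using a by linarith
    have "s\<^sup>2 - 4 * t\<^sup>2 = s\<^sup>2 * (1 + - \<alpha>)" using s8 by (simp add: \<alpha>_def field_simps)
    then have "ln (s\<^sup>2 - 4 * t\<^sup>2) = ln (s\<^sup>2) + ln (1 + - \<alpha>)"
      using s8 a2 by (simp only: ln_mult_pos) (rule ln_mult_pos, auto)
    also have "ln (s\<^sup>2) = 2 * ln s" using s8 by (simp add: ln_realpow)
    finally have "\<bar>ln (s\<^sup>2 - 4 * t\<^sup>2) - 2 * ln s + \<alpha>\<bar> = \<bar>ln (1 + - \<alpha>) - - \<alpha>\<bar>" by simp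
    also have "\<dots> \<le> 2 * (- \<alpha>)\<^sup>2"
      using a0 a2 by (intro abs_ln_one_plus_x_minus_x_bound) auto
    also have "\<dots> \<le> 2 * (4 / s)\<^sup>2" using a a0 by (simp add: power_mono)
    finally show ?thesis by (simp add: \<alpha>_def power_divide)
  qed
  have k: "\<bar>ln (s\<^sup>2 - 4 * x\<^sup>2) - 2 * ln s + 4 * x\<^sup>2 / s\<^sup>2\<bar> \<le> 32 / s\<^sup>2"
    "\<bar>ln (s\<^sup>2 - 4 * y\<^sup>2) - 2 * ln s + 4 * y\<^sup>2 / s\<^sup>2\<bar> \<le> 32 / s\<^sup>2"
    by (rule key, simp add: \<rho>)+
  have rs: "0 < s\<^sup>2 * \<rho>\<^sup>2"
    using assms(2) s8 by (intro mult_pos_pos zero_less_power) auto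
  have inv: "1 / s\<^sup>2 \<le> 1 / \<rho>\<^sup>2"
    by (intro divide_left_mono power_mono) (use rs assms(2) s in auto)
  then have s_le: "16 / s\<^sup>2 \<le> 16 / \<rho>\<^sup>2" by simp
  have "\<bar>(y\<^sup>2 - x\<^sup>2) / s\<^sup>2 - (y\<^sup>2 - x\<^sup>2) / \<rho>\<^sup>2\<bar> = \<bar>y\<^sup>2 - x\<^sup>2\<bar> * (1 / \<rho>\<^sup>2 - 1 / s\<^sup>2)"
  proof -
    have "t / a - t / c = t * - (1 / c - 1 / a)" for t a c :: real
      by (simp add: divide_inverse right_diff_distrib)
    note this[of "y\<^sup>2 - x\<^sup>2" "s\<^sup>2" "\<rho>\<^sup>2"]
    then have "\<bar>(y\<^sup>2 - x\<^sup>2) / s\<^sup>2 - (y\<^sup>2 - x\<^sup>2) / \<rho>\<^sup>2\<bar> = \<bar>y\<^sup>2 - x\<^sup>2\<bar> * \<bar>1 / \<rho>\<^sup>2 - 1 / s\<^sup>2\<bar>"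
      by (simp only: abs_mult abs_minus_cancel)
    then show ?thesis using inv by simp
  qed
  also have "\<dots> \<le> \<rho> * (4 / (s * \<rho>\<^sup>2))"
  proof (intro mult_mono)
    show "\<bar>y\<^sup>2 - x\<^sup>2\<bar> \<le> \<rho>" by (auto simp: \<rho> abs_le_iff)
    have "1 / \<rho>\<^sup>2 - 1 / s\<^sup>2 = ((s - \<rho>) * (s + \<rho>)) / (s\<^sup>2 * \<rho>\<^sup>2)"
      using assms(2) s8 by (simp add: divide_simps power2_eq_square) (simp add: algebra_simps)
    also have "\<dots> \<le> (2 * (2 * s)) / (s\<^sup>2 * \<rho>\<^sup>2)"
      using assms by (intro divide_right_mono mult_mono) auto
    also have "\<dots> = 4 / (s * \<rho>\<^sup>2)" using s8 by (simp add: power2_eq_square)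
    finally show "1 / \<rho>\<^sup>2 - 1 / s\<^sup>2 \<le> 4 / (s * \<rho>\<^sup>2)" .
    show "0 \<le> 1 / \<rho>\<^sup>2 - 1 / s\<^sup>2" using inv by simp
  qed (use assms in auto)
  also have "\<dots> = 4 / (s * \<rho>)" using assms(2) by (simp add: power2_eq_square)
  also have "\<dots> \<le> 4 / (\<rho> * \<rho>)"
    by (intro divide_left_mono mult_right_mono mult_pos_pos) (use assms(2) s s8 in auto)
  also have "\<dots> = 4 / \<rho>\<^sup>2" by (simp add: power2_eq_square)
  finally have d: "\<bar>(y\<^sup>2 - x\<^sup>2) / s\<^sup>2 - (y\<^sup>2 - x\<^sup>2) / \<rho>\<^sup>2\<bar> \<le> 4 / \<rho>\<^sup>2" .
  have e: "(y\<^sup>2 - x\<^sup>2) / s\<^sup>2 = (4 * y\<^sup>2 / s\<^sup>2 - 4 * x\<^sup>2 / s\<^sup>2) / 4" by (simp add: diff_divide_distrib)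
  have "\<bar>(a - b) / 4 - e\<bar> \<le> u / 2 + v"
    if "\<bar>a - l + p\<bar> \<le> u" "\<bar>b - l + q\<bar> \<le> u" "\<bar>d - e\<bar> \<le> v" "d = (q - p) / 4" for a b d e l p q u v :: real
    using that by (auto simp: abs_le_iff field_simps)
  from this[OF k d e] show ?thesis using s_le by simp
qed

text \<open>The true order of the error is \<open>1 / bracket^4\<close>. The cube is already
  summable over the plane, and the constant 600 leaves room for the sites near the origin in the two
  kernel estimates.\<close>

lemma anisotropy_ln:
  fixes c :: real
  assumes c: "- 1 \<le> c" "c \<le> 1" and z: "sup_norm z \<ge> 3"
    and f: "\<And>u. f u = ln (norm_sq u + c) + d"
  shows "\<bar>anisotropy f z - kern z\<bar> \<le> 600 / (bracket z) ^ 3"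
proof -
  define s x y where "s = norm_sq z + 1 + c" and "x = (of_int (fst z) :: real)" and "y = (of_int (snd z) :: real)"
  have \<rho>: "norm_sq z = x\<^sup>2 + y\<^sup>2" by (simp add: x_def y_def norm_sq_def)
  have big: "norm_sq u \<ge> 4" if "sup_norm u \<ge> 2" for u
    using norm_sq_ge_sup_norm[of u] power_mono[of 2 "real (sup_norm u)" 2] that by simp
  have r9: "norm_sq z \<ge> 9"
    using norm_sq_ge_sup_norm[of z] power_mono[of 3 "real (sup_norm z)" 2] z by simp
  have "norm_sq (z + e) \<ge> 4" if "e \<in> {(1,0), (-1,0), (0,1), (0,-1)}" for e
    using sup_norm_neighbour[OF that, of z] z by (intro big) linarith
  from this[of "(1,0)"] this[of "(-1,0)"] this[of "(0,1)"] this[of "(0,-1)"]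
  have p: "s + 2 * x > 0" "s - 2 * x > 0" "s + 2 * y > 0" "s - 2 * y > 0"
    using c by (auto simp: norm_sq_neighbours s_def x_def y_def)
  have "s\<^sup>2 - 4 * x\<^sup>2 = (s + 2 * x) * (s - 2 * x)" "s\<^sup>2 - 4 * y\<^sup>2 = (s + 2 * y) * (s - 2 * y)"
    by (simp_all add: power2_eq_square algebra_simps)
  then have l: "ln (s\<^sup>2 - 4 * x\<^sup>2) = ln (s + 2 * x) + ln (s - 2 * x)"
    "ln (s\<^sup>2 - 4 * y\<^sup>2) = ln (s + 2 * y) + ln (s - 2 * y)"
    using p by (simp_all only: ln_mult_pos)
  have "anisotropy f z = (ln (s\<^sup>2 - 4 * x\<^sup>2) - ln (s\<^sup>2 - 4 * y\<^sup>2)) / 4"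
    unfolding anisotropy_def f norm_sq_neighbours l by (simp add: s_def x_def y_def algebra_simps)
  moreover have "kern z = (y\<^sup>2 - x\<^sup>2) / (norm_sq z)\<^sup>2" by (simp add: kern_def x_def y_def)
  moreover have "\<bar>(ln (s\<^sup>2 - 4 * x\<^sup>2) - ln (s\<^sup>2 - 4 * y\<^sup>2)) / 4 - (y\<^sup>2 - x\<^sup>2) / (norm_sq z)\<^sup>2\<bar> \<le> 20 / (norm_sq z)\<^sup>2"
    by (rule ln_anisotropy_estimate[OF \<rho>]) (use c r9 in \<open>auto simp: s_def\<close>)
  ultimately have "\<bar>anisotropy f z - kern z\<bar> \<le> 20 / (norm_sq z)\<^sup>2" by (simp only:)
  also have "\<dots> \<le> 20 / (((bracket z / 2)\<^sup>2)\<^sup>2)"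
  proof (intro divide_left_mono power_mono)
    have "(bracket z / 2)\<^sup>2 \<le> (real (sup_norm z))\<^sup>2" using z by (intro power_mono) (auto simp: bracket_def)
    then show "(bracket z / 2)\<^sup>2 \<le> norm_sq z" using norm_sq_ge_sup_norm[of z] by linarith
  qed (use r9 bracket_pos[of z] in \<open>auto intro!: mult_pos_pos zero_less_power\<close>)
  also have "\<dots> = 320 / (bracket z) ^ 4" by (simp add: power_divide flip: power_mult)
  also have "\<dots> \<le> 600 / (bracket z) ^ 3"
    by (intro frac_le power_increasing) auto
  finally show ?thesis .
qed

lemma super_kernel_estimate: "\<bar>super_kernel z - kern z\<bar> \<le> 600 / (bracket z) ^ 3"
proof (cases "sup_norm z \<le> 3")
  case True
  then have "bracket z ^ 3 \<le> 4 ^ 3" by (intro power_mono) (auto simp: bracket_def)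
  then have "1 \<le> 600 / bracket z ^ 3" by (simp add: le_divide_eq zero_less_power)
  with abs_kern_le_1[of z] have "\<bar>kern z\<bar> \<le> 600 / bracket z ^ 3" by (rule order_trans)
  then show ?thesis using True by (simp add: super_kernel_def)
next
  case False
  have "super_log u = ln (norm_sq u + - 1) + 0" for u by (simp add: super_log_def)
  then show ?thesis using anisotropy_ln[of "-1" z super_log 0] False by (simp add: super_kernel_def)
qed

lemma sub_log_nonneg [simp]: "sub_log z \<ge> 0" by (simp add: sub_log_def)
lemma sub_log_zero [simp]: "sub_log 0 = 0" by (simp add: sub_log_def norm_sq_def)

lemma sub_kernel_estimate: "\<bar>sub_kernel z - kern z\<bar> \<le> 600 / (bracket z) ^ 3"
proof (cases "sup_norm z < 3")
  case True
  have nb: "sub_log (z + e) \<le> 36" if "e \<in> {(1,0), (-1,0), (0,1), (0,-1)}" for e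
  proof -
    have "sup_norm (z + e) \<le> 3" using sup_norm_neighbour[OF that, of z] True by linarith
    then have "(real (sup_norm (z + e)))\<^sup>2 \<le> 3\<^sup>2" by (intro power_mono) auto
    then have "norm_sq (z + e) \<le> 18" using norm_sq_le_sup_norm[of "z + e"] by simp
    moreover have "sub_log (z + e) \<le> 2 * norm_sq (z + e)"
      unfolding sub_log_def using ln_add_one_self_le_self[of "2 * norm_sq (z + e)"] by (simp add: add.commute)
    ultimately show ?thesis by linarith
  qed
  have "\<bar>sub_kernel z\<bar> \<le> 18"
    unfolding sub_kernel_def anisotropy_def
    using nb[of "(1,0)"] nb[of "(-1,0)"] nb[of "(0,1)"] nb[of "(0,-1)"]
      sub_log_nonneg[of "z + (1,0)"] sub_log_nonneg[of "z + (-1,0)"] sub_log_nonneg[of "z + (0,1)"] sub_log_nonneg[of "z + (0,-1)"]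
    by (simp add: abs_le_iff del: sub_log_nonneg)
  then have "\<bar>sub_kernel z - kern z\<bar> \<le> 19" using abs_kern_le_1[of z] by linarith
  also have "bracket z ^ 3 \<le> 3 ^ 3" using True by (intro power_mono) (auto simp: bracket_def)
  \<comment> \<open>Here \<open>19 * 27 = 513\<close> is what the constant 600 has to cover.\<close>
  then have "19 \<le> 600 / bracket z ^ 3" by (simp add: le_divide_eq zero_less_power)
  finally show ?thesis .
next
  case False
  have "sub_log u = ln (norm_sq u + 1 / 2) + ln 2" for u
  proof -
    have "2 * norm_sq u + 1 = (norm_sq u + 1 / 2) * 2" by simp
    moreover have "norm_sq u + 1 / 2 > 0" using norm_sq_nonneg[of u] by linarith
    ultimately show ?thesis unfolding sub_log_def by (simp only: ln_mult_pos zero_less_numeral)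
  qed
  then show ?thesis using anisotropy_ln[of "1/2" z sub_log "ln 2"] False by (simp add: sub_kernel_def)
qed

lemma abs_sub_kernel_le: "\<bar>sub_kernel z\<bar> \<le> 604 / (bracket z)\<^sup>2"
proof -
  have "600 / bracket z ^ 3 \<le> 600 / (bracket z)\<^sup>2"
    by (intro divide_left_mono power_increasing) auto
  moreover have "600 / (bracket z)\<^sup>2 + 4 / (bracket z)\<^sup>2 = 604 / (bracket z)\<^sup>2" by (simp add: add_divide_distrib[symmetric])
  ultimately show ?thesis using sub_kernel_estimate[of z] abs_kern_le_bracket[of z] by linarith
qed

section \<open>Histories and stopped expectations\<close>

text \<open>
  A history lists the visited sites, newest first. In history \<open>h\<close> the walk is about to make
  departure number \<open>count_list h (hd h)\<close> from \<open>hd h\<close>.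
\<close>

definition cookie :: "(site \<Rightarrow> nat \<Rightarrow> real) \<Rightarrow> site list \<Rightarrow> real" where
  "cookie \<beta> h = \<beta> (hd h) (count_list h (hd h))"

abbreviation dirs :: "site set" where
  "dirs \<equiv> {(1,0), (-1,0), (0,1), (0,-1)}"

definition step_prob :: "(site \<Rightarrow> nat \<Rightarrow> real) \<Rightarrow> site list \<Rightarrow> site \<Rightarrow> real" where
  "step_prob \<beta> h e = (if e \<in> {(1,0), (-1,0)} then 1 + cookie \<beta> h else 1 - cookie \<beta> h) / 4"

definition step_exp :: "(site \<Rightarrow> nat \<Rightarrow> real) \<Rightarrow> (site list \<Rightarrow> real) \<Rightarrow> site list \<Rightarrow> real" where
  "step_exp \<beta> F h = (\<Sum>e\<in>dirs. step_prob \<beta> h e * F ((hd h + e) # h))"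

text \<open>The expectation of \<open>F\<close> at the stopping time capped at \<open>n\<close>
  steps, by backward recursion. Living on histories, it lets the whole potential argument run
  without a probability space.\<close>

primrec stopped_exp :: "(site \<Rightarrow> nat \<Rightarrow> real) \<Rightarrow> (site list \<Rightarrow> bool) \<Rightarrow> (site list \<Rightarrow> real) \<Rightarrow> nat \<Rightarrow> site list \<Rightarrow> real" where
  "stopped_exp \<beta> stp F 0 = F"
| "stopped_exp \<beta> stp F (Suc n) = (\<lambda>h. if stp h then F h else step_exp \<beta> (stopped_exp \<beta> stp F n) h)"

lemma step_alt:
  "step_exp \<beta> F h = (1 + cookie \<beta> h) / 4 * (F ((hd h + (1,0)) # h) + F ((hd h + (-1,0)) # h))
     + (1 - cookie \<beta> h) / 4 * (F ((hd h + (0,1)) # h) + F ((hd h + (0,-1)) # h))"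
  unfolding step_exp_def step_prob_def by (simp add: algebra_simps)

lemma sum_step_prob: "(\<Sum>e\<in>dirs. step_prob \<beta> h e) = 1"
  unfolding step_prob_def by (simp add: field_simps)

lemma step_const [simp]: "step_exp \<beta> (\<lambda>_. c) h = c"
  using sum_step_prob[of \<beta> h] by (simp only: step_exp_def flip: sum_distrib_right)

lemma step_add: "step_exp \<beta> (\<lambda>h. F h + G h) h = step_exp \<beta> F h + step_exp \<beta> G h"
  by (simp add: step_exp_def sum.distrib distrib_left)

lemma step_diff: "step_exp \<beta> (\<lambda>h. F h - G h) h = step_exp \<beta> F h - step_exp \<beta> G h"
  by (simp add: step_exp_def sum_subtractf right_diff_distrib)

lemma step_cmult: "step_exp \<beta> (\<lambda>h. c * F h) h = c * step_exp \<beta> F h"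
  by (simp only: step_exp_def sum_distrib_left mult.left_commute)

lemma step_sum: "step_exp \<beta> (\<lambda>h. \<Sum>i\<in>I. F i h) h = (\<Sum>i\<in>I. step_exp \<beta> (F i) h)"
proof -
  have "step_exp \<beta> (\<lambda>h. \<Sum>i\<in>I. F i h) h = (\<Sum>e\<in>dirs. \<Sum>i\<in>I. step_prob \<beta> h e * F i ((hd h + e) # h))"
    unfolding step_exp_def by (simp only: sum_distrib_left)
  also have "\<dots> = (\<Sum>i\<in>I. step_exp \<beta> (F i) h)"
    unfolding step_exp_def by (rule sum.swap)
  finally show ?thesis .
qed

lemma step_cong:
  "(\<And>e. e \<in> dirs \<Longrightarrow> F ((hd h + e) # h) = G ((hd h + e) # h)) \<Longrightarrow> step_exp \<beta> F h = step_exp \<beta> G h"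
  unfolding step_exp_def by (rule sum.cong) auto

lemma step_hd: "step_exp \<beta> (\<lambda>h. f (hd h)) h = nbr_avg f (hd h) + cookie \<beta> h * anisotropy f (hd h)"
  unfolding step_alt nbr_avg_def anisotropy_def by (simp add: field_simps)

section \<open>Additive functionals of a history\<close>

text \<open>Sums \<open>\<phi>\<close> over the histories at which a departure has already been
  made, that is, over the proper nonempty suffixes. The step out of the current history is still to
  come.\<close>

primrec accumulate :: "(site list \<Rightarrow> real) \<Rightarrow> site list \<Rightarrow> real" where
  "accumulate \<phi> [] = 0"
| "accumulate \<phi> (y # h) = accumulate \<phi> h + (if h = [] then 0 else \<phi> h)"

lemma accumulate_cong:
  assumes "set (tl h) \<subseteq> S" and "\<And>h. h \<noteq> [] \<Longrightarrow> set h \<subseteq> S \<Longrightarrow> \<phi> h = \<psi> h"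
  shows "accumulate \<phi> h = accumulate \<psi> h"
  using assms(1)
proof (induction h)
  case (Cons y h)
  then have "set (tl h) \<subseteq> S" by (cases h) auto
  then show ?case using Cons assms(2) by auto
qed simp

lemma accumulate_sum: "accumulate (\<lambda>h. \<Sum>i\<in>I. \<phi> i h) h = (\<Sum>i\<in>I. accumulate (\<phi> i) h)"
  by (induction h) (auto simp: sum.distrib)

lemma accumulate_cmult: "accumulate (\<lambda>h. c * \<phi> h) h = c * accumulate \<phi> h"
  by (induction h) (auto simp: algebra_simps)

lemma accumulate_diff: "accumulate (\<lambda>h. \<phi> h - \<psi> h) h = accumulate \<phi> h - accumulate \<psi> h"
  by (induction h) auto

lemma accumulate_mono: "(\<And>h. h \<noteq> [] \<Longrightarrow> \<phi> h \<le> \<psi> h) \<Longrightarrow> accumulate \<phi> h \<le> accumulate \<psi> h"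
  by (induction h) (auto intro: add_mono)

lemma accumulate_nonneg: "(\<And>h. h \<noteq> [] \<Longrightarrow> 0 \<le> \<phi> h) \<Longrightarrow> 0 \<le> accumulate \<phi> h"
  by (induction h) auto

lemma accumulate_const_le: "c \<ge> 0 \<Longrightarrow> accumulate (\<lambda>_. c) h \<le> c * length h"
  by (induction h) (auto simp: algebra_simps)

text \<open>
  With \<open>s\<close> the positive or negative part, \<open>eaten s \<beta> y h\<close> is the cookie mass of that sign
  consumed at \<open>y\<close>, and \<open>eaten_before s \<beta> z y h\<close> the part consumed before the first visit to \<open>z\<close>.
\<close>

definition eaten :: "(real \<Rightarrow> real) \<Rightarrow> (site \<Rightarrow> nat \<Rightarrow> real) \<Rightarrow> site \<Rightarrow> site list \<Rightarrow> real" where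
  "eaten s \<beta> y h = accumulate (\<lambda>h. if hd h = y then s (cookie \<beta> h) else 0) h"

definition eaten_before :: "(real \<Rightarrow> real) \<Rightarrow> (site \<Rightarrow> nat \<Rightarrow> real) \<Rightarrow> site \<Rightarrow> site \<Rightarrow> site list \<Rightarrow> real" where
  "eaten_before s \<beta> z y h = accumulate (\<lambda>h. if hd h = y \<and> z \<notin> set h then s (cookie \<beta> h) else 0) h"

text \<open>The visits listed in \<open>tl h\<close> are the completed departures, and departure
  number \<open>j\<close> from \<open>y\<close> consumes cookie \<open>j\<close>.\<close>

lemma eaten_eq: "eaten s \<beta> y h = (\<Sum>j=1..count_list (tl h) y. s (\<beta> y j))"
proof (induction h)
  case (Cons x h)
  show ?case
  proof (cases h)
    case (Cons u h')
    then have "eaten s \<beta> y (x # h) = eaten s \<beta> y h + (if u = y then s (\<beta> y (count_list h y)) else 0)"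
      by (simp add: eaten_def cookie_def)
    then show ?thesis using Cons.IH Cons by simp
  qed (simp add: eaten_def)
qed (simp add: eaten_def)

lemma eaten_before_le:
  assumes "\<And>b. s b \<ge> 0"
  shows "0 \<le> eaten_before s \<beta> z y h" "eaten_before s \<beta> z y h \<le> eaten s \<beta> y h"
  unfolding eaten_before_def eaten_def by (auto intro!: accumulate_nonneg accumulate_mono simp: assms)

lemma eaten_unvisited: "y \<notin> set h \<Longrightarrow> eaten s \<beta> y h = 0"
  unfolding eaten_eq by (cases h) auto

text \<open>Of two sites one is visited first, and nothing is eaten at the other one before that.\<close>

lemma eaten_before_exclusive:
  assumes s: "\<And>b. s b \<ge> 0"
  shows "eaten_before s \<beta> z y h = 0 \<or> eaten_before s \<beta> y z h = 0"
proof -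
  have unv: "eaten_before s \<beta> z y h = 0" if "y \<notin> set h" for y z h
  proof (rule order_antisym)
    show "eaten_before s \<beta> z y h \<le> 0"
      using eaten_before_le(2)[of s \<beta> z y h] s eaten_unvisited[OF that] by simp
  qed (use eaten_before_le(1)[of s] s in blast)
  show ?thesis
  proof (induction h)
    case (Cons x h)
    show ?case
    proof (cases "h = []")
      case False
      then have hd: "hd h \<in> set h" by simp
      have eq: "eaten_before s \<beta> z y (x # h) = eaten_before s \<beta> z y h
          + (if hd h = y \<and> z \<notin> set h then s (cookie \<beta> h) else 0)" for z y
        using False by (simp add: eaten_before_def)
      show ?thesis
      proof (cases "y \<in> set h \<and> z \<in> set h")
        case True
        then show ?thesis unfolding eq using Cons by auto
      next
        case False
        then show ?thesis
          unfolding eq using unv[of y h z] unv[of z h y] hd by auto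
      qed
    qed (simp add: eaten_before_def)
  qed (simp add: eaten_before_def)
qed

text \<open>Bounds on partial sums are all that a finite history can feel. Fixing the total at
  \<open>8 / 7\<close>, instead of bounding it, turns the final comparison into arithmetic.\<close>

locale cookie_walk =
  fixes \<beta> :: "site \<Rightarrow> nat \<Rightarrow> real" and A B :: real
  assumes abs_cookie_le: "\<And>z j. j \<ge> 1 \<Longrightarrow> \<bar>\<beta> z j\<bar> \<le> 1"
    and A_bound: "\<And>z n. (\<Sum>j=1..n. max (\<beta> z j) 0) \<le> A"
    and B_bound: "\<And>z n. (\<Sum>j=1..n. max (- \<beta> z j) 0) \<le> B"
    and A_plus_B: "A + B = 8 / 7"
begin

lemma A_nonneg [simp]: "A \<ge> 0" and B_nonneg [simp]: "B \<ge> 0"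
  using A_bound[of _ 0] B_bound[of _ 0] by simp_all

lemma abs_cookie: "h \<noteq> [] \<Longrightarrow> \<bar>cookie \<beta> h\<bar> \<le> 1"
  unfolding cookie_def by (rule abs_cookie_le) (cases h, auto)

lemma step_prob_nonneg: "h \<noteq> [] \<Longrightarrow> step_prob \<beta> h e \<ge> 0"
  using abs_cookie[of h] by (auto simp: step_prob_def abs_le_iff)

lemma step_mono:
  assumes "h \<noteq> []" "\<And>e. e \<in> dirs \<Longrightarrow> F ((hd h + e) # h) \<le> G ((hd h + e) # h)"
  shows "step_exp \<beta> F h \<le> step_exp \<beta> G h"
  unfolding step_exp_def using assms step_prob_nonneg by (intro sum_mono mult_left_mono) auto

section \<open>Comparison principles for stopped expectations\<close>

text \<open>An invariant of all histories reachable up to the stopping time; it carries facts such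
  as confinement to a box into the comparison lemmas.\<close>

definition closed_under_steps :: "(site list \<Rightarrow> bool) \<Rightarrow> (site list \<Rightarrow> bool) \<Rightarrow> bool" where
  "closed_under_steps stp I \<longleftrightarrow>
     (\<forall>h. I h \<longrightarrow> h \<noteq> [] \<and> (\<not> stp h \<longrightarrow> (\<forall>e\<in>dirs. I ((hd h + e) # h))))"

lemma stopped_exp_mono:
  assumes I: "closed_under_steps stp I" and "I h" and "\<And>h. I h \<Longrightarrow> F h \<le> G h"
  shows "stopped_exp \<beta> stp F n h \<le> stopped_exp \<beta> stp G n h"
  using \<open>I h\<close>
proof (induction n arbitrary: h)
  case (Suc n)
  show ?case
  proof (cases "stp h")
    case False
    then have "step_exp \<beta> (stopped_exp \<beta> stp F n) h \<le> step_exp \<beta> (stopped_exp \<beta> stp G n) h"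
      using I Suc by (intro step_mono) (auto simp: closed_under_steps_def)
    then show ?thesis using False by simp
  qed (use assms Suc in simp)
qed (use assms in simp)

lemma stopped_exp_supermartingale:
  assumes I: "closed_under_steps stp I" and "I h"
    and super: "\<And>h. I h \<Longrightarrow> \<not> stp h \<Longrightarrow> step_exp \<beta> F h \<le> F h"
  shows "stopped_exp \<beta> stp F n h \<le> F h"
  using \<open>I h\<close>
proof (induction n arbitrary: h)
  case (Suc n)
  show ?case
  proof (cases "stp h")
    case False
    then have "step_exp \<beta> (stopped_exp \<beta> stp F n) h \<le> step_exp \<beta> F h"
      using I Suc by (intro step_mono) (auto simp: closed_under_steps_def)
    then show ?thesis using False super[OF Suc.prems] by simp
  qed simp
qed simp

lemma stopped_exp_cmult: "stopped_exp \<beta> stp (\<lambda>h. c * F h) n h = c * stopped_exp \<beta> stp F n h"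
  by (induction n arbitrary: h) (auto simp: step_cmult[symmetric] intro!: step_cong)

lemma stopped_exp_add: "stopped_exp \<beta> stp (\<lambda>h. F h + G h) n h = stopped_exp \<beta> stp F n h + stopped_exp \<beta> stp G n h"
  by (induction n arbitrary: h) (auto simp: step_add[symmetric] intro!: step_cong)

lemma stopped_exp_const: "stopped_exp \<beta> stp (\<lambda>_. c) n h = c"
proof (induction n arbitrary: h)
  case (Suc n)
  have "stopped_exp \<beta> stp (\<lambda>_. c) n = (\<lambda>_. c)" using Suc by auto
  then show ?case by simp
qed simp

text \<open>The mean increment of \<open>norm_sq\<close> is 1 whatever the cookie, since its
  anisotropy vanishes. A walk confined to \<open>norm_sq \<le> K\<close> therefore cannot stay
  unstopped for long.\<close>

lemma stopped_exp_unstopped_le: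
  assumes I: "closed_under_steps stp I" and "I h" and K: "\<And>h. I h \<Longrightarrow> norm_sq (hd h) \<le> K"
  shows "real n * stopped_exp \<beta> stp (\<lambda>h. of_bool (\<not> stp h)) n h \<le> K - norm_sq (hd h)"
  using \<open>I h\<close>
proof (induction n arbitrary: h)
  case (Suc n)
  let ?u = "\<lambda>n. stopped_exp \<beta> stp (\<lambda>h. of_bool (\<not> stp h)) n"
  show ?case
  proof (cases "stp h")
    case True
    then show ?thesis using K[OF Suc.prems] by simp
  next
    case False
    have "h \<noteq> []" using I Suc.prems by (auto simp: closed_under_steps_def)
    have nxt: "I ((hd h + e) # h)" if "e \<in> dirs" for e
      using I Suc.prems False that by (auto simp: closed_under_steps_def)
    have u1: "?u n ((hd h + e) # h) \<le> 1" if "e \<in> dirs" for e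
      using stopped_exp_mono[OF I nxt[OF that], of "\<lambda>h. of_bool (\<not> stp h)" "\<lambda>_. 1" n] by (simp add: stopped_exp_const)
    have "real (Suc n) * ?u (Suc n) h = step_exp \<beta> (\<lambda>h. real (Suc n) * ?u n h) h"
      using False by (simp add: step_cmult)
    also have "\<dots> \<le> step_exp \<beta> (\<lambda>h. (K - norm_sq (hd h)) + 1) h"
    proof (rule step_mono[OF \<open>h \<noteq> []\<close>])
      fix e assume e: "e \<in> dirs"
      show "real (Suc n) * ?u n ((hd h + e) # h) \<le> (K - norm_sq (hd ((hd h + e) # h))) + 1"
        using Suc.IH[OF nxt[OF e]] u1[OF e] by (simp add: distrib_right)
    qed
    also have "\<dots> = K - norm_sq (hd h)"
      by (simp add: step_add step_diff step_hd nbr_avg_norm_sq anisotropy_norm_sq)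
    finally show ?thesis .
  qed
qed (use K in auto)

abbreviation "pos \<equiv> \<lambda>b::real. max b 0"
abbreviation "neg \<equiv> \<lambda>b::real. max (- b) 0"

lemma eaten_le: "eaten pos \<beta> y h \<le> A" "eaten neg \<beta> y h \<le> B"
  unfolding eaten_eq using A_bound B_bound by auto

section \<open>The combined potential\<close>

text \<open>To leading order, the most that the cookies of \<open>z\<close> can push outward:
  positive cookies do so where \<open>kern\<close> is positive, negative ones where it is
  negative.\<close>

definition budget :: "site \<Rightarrow> real" where "budget z = A * kern_pos z + B * kern_neg z"
text \<open>Both parts of \<open>kern\<close> sum to about \<open>2 ln R\<close> over the box, so
  the total mass is about 1.\<close>

definition target_mass :: "nat \<Rightarrow> site \<Rightarrow> real" where "target_mass R z = budget z / (2 * ln R * (A + B))"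

text \<open>What the cookies have contributed so far to the conditional drift of
  \<open>super_log\<close>; \<open>target_drift\<close> plays the same role for
  \<open>target_potential\<close>.\<close>

definition home_drift :: "site list \<Rightarrow> real" where
  "home_drift = accumulate (\<lambda>h. cookie \<beta> h * super_kernel (hd h))"

definition target_drift :: "nat \<Rightarrow> site list \<Rightarrow> real" where
  "target_drift R = accumulate (\<lambda>h. cookie \<beta> h * (\<Sum>z\<in>box R. target_mass R z * (if z \<in> set h then 0 else sub_kernel (hd h - z))))"

text \<open>A visited target contributes 0 for good. Since \<open>sub_log 0 = 0\<close>, each
  summand is \<open>sub_log (S - z)\<close> stopped at the first visit to \<open>z\<close>.\<close>

definition target_potential :: "nat \<Rightarrow> site list \<Rightarrow> real" where
  "target_potential R h = (\<Sum>z\<in>box R. target_mass R z * (if z \<in> set h then 0 else sub_log (hd h - z)))"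

definition stops :: "nat \<Rightarrow> site list \<Rightarrow> bool" where
  "stops R h \<longleftrightarrow> sup_norm (hd h) \<le> 3 \<or> sup_norm (hd h) > R"

lemma budget_nonneg [simp]: "budget z \<ge> 0" by (simp add: budget_def)
lemma target_mass_nonneg: "R \<ge> 1 \<Longrightarrow> target_mass R z \<ge> 0" by (simp add: target_mass_def)

text \<open>Both logarithms are compensated for the cookies, so only their defects from harmonicity
  remain, and these have the right signs.\<close>

lemma potential_supermartingale:
  assumes R: "R \<ge> 1" and h: "h \<noteq> []" "\<not> stops R h"
  shows "step_exp \<beta> (\<lambda>h. super_log (hd h) - home_drift h + target_drift R h - target_potential R h) h \<le> super_log (hd h) - home_drift h + target_drift R h - target_potential R h"
proof -
  let ?b = "cookie \<beta> h"
  have nm3: "sup_norm (hd h) > 3" using h by (auto simp: stops_def)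
  have 1: "step_exp \<beta> (\<lambda>h. super_log (hd h)) h \<le> super_log (hd h) + ?b * super_kernel (hd h)"
    using super_log_superharmonic[of "hd h"] nm3 by (simp add: step_hd super_kernel_def)
  have 2: "step_exp \<beta> home_drift h = home_drift h + ?b * super_kernel (hd h)"
    using step_cong[of home_drift h "\<lambda>_. home_drift h + ?b * super_kernel (hd h)" \<beta>] h by (simp add: home_drift_def)
  define Z where "Z = ?b * (\<Sum>z\<in>box R. target_mass R z * (if z \<in> set h then 0 else sub_kernel (hd h - z)))"
  have 3: "step_exp \<beta> (target_drift R) h = target_drift R h + Z"
    using step_cong[of "target_drift R" h "\<lambda>_. target_drift R h + Z" \<beta>] h by (simp add: target_drift_def Z_def)
  have 4: "step_exp \<beta> (\<lambda>h. if z \<in> set h then 0 else sub_log (hd h - z)) h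
      \<ge> (if z \<in> set h then 0 else sub_log (hd h - z)) + ?b * (if z \<in> set h then 0 else sub_kernel (hd h - z))" for z
  proof (cases "z \<in> set h")
    case True
    have "step_exp \<beta> (\<lambda>h. if z \<in> set h then 0 else sub_log (hd h - z)) h = step_exp \<beta> (\<lambda>_. 0) h"
      by (rule step_cong) (use True in auto)
    then show ?thesis using True by simp
  next
    case False
    \<comment> \<open>On the step that reaches \<open>z\<close> both integrands are 0, by
      \<open>sub_log 0 = 0\<close>.\<close>
    have "step_exp \<beta> (\<lambda>h. if z \<in> set h then 0 else sub_log (hd h - z)) h = step_exp \<beta> (\<lambda>h. sub_log (hd h - z)) h"
      by (rule step_cong) (use False in auto)
    also have "\<dots> = nbr_avg sub_log (hd h - z) + ?b * sub_kernel (hd h - z)"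
      unfolding step_hd[of \<beta> "\<lambda>u. sub_log (u - z)"] sub_kernel_def nbr_avg_def anisotropy_def by (simp add: diff_add_eq)
    finally show ?thesis using False sub_log_subharmonic[of "hd h - z"] by simp
  qed
  have "target_potential R h + Z = (\<Sum>z\<in>box R. target_mass R z * ((if z \<in> set h then 0 else sub_log (hd h - z))
      + ?b * (if z \<in> set h then 0 else sub_kernel (hd h - z))))"
    unfolding target_potential_def Z_def by (simp only: distrib_left sum.distrib sum_distrib_left mult.left_commute)
  also have "\<dots> \<le> (\<Sum>z\<in>box R. target_mass R z * step_exp \<beta> (\<lambda>h. if z \<in> set h then 0 else sub_log (hd h - z)) h)"
    using 4 target_mass_nonneg[OF R] by (intro sum_mono mult_left_mono) auto
  also have "\<dots> = step_exp \<beta> (target_potential R) h"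
    unfolding target_potential_def by (simp only: step_sum step_cmult)
  finally have 5: "target_potential R h + Z \<le> step_exp \<beta> (target_potential R) h" .
  show ?thesis unfolding step_diff step_add 2 3 using 1 5 by linarith
qed

lemma home_drift_eq:
  assumes "set (tl h) \<subseteq> box R"
  shows "home_drift h = (\<Sum>y\<in>box R. super_kernel y * (eaten pos \<beta> y h - eaten neg \<beta> y h))"
proof -
  have "home_drift h = accumulate (\<lambda>h. \<Sum>y\<in>box R. super_kernel y * ((if hd h = y then pos (cookie \<beta> h) else 0)
      - (if hd h = y then neg (cookie \<beta> h) else 0))) h"
    unfolding home_drift_def
  proof (rule accumulate_cong[OF assms])
    fix h :: "site list" assume h: "h \<noteq> []" "set h \<subseteq> box R"
    have "cookie \<beta> h * super_kernel (hd h) = (\<Sum>y\<in>box R. if hd h = y then cookie \<beta> h * super_kernel y else 0)"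
      using h hd_in_set[of h] by (auto simp del: hd_in_set)
    also have "\<dots> = (\<Sum>y\<in>box R. super_kernel y * ((if hd h = y then pos (cookie \<beta> h) else 0)
      - (if hd h = y then neg (cookie \<beta> h) else 0)))"
      by (rule sum.cong) (auto simp: max_def)
    finally show "cookie \<beta> h * super_kernel (hd h) = \<dots>" .
  qed
  then show ?thesis by (simp only: accumulate_sum accumulate_cmult accumulate_diff eaten_def)
qed

lemma target_drift_eq:
  assumes "set (tl h) \<subseteq> box R"
  shows "target_drift R h = (\<Sum>y\<in>box R. \<Sum>z\<in>box R. target_mass R z * sub_kernel (y - z) *
     (eaten_before pos \<beta> z y h - eaten_before neg \<beta> z y h))"
proof -
  have "target_drift R h = accumulate (\<lambda>h. \<Sum>y\<in>box R. \<Sum>z\<in>box R. target_mass R z * sub_kernel (y - z) *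
      ((if hd h = y \<and> z \<notin> set h then pos (cookie \<beta> h) else 0)
      - (if hd h = y \<and> z \<notin> set h then neg (cookie \<beta> h) else 0))) h"
    unfolding target_drift_def
  proof (rule accumulate_cong[OF assms])
    fix h :: "site list" assume h: "h \<noteq> []" "set h \<subseteq> box R"
    let ?G = "\<lambda>y. cookie \<beta> h * (\<Sum>z\<in>box R. target_mass R z * (if z \<in> set h then 0 else sub_kernel (y - z)))"
    have "?G (hd h) = (\<Sum>y\<in>box R. if hd h = y then ?G y else 0)"
      using h hd_in_set[of h] by (auto simp del: hd_in_set)
    also have "\<dots> = (\<Sum>y\<in>box R. \<Sum>z\<in>box R. target_mass R z * sub_kernel (y - z) *
      ((if hd h = y \<and> z \<notin> set h then pos (cookie \<beta> h) else 0)
      - (if hd h = y \<and> z \<notin> set h then neg (cookie \<beta> h) else 0)))"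
    proof (rule sum.cong[OF refl])
      fix y
      show "(if hd h = y then ?G y else 0) = (\<Sum>z\<in>box R. target_mass R z * sub_kernel (y - z) *
      ((if hd h = y \<and> z \<notin> set h then pos (cookie \<beta> h) else 0)
      - (if hd h = y \<and> z \<notin> set h then neg (cookie \<beta> h) else 0)))"
        unfolding sum_distrib_left by (cases "hd h = y") (auto intro!: sum.cong simp: max_def)
    qed
    finally show "?G (hd h) = \<dots>" .
  qed
  then show ?thesis by (simp only: accumulate_sum accumulate_cmult accumulate_diff eaten_before_def)
qed

end

section \<open>Pairs of sites\<close>

lemma ln_ge_1: "R \<ge> 3 \<Longrightarrow> ln (real R) \<ge> 1"
  using exp_le by (subst ln_ge_iff) auto

lemma sum_shift_le:
  fixes f :: "site \<Rightarrow> real"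
  assumes "finite T" "\<And>z. z \<in> S \<Longrightarrow> y - z \<in> T" "\<And>u. f u \<ge> 0"
  shows "(\<Sum>z\<in>S. f (y - z)) \<le> sum f T"
proof -
  have "inj_on (\<lambda>z. y - z) S" by (auto simp: inj_on_def)
  then have "(\<Sum>z\<in>S. f (y - z)) = sum f ((\<lambda>z. y - z) ` S)" by (simp add: sum.reindex)
  also have "\<dots> \<le> sum f T" using assms by (intro sum_mono2) auto
  finally show ?thesis .
qed

lemma finite_sup_norm_le [simp]: "finite {z. sup_norm z \<le> n}"
  using finite_box[of n] by (simp only: box_def)

text \<open>\<open>near\<close> forces the two norms to within a factor 3 of each other, so it
  excludes \<open>far\<close>. If \<open>z\<close> is nonzero and much farther out than
  \<open>y\<close>, neither holds.\<close>

definition far :: "site \<Rightarrow> site \<Rightarrow> bool" where "far y z \<longleftrightarrow> 3 * sup_norm z \<le> sup_norm y"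
definition near :: "site \<Rightarrow> site \<Rightarrow> bool" where "near y z \<longleftrightarrow> 2 * sup_norm (y - z) < sup_norm y + sup_norm z"

lemma near_sym: "near y z \<longleftrightarrow> near z y"
  by (simp add: near_def sup_norm_minus_commute add.commute)

lemma nearD:
  assumes "near y z"
  shows "sup_norm z < 3 * sup_norm y" "sup_norm y < 3 * sup_norm z" "sup_norm (y - z) < 2 * sup_norm y"
  using assms sup_norm_le_diff[of y z] sup_norm_le_diff[of z y] sup_norm_minus_commute[of y z]
  by (auto simp: near_def)

definition kernel_error :: "site \<Rightarrow> site \<Rightarrow> real" where
  "kernel_error y z = sub_kernel (y - z) - (if far y z then kern y else 0) - (if near y z then kern (y - z) else 0)"

text \<open>For near pairs only the discretisation error of \<open>sub_kernel\<close> is left. For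
  far pairs \<open>kern (y - z)\<close> is also replaced by \<open>kern y\<close>, at a Lipschitz
  cost. For the others \<open>y - z\<close> is at least about half as large as \<open>z\<close>, and
  the whole kernel counts as error. The weight \<open>1 / bracket^2\<close> is the spatial decay of
  the target mass.\<close>

lemma kernel_error_bound:
  "\<bar>kernel_error y z\<bar> / (bracket z)\<^sup>2 \<le> 5400 / (bracket y)\<^sup>2 * (1 / (bracket (y - z)) ^ 3)
     + (if far y z then 5568 / (bracket y) ^ 3 * (1 / bracket z) else 0)
     + (if bracket y \<le> 3 * bracket z then 2416 * (1 / (bracket z) ^ 4) else 0)"
  (is "_ \<le> ?N + ?F + ?O")
proof -
  have nn: "?N \<ge> 0" "?F \<ge> 0" "?O \<ge> 0"
    by (auto intro!: mult_nonneg_nonneg divide_nonneg_nonneg simp: less_imp_le)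
  have half: "bracket y \<le> 2 * bracket (y - z)" "bracket (y - z) \<le> 2 * bracket y" if "far y z"
    using that sup_norm_le_diff[of y z] sup_norm_triangle_diff[of y z] by (auto simp: far_def bracket_def)
  consider "near y z" | "far y z" "\<not> near y z" | "\<not> near y z" "\<not> far y z" by blast
  then show ?thesis
  proof cases
    case 1
    then have "bracket y \<le> 3 * bracket z" "\<not> far y z" using nearD[OF 1] by (auto simp: bracket_def far_def)
    then have "(bracket y)\<^sup>2 \<le> (3 * bracket z)\<^sup>2" by (intro power_mono) (auto simp: less_imp_le)
    then have "1 / (bracket z)\<^sup>2 \<le> 9 / (bracket y)\<^sup>2" by (simp add: field_simps power_mult_distrib)
    moreover have "\<bar>kernel_error y z\<bar> \<le> 600 / bracket (y - z) ^ 3"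
      using 1 \<open>\<not> far y z\<close> sub_kernel_estimate[of "y - z"] by (simp add: kernel_error_def)
    ultimately have "(1 / (bracket z)\<^sup>2) * \<bar>kernel_error y z\<bar> \<le> 9 / (bracket y)\<^sup>2 * (600 / bracket (y - z) ^ 3)"
      by (intro mult_mono) (auto simp: less_imp_le)
    then show ?thesis using nn by simp
  next
    case 2
    have n: "real (sup_norm z) \<le> bracket z" by (simp add: bracket_def)
    have "\<bar>kernel_error y z\<bar> \<le> 600 / bracket (y - z) ^ 3 + \<bar>kern (y - z) - kern y\<bar>"
      using 2 sub_kernel_estimate[of "y - z"] by (simp add: kernel_error_def)
    also have "600 / bracket (y - z) ^ 3 \<le> 600 / (bracket y / 2) ^ 3"
      using half(1)[OF 2(1)] by (intro divide_left_mono power_mono) (auto simp: less_imp_le)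
    also have "\<dots> = 4800 / bracket y ^ 3 * 1" by (simp add: power_divide)
    also have "\<dots> \<le> 4800 / bracket y ^ 3 * bracket z" by (intro mult_left_mono) (auto simp: less_imp_le)
    also have "\<bar>kern (y - z) - kern y\<bar> \<le> 64 * real (sup_norm z) * (bracket (y - z) + bracket y) / ((bracket (y - z))\<^sup>2 * (bracket y)\<^sup>2)"
      using kern_lipschitz[of "y - z" y] by simp
    also have "\<dots> \<le> 64 * bracket z * (2 * bracket y + bracket y) / ((bracket y / 2)\<^sup>2 * (bracket y)\<^sup>2)"
      using half[OF 2(1)] n
      by (intro frac_le mult_mono add_mono power_mono mult_pos_pos zero_less_power) (auto simp: less_imp_le)
    also have "\<dots> = 768 / bracket y ^ 3 * bracket z"
      by (simp add: power_divide power2_eq_square power3_eq_cube field_simps)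
    finally have "\<bar>kernel_error y z\<bar> \<le> 5568 / bracket y ^ 3 * bracket z" by (simp add: field_simps)
    then have "\<bar>kernel_error y z\<bar> / (bracket z)\<^sup>2 \<le> 5568 / bracket y ^ 3 * bracket z / (bracket z)\<^sup>2"
      by (intro divide_right_mono) auto
    also have "\<dots> = ?F" using 2 by (simp add: power2_eq_square)
    finally show ?thesis using nn by linarith
  next
    case 3
    have "bracket z \<le> 2 * bracket (y - z)" using 3 by (auto simp: near_def bracket_def)
    have O: "bracket y \<le> 3 * bracket z" using 3 by (auto simp: far_def bracket_def)
    have "\<bar>kernel_error y z\<bar> \<le> 604 / (bracket (y - z))\<^sup>2"
      using 3 abs_sub_kernel_le[of "y - z"] by (simp add: kernel_error_def)
    also have "\<dots> \<le> 604 / (bracket z / 2)\<^sup>2"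
      using \<open>bracket z \<le> 2 * bracket (y - z)\<close>
      by (intro divide_left_mono power_mono mult_pos_pos zero_less_power) (auto simp: less_imp_le)
    also have "\<dots> = 2416 / (bracket z)\<^sup>2" by (simp add: power_divide)
    finally have "\<bar>kernel_error y z\<bar> / (bracket z)\<^sup>2 \<le> 2416 / (bracket z)\<^sup>2 / (bracket z)\<^sup>2"
      by (intro divide_right_mono) auto
    also have "\<dots> = ?O" using O by (simp add: power2_eq_square power4_eq_xxxx)
    finally show ?thesis using nn by linarith
  qed
qed

text \<open>The constant is \<open>5400 * 17 + 5568 * 8 + 2416 * 153\<close>. Summing the right side
  over \<open>y\<close> gives \<open>O(ln R)\<close>, which the factor \<open>1 / ln R\<close> in
  the target mass turns into \<open>O(1)\<close>.\<close>

lemma sum_kernel_error: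
  assumes y: "y \<in> box R"
  shows "(\<Sum>z\<in>box R. \<bar>kernel_error y z\<bar> / (bracket z)\<^sup>2) \<le> 505992 / (bracket y)\<^sup>2"
proof -
  have N: "(\<Sum>z\<in>box R. 1 / (bracket (y - z)) ^ 3) \<le> 17"
  proof -
    have "(\<Sum>z\<in>box R. 1 / (bracket (y - z)) ^ 3) \<le> (\<Sum>u\<in>box (2 * R). 1 / (bracket u) ^ 3)"
    proof (rule sum_shift_le)
      show "y - z \<in> box (2 * R)" if "z \<in> box R" for z
        using sup_norm_triangle_diff[of y z] that y by (auto simp: box_def)
    qed (auto simp: less_imp_le)
    also have "\<dots> \<le> 17" by (rule sum_inverse_bracket3_le)
    finally show ?thesis .
  qed
  have F: "(\<Sum>z | z \<in> box R \<and> far y z. 1 / bracket z) \<le> 8 * bracket y"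
  proof -
    have "(\<Sum>z | z \<in> box R \<and> far y z. 1 / bracket z) \<le> (\<Sum>z\<in>box (sup_norm y). 1 / bracket z)"
      by (rule sum_mono2) (auto simp: box_def far_def less_imp_le)
    also have "\<dots> \<le> 1 + 8 * real (sup_norm y)" by (rule sum_inverse_bracket_le)
    finally show ?thesis by (simp add: bracket_def)
  qed
  have "(\<Sum>z\<in>box R. \<bar>kernel_error y z\<bar> / (bracket z)\<^sup>2) \<le> (\<Sum>z\<in>box R.
      5400 / (bracket y)\<^sup>2 * (1 / (bracket (y - z)) ^ 3)
     + (if far y z then 5568 / (bracket y) ^ 3 * (1 / bracket z) else 0)
     + (if bracket y \<le> 3 * bracket z then 2416 * (1 / (bracket z) ^ 4) else 0))"
    by (intro sum_mono kernel_error_bound)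
  also have "\<dots> = 5400 / (bracket y)\<^sup>2 * (\<Sum>z\<in>box R. 1 / (bracket (y - z)) ^ 3)
     + 5568 / (bracket y) ^ 3 * (\<Sum>z | z \<in> box R \<and> far y z. 1 / bracket z)
     + 2416 * (\<Sum>z | z \<in> box R \<and> bracket y \<le> 3 * bracket z. 1 / (bracket z) ^ 4)"
    by (simp only: sum.distrib sum_distrib_left sum.inter_filter[OF finite_box, symmetric])
  also have "\<dots> \<le> 5400 / (bracket y)\<^sup>2 * 17 + 5568 / (bracket y) ^ 3 * (8 * bracket y) + 2416 * (153 / (bracket y)\<^sup>2)"
    using N F sum_inverse_bracket4_tail[of R y] by (intro add_mono mult_left_mono) (auto simp: less_imp_le)
  also have "\<dots> = 505992 / (bracket y)\<^sup>2"
    by (simp add: power2_eq_square power3_eq_cube add_divide_distrib[symmetric])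
  finally show ?thesis .
qed

section \<open>Target masses and the near pairs\<close>

context cookie_walk
begin

text \<open>The mean of \<open>ln norm_sq\<close> under the target masses. Up to a constant
  depending on the history, the initial \<open>target_potential\<close> is at least this
  large.\<close>

abbreviation "Q R \<equiv> (\<Sum>z\<in>box R. target_mass R z * ln (norm_sq z))"

lemma budget_le: "budget z \<le> (A + B) * \<bar>kern z\<bar>"
proof -
  have "budget z \<le> A * \<bar>kern z\<bar> + B * \<bar>kern z\<bar>"
    unfolding budget_def using kern_parts_le[of z] by (intro add_mono mult_left_mono) auto
  then show ?thesis by (simp add: distrib_right)
qed

lemma den_pos: "R \<ge> 3 \<Longrightarrow> 0 < 2 * ln (real R) * (A + B)"
  unfolding A_plus_B using ln_ge_1[of R] by simp

lemma A_plus_B_neq_0: "A + B \<noteq> 0"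
  unfolding A_plus_B by simp

lemma target_mass_zero [simp]: "target_mass R 0 = 0" by (simp add: target_mass_def budget_def)

lemma target_mass_le:
  assumes "R \<ge> 3"
  shows "target_mass R z \<le> \<bar>kern z\<bar> / (2 * ln R)" "target_mass R z \<le> 2 / ln R * (1 / (bracket z)\<^sup>2)"
proof -
  have L: "ln (real R) \<ge> 1" using ln_ge_1[OF assms] .
  have "target_mass R z \<le> ((A + B) * \<bar>kern z\<bar>) / (2 * ln R * (A + B))"
    unfolding target_mass_def by (intro divide_right_mono budget_le less_imp_le[OF den_pos[OF assms]])
  also have "\<dots> = \<bar>kern z\<bar> / (2 * ln R)" using A_plus_B_neq_0 by simp
  finally show 1: "target_mass R z \<le> \<bar>kern z\<bar> / (2 * ln R)" .
  also have "\<dots> \<le> (4 / (bracket z)\<^sup>2) / (2 * ln R)"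
    using L abs_kern_le_bracket[of z] by (intro divide_right_mono) auto
  finally show "target_mass R z \<le> 2 / ln R * (1 / (bracket z)\<^sup>2)" by simp
qed

lemma sum_budget_le:
  assumes "R \<ge> 1"
  shows "(\<Sum>z\<in>box R. budget z) \<le> (A + B) * (2 * ln R + 6)"
proof -
  have "(\<Sum>z\<in>box R. budget z) = A * (\<Sum>z\<in>box R. kern_pos z) + B * (\<Sum>z\<in>box R. kern_neg z)"
    by (simp add: budget_def sum.distrib sum_distrib_left)
  also have "\<dots> \<le> A * (2 * ln R + 6) + B * (2 * ln R + 6)"
    using sum_kern_pos_box_le[OF assms] sum_kern_neg_box_le[OF assms] by (intro add_mono mult_left_mono) auto
  finally show ?thesis by (simp add: distrib_right)
qed

lemma sum_target_mass_eq: "(\<Sum>z\<in>box R. target_mass R z) = (\<Sum>z\<in>box R. budget z) / (2 * ln R * (A + B))"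
  by (simp add: target_mass_def sum_divide_distrib)

lemma sum_target_mass_le:
  assumes "R \<ge> 3"
  shows "(\<Sum>z\<in>box R. target_mass R z) \<le> 1 + 3 / ln R"
proof -
  have L: "ln (real R) \<ge> 1" using ln_ge_1[OF assms] .
  have "(\<Sum>z\<in>box R. target_mass R z) \<le> ((A + B) * (2 * ln R + 6)) / (2 * ln R * (A + B))"
    unfolding sum_target_mass_eq using assms by (intro divide_right_mono sum_budget_le less_imp_le[OF den_pos]) auto
  also have "\<dots> = (2 * ln R + 6) / (2 * ln R)" using A_plus_B_neq_0 by simp
  also have "\<dots> = 1 + 3 / ln R" using L by (simp add: field_simps)
  finally show ?thesis .
qed

lemma sum_target_mass_le_4: "R \<ge> 3 \<Longrightarrow> (\<Sum>z\<in>box R. target_mass R z) \<le> 4"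
  using sum_target_mass_le[of R] ln_ge_1[of R] divide_left_mono[of 1 "ln (real R)" 3] by simp

text \<open>Half of the maximal \<open>2 ln R\<close>, because the mass is about uniform in the
  logarithm of the distance. By the coordinate swap the weighted sum is the same for both parts of
  the kernel.\<close>

lemma log_mass_ge:
  assumes "R \<ge> 3"
  shows "Q R \<ge> ln R - 6"
proof -
  have L: "ln (real R) \<ge> 1" using ln_ge_1[OF assms] .
  have "(\<Sum>z\<in>box R. budget z * ln (norm_sq z)) = A * (\<Sum>z\<in>box R. kern_pos z * ln (norm_sq z)) + B * (\<Sum>z\<in>box R. kern_neg z * ln (norm_sq z))"
    by (simp add: budget_def sum.distrib sum_distrib_left algebra_simps)
  also have "\<dots> = (A + B) * (\<Sum>z\<in>box R. kern_neg z * ln (norm_sq z))"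
    by (simp add: sum_kern_pos_eq_kern_neg distrib_right)
  finally have "Q R = ((A + B) * (\<Sum>z\<in>box R. kern_neg z * ln (norm_sq z))) / (2 * ln R * (A + B))"
    by (simp only: target_mass_def times_divide_eq_left flip: sum_divide_distrib)
  also have "\<dots> = (\<Sum>z\<in>box R. kern_neg z * ln (norm_sq z)) / (2 * ln R)" using A_plus_B_neq_0 by simp
  also have "\<dots> \<ge> (2 * (ln R)\<^sup>2 - 8 * ln R - 4) / (2 * ln R)"
    using sum_kern_neg_ln_ge[of R] assms L by (intro divide_right_mono) auto
  also have "(2 * (ln R)\<^sup>2 - 8 * ln R - 4) / (2 * ln R) = ln R - 4 - 2 / ln R"
    using L by (simp add: field_simps power2_eq_square)
  finally show ?thesis using L divide_left_mono[of 1 "ln (real R)" 2] by simp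
qed

lemma target_mass_lipschitz:
  assumes "R \<ge> 3"
  shows "\<bar>target_mass R y - target_mass R z\<bar> \<le> \<bar>kern y - kern z\<bar> / (2 * ln R)"
proof -
  have L: "ln (real R) \<ge> 1" using ln_ge_1[OF assms] .
  have "\<bar>budget y - budget z\<bar> = \<bar>A * (kern_pos y - kern_pos z) + B * (kern_neg y - kern_neg z)\<bar>" by (simp add: budget_def algebra_simps)
  also have "\<dots> \<le> \<bar>A * (kern_pos y - kern_pos z)\<bar> + \<bar>B * (kern_neg y - kern_neg z)\<bar>" by (rule abs_triangle_ineq)
  also have "\<dots> = A * \<bar>kern_pos y - kern_pos z\<bar> + B * \<bar>kern_neg y - kern_neg z\<bar>" by (simp add: abs_mult)
  also have "\<dots> \<le> A * \<bar>kern y - kern z\<bar> + B * \<bar>kern y - kern z\<bar>"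
    by (intro add_mono mult_left_mono) (auto simp: kern_pos_def kern_neg_def max_def)
  finally have diff: "\<bar>budget y - budget z\<bar> \<le> (A + B) * \<bar>kern y - kern z\<bar>" by (simp add: distrib_right)
  have "\<bar>target_mass R y - target_mass R z\<bar> = \<bar>budget y - budget z\<bar> / (2 * ln R * (A + B))"
    using den_pos[OF assms] by (simp only: target_mass_def abs_divide flip: diff_divide_distrib)
  also have "\<dots> \<le> ((A + B) * \<bar>kern y - kern z\<bar>) / (2 * ln R * (A + B))"
    by (intro divide_right_mono diff less_imp_le[OF den_pos[OF assms]])
  also have "\<dots> = \<bar>kern y - kern z\<bar> / (2 * ln R)" using A_plus_B_neq_0 by simp
  finally show ?thesis .
qed

lemma sum_bracket2_over_ln:
  assumes "R \<ge> 3"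
  shows "(\<Sum>y\<in>box R. 1 / ln R * (1 / (bracket y)\<^sup>2)) \<le> 17"
proof -
  have L: "ln (real R) \<ge> 1" using ln_ge_1[OF assms] .
  have "(\<Sum>y\<in>box R. 1 / ln R * (1 / (bracket y)\<^sup>2)) = 1 / ln R * (\<Sum>y\<in>box R. 1 / (bracket y)\<^sup>2)"
    by (simp only: sum_distrib_left)
  also have "\<dots> \<le> 1 / ln R * (9 + 8 * ln R)"
    using sum_inverse_bracket2_le[of R] assms L by (intro mult_left_mono) auto
  also have "\<dots> \<le> 17" using L by (simp add: field_simps)
  finally show ?thesis .
qed

text \<open>The difference of two masses gains a factor \<open>bracket (y - z) / bracket y\<close>
  over the masses themselves. This softens the kernel to \<open>1 / bracket (y - z)\<close>, whose
  sum over near \<open>z\<close> is only of order \<open>bracket y\<close>.\<close>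

lemma near_difference:
  assumes R: "R \<ge> 3" and n: "near y z"
  shows "\<bar>target_mass R y - target_mass R z\<bar> * (A * kern_neg (y - z) + B * kern_pos (y - z))
    \<le> 4608 * (A + B) / ln R * (1 / (bracket y) ^ 3) * (1 / bracket (y - z))"
proof -
  have L: "ln (real R) \<ge> 1" using ln_ge_1[OF R] .
  have Jz: "bracket y \<le> 3 * bracket z" "bracket z \<le> 3 * bracket y" using nearD[OF n] by (auto simp: bracket_def)
  have "\<bar>kern y - kern z\<bar> \<le> 64 * real (sup_norm (y - z)) * (bracket y + bracket z) / ((bracket y)\<^sup>2 * (bracket z)\<^sup>2)"
    by (rule kern_lipschitz)
  also have "\<dots> \<le> 64 * bracket (y - z) * (bracket y + 3 * bracket y) / ((bracket y)\<^sup>2 * (bracket y / 3)\<^sup>2)"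
    using Jz by (intro frac_le mult_mono add_mono power_mono mult_pos_pos zero_less_power)
      (auto simp: less_imp_le bracket_def)
  also have "\<dots> = 2304 * bracket (y - z) / bracket y ^ 3"
    by (simp add: power_divide power2_eq_square power3_eq_cube field_simps)
  finally have diff: "\<bar>kern y - kern z\<bar> \<le> 2304 * bracket (y - z) / bracket y ^ 3" .
  have mass_diff: "\<bar>target_mass R y - target_mass R z\<bar> \<le> 2304 * bracket (y - z) / bracket y ^ 3 / (2 * ln R)"
    using target_mass_lipschitz[OF R, of y z] divide_right_mono[OF diff, of "2 * ln R"] L by linarith
  have "A * kern_neg (y - z) + B * kern_pos (y - z) \<le> A * (4 / (bracket (y - z))\<^sup>2) + B * (4 / (bracket (y - z))\<^sup>2)"
    using kern_parts_le[of "y - z"] abs_kern_le_bracket[of "y - z"] by (intro add_mono mult_left_mono) auto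
  then have k: "A * kern_neg (y - z) + B * kern_pos (y - z) \<le> (A + B) * (4 / (bracket (y - z))\<^sup>2)"
    by (simp only: distrib_right)
  have "\<bar>target_mass R y - target_mass R z\<bar> * (A * kern_neg (y - z) + B * kern_pos (y - z))
    \<le> (2304 * bracket (y - z) / bracket y ^ 3 / (2 * ln R)) * ((A + B) * (4 / (bracket (y - z))\<^sup>2))"
    using L by (intro mult_mono mass_diff k) (auto intro!: add_nonneg_nonneg mult_nonneg_nonneg divide_nonneg_nonneg simp: less_imp_le)
  also have "\<dots> = 4608 * (A + B) / ln R * (1 / (bracket y) ^ 3) * (1 / bracket (y - z))"
    by (simp add: power2_eq_square)
  finally show ?thesis .
qed

text \<open>Sites near \<open>y\<close> differ from it by less than \<open>2 * sup_norm y\<close>,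
  and the kernel sum over a box of that radius is \<open>ln norm_sq y\<close> up to a constant.
  Weighted with the mass at \<open>y\<close>, this becomes \<open>Q R\<close> after summation; the
  mass 0 covers the origin.\<close>

lemma sum_near_le:
  assumes R: "R \<ge> 3"
  shows "(\<Sum>z | z \<in> box R \<and> near y z. A * kern_neg (y - z) + B * kern_pos (y - z)) * target_mass R y \<le> (A + B) * (target_mass R y * ln (norm_sq y) + 8 * target_mass R y)"
proof (cases "y = 0")
  case False
  then have n1: "sup_norm y \<ge> 1" using sup_norm_eq_0[of y] by linarith
  have m0: "target_mass R y \<ge> 0" using target_mass_nonneg[of R y] R by simp
  have "(\<Sum>z | z \<in> box R \<and> near y z. A * kern_neg (y - z) + B * kern_pos (y - z)) \<le> (\<Sum>u\<in>box (2 * sup_norm y). A * kern_neg u + B * kern_pos u)"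
    by (rule sum_shift_le[where f = "\<lambda>u. A * kern_neg u + B * kern_pos u"])
      (use nearD(3)[of y] in \<open>auto simp: box_def less_imp_le\<close>)
  also have "\<dots> = A * (\<Sum>u\<in>box (2 * sup_norm y). kern_neg u) + B * (\<Sum>u\<in>box (2 * sup_norm y). kern_pos u)"
    by (simp add: sum.distrib sum_distrib_left)
  also have "\<dots> \<le> A * (2 * ln (2 * sup_norm y) + 6) + B * (2 * ln (2 * sup_norm y) + 6)"
    using sum_kern_neg_box_le[of "2 * sup_norm y"] sum_kern_pos_box_le[of "2 * sup_norm y"] n1
    by (intro add_mono mult_left_mono) auto
  also have "\<dots> = (A + B) * (2 * ln (2 * sup_norm y) + 6)" by (simp add: distrib_right)
  also have "\<dots> \<le> (A + B) * (ln (norm_sq y) + 8)"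
  proof (intro mult_left_mono)
    have "ln (2 * real (sup_norm y)) = ln 2 + ln (sup_norm y)" using n1 by (intro ln_mult_pos) auto
    moreover have "ln (2::real) \<le> 1" using ln_le_minus_one[of 2] by simp
    ultimately show "2 * ln (2 * sup_norm y) + 6 \<le> ln (norm_sq y) + 8"
      using ln_norm_sq_ge[OF False] by simp
  qed simp
  finally have "(\<Sum>z | z \<in> box R \<and> near y z. A * kern_neg (y - z) + B * kern_pos (y - z)) \<le> (A + B) * (ln (norm_sq y) + 8)" .
  from mult_right_mono[OF this m0] show ?thesis by (simp add: algebra_simps)
qed simp

lemma eaten_before_bounds:
  "0 \<le> eaten_before pos \<beta> z y h" "eaten_before pos \<beta> z y h \<le> A"
  "0 \<le> eaten_before neg \<beta> z y h" "eaten_before neg \<beta> z y h \<le> B"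
  using eaten_before_le[of pos \<beta> z y h] eaten_before_le[of neg \<beta> z y h] eaten_le[of y h]
  by auto

text \<open>
  The pairs \<open>(y, z)\<close> and \<open>(z, y)\<close> cannot both contribute; this halves the trivial bound \<open>(A + B) * Q R\<close>.
\<close>

lemma near_pairs_le:
  assumes R: "R \<ge> 3"
  shows "(\<Sum>y\<in>box R. \<Sum>z\<in>box R. if near y z then target_mass R z *
      (kern_neg (y - z) * eaten_before pos \<beta> z y h + kern_pos (y - z) * eaten_before neg \<beta> z y h) else 0)
    \<le> (A + B) / 2 * Q R + 2000000" (is "?T \<le> _")
proof -
  have L: "ln (real R) \<ge> 1" using ln_ge_1[OF R] .
  define t where "t y z = (if near y z then target_mass R z *
      (kern_neg (y - z) * eaten_before pos \<beta> z y h + kern_pos (y - z) * eaten_before neg \<beta> z y h) else 0)" for y z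
  define k where "k y z = A * kern_neg (y - z) + B * kern_pos (y - z)" for y z
  have k0: "k y z \<ge> 0" for y z by (simp add: k_def)
  \<comment> \<open>Only one of the two terms survives. If it is the one weighted by the mass at
    \<open>z\<close>, that mass is compared with the mass at \<open>y\<close>.\<close>
  have cap: "target_mass R z * p + target_mass R y * q \<le> c * (target_mass R y + \<bar>target_mass R y - target_mass R z\<bar>)"
    if "p = 0 \<or> q = 0" "0 \<le> p" "p \<le> c" "0 \<le> q" "q \<le> c" for p q c y z
  proof -
    have mm: "target_mass R y \<ge> 0" "target_mass R z \<ge> 0" "target_mass R z \<le> target_mass R y + \<bar>target_mass R y - target_mass R z\<bar>"
      using target_mass_nonneg[of R] R by auto
    have "target_mass R z * p \<le> (target_mass R y + \<bar>target_mass R y - target_mass R z\<bar>) * c" "target_mass R y * q \<le> (target_mass R y + \<bar>target_mass R y - target_mass R z\<bar>) * c"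
      using that mm by (auto intro!: mult_mono)
    then show ?thesis using that(1) by (auto simp: mult.commute)
  qed
  have pair: "t y z + t z y \<le> (if near y z then k y z * target_mass R y + \<bar>target_mass R y - target_mass R z\<bar> * k y z else 0)" for y z
  proof (cases "near y z")
    case True
    have 1: "target_mass R z * eaten_before pos \<beta> z y h + target_mass R y * eaten_before pos \<beta> y z h \<le> A * (target_mass R y + \<bar>target_mass R y - target_mass R z\<bar>)"
      by (intro cap eaten_before_exclusive eaten_before_bounds) simp
    have 2: "target_mass R z * eaten_before neg \<beta> z y h + target_mass R y * eaten_before neg \<beta> y z h \<le> B * (target_mass R y + \<bar>target_mass R y - target_mass R z\<bar>)"
      by (intro cap eaten_before_exclusive eaten_before_bounds) simp
    have c: "kern_neg (z - y) = kern_neg (y - z)" "kern_pos (z - y) = kern_pos (y - z)"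
      using kern_neg_minus[of "y - z"] kern_pos_minus[of "y - z"] by simp_all
    have "t y z + t z y = kern_neg (y - z) * (target_mass R z * eaten_before pos \<beta> z y h + target_mass R y * eaten_before pos \<beta> y z h)
      + kern_pos (y - z) * (target_mass R z * eaten_before neg \<beta> z y h + target_mass R y * eaten_before neg \<beta> y z h)"
      using True near_sym[of y z] by (simp add: t_def c algebra_simps)
    also have "\<dots> \<le> kern_neg (y - z) * (A * (target_mass R y + \<bar>target_mass R y - target_mass R z\<bar>)) + kern_pos (y - z) * (B * (target_mass R y + \<bar>target_mass R y - target_mass R z\<bar>))"
      using 1 2 by (intro add_mono mult_left_mono) auto
    finally show ?thesis using True by (simp add: k_def algebra_simps)
  next
    case False
    then show ?thesis using near_sym[of y z] by (simp add: t_def)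
  qed
  have "?T = (\<Sum>y\<in>box R. \<Sum>z\<in>box R. t y z)" by (simp add: t_def)
  \<comment> \<open>Adding the sum with its arguments exchanged brings both orders of each pair
    together; the doubling is where the final factor \<open>1 / 2\<close> comes from.\<close>
  moreover have "?T = (\<Sum>y\<in>box R. \<Sum>z\<in>box R. t z y)"
    unfolding t_def by (rule sum.swap)
  ultimately have "2 * ?T = (\<Sum>y\<in>box R. \<Sum>z\<in>box R. t y z + t z y)"
    by (simp add: sum.distrib)
  also have "\<dots> \<le> (\<Sum>y\<in>box R. \<Sum>z\<in>box R. if near y z then k y z * target_mass R y + \<bar>target_mass R y - target_mass R z\<bar> * k y z else 0)"
    by (intro sum_mono pair)
  also have "\<dots> = (\<Sum>y\<in>box R. (\<Sum>z | z \<in> box R \<and> near y z. k y z) * target_mass R y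
      + (\<Sum>z | z \<in> box R \<and> near y z. \<bar>target_mass R y - target_mass R z\<bar> * k y z))"
    by (simp only: sum.inter_filter[OF finite_box, symmetric] sum.distrib sum_distrib_right)
  also have "\<dots> \<le> (\<Sum>y\<in>box R. (A + B) * (target_mass R y * ln (norm_sq y) + 8 * target_mass R y)
      + 73728 * (A + B) * (1 / ln R * (1 / (bracket y)\<^sup>2)))"
  proof (intro sum_mono add_mono)
    fix y
    show "(\<Sum>z | z \<in> box R \<and> near y z. k y z) * target_mass R y \<le> (A + B) * (target_mass R y * ln (norm_sq y) + 8 * target_mass R y)"
      unfolding k_def by (rule sum_near_le[OF R])
    have "(\<Sum>z | z \<in> box R \<and> near y z. \<bar>target_mass R y - target_mass R z\<bar> * k y z)
      \<le> (\<Sum>z | z \<in> box R \<and> near y z. 4608 * (A + B) / ln R * (1 / (bracket y) ^ 3) * (1 / bracket (y - z)))"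
      unfolding k_def by (intro sum_mono near_difference[OF R]) simp
    also have "\<dots> = 4608 * (A + B) / ln R * (1 / (bracket y) ^ 3) * (\<Sum>z | z \<in> box R \<and> near y z. 1 / bracket (y - z))"
      by (simp only: sum_distrib_left)
    also have "\<dots> \<le> 4608 * (A + B) / ln R * (1 / (bracket y) ^ 3) * (16 * bracket y)"
    proof (rule mult_left_mono)
      have "(\<Sum>z | z \<in> box R \<and> near y z. 1 / bracket (y - z)) \<le> (\<Sum>u\<in>box (2 * sup_norm y). 1 / bracket u)"
        by (rule sum_shift_le[where f = "\<lambda>u. 1 / bracket u"])
          (use nearD(3)[of y] in \<open>auto simp: box_def less_imp_le\<close>)
      then show "(\<Sum>z | z \<in> box R \<and> near y z. 1 / bracket (y - z)) \<le> 16 * bracket y"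
        using sum_inverse_bracket_le[of "2 * sup_norm y"] by (simp add: bracket_def)
    qed (use L in \<open>simp add: less_imp_le\<close>)
    also have "4608 * (A + B) / ln R * (1 / (bracket y) ^ 3) * (16 * bracket y) = 73728 * (A + B) * (1 / ln R * (1 / (bracket y)\<^sup>2))"
      by (simp add: power2_eq_square power3_eq_cube)
    finally show "(\<Sum>z | z \<in> box R \<and> near y z. \<bar>target_mass R y - target_mass R z\<bar> * k y z)
      \<le> 73728 * (A + B) * (1 / ln R * (1 / (bracket y)\<^sup>2))" .
  qed
  also have "\<dots> = (A + B) * (Q R + 8 * (\<Sum>y\<in>box R. target_mass R y)) + 73728 * (A + B) * (\<Sum>y\<in>box R. 1 / ln R * (1 / (bracket y)\<^sup>2))"
    by (simp only: sum.distrib flip: sum_distrib_left)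
  also have "\<dots> \<le> (A + B) * (Q R + 8 * 4) + 73728 * (A + B) * 17"
    using sum_target_mass_le_4[OF R] sum_bracket2_over_ln[OF R] by (intro add_mono mult_left_mono) auto
  finally have fin: "2 * ?T \<le> (A + B) * (Q R + 8 * 4) + 73728 * (A + B) * 17" .
  \<comment> \<open>The additive constant is really \<open>4 / 7 * (32 + 73728 * 17)\<close>, about
    716000.\<close>
  have "T \<le> (A + B) / 2 * q + 2000000" if "2 * T \<le> (A + B) * (q + 8 * 4) + 73728 * (A + B) * 17" for T q
    using that unfolding A_plus_B by argo
  from this[OF fin] show ?thesis .
qed

end

section \<open>The escape probability\<close>

context cookie_walk
begin

text \<open>Outward pushes at a site are capped by its budget and occur only if it has been visited.
  Inward pushes are kept as an explicit loss, which \<open>target_drift_ge\<close> will spend. The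
  error is \<open>1200 * 17\<close>.\<close>

lemma home_drift_le:
  assumes h: "set (tl h) \<subseteq> box R"
  shows "home_drift h \<le> (\<Sum>y\<in>box R. if y \<in> set h then budget y else 0)
    - (\<Sum>y\<in>box R. kern_neg y * eaten pos \<beta> y h + kern_pos y * eaten neg \<beta> y h) + 20400"
proof -
  have nn: "0 \<le> eaten pos \<beta> y h" "0 \<le> eaten neg \<beta> y h" for y
    using eaten_before_le[of pos \<beta> y y h] eaten_before_le[of neg \<beta> y y h] by auto
  have bound: "super_kernel y * (eaten pos \<beta> y h - eaten neg \<beta> y h) \<le>
     (if y \<in> set h then budget y else 0) - (kern_neg y * eaten pos \<beta> y h + kern_pos y * eaten neg \<beta> y h)
     + 1200 * (1 / (bracket y) ^ 3)" for y
  proof -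
    let ?a = "eaten pos \<beta> y h" and ?d = "eaten neg \<beta> y h"
    have ad: "\<bar>?a - ?d\<bar> \<le> 2" using nn[of y] eaten_le[of y h] A_plus_B by (auto simp: abs_le_iff)
    have "(super_kernel y - kern y) * (?a - ?d) \<le> \<bar>super_kernel y - kern y\<bar> * \<bar>?a - ?d\<bar>"
      unfolding abs_mult[symmetric] by (rule abs_ge_self)
    also have "\<dots> \<le> 600 / (bracket y) ^ 3 * 2"
      using ad super_kernel_estimate[of y] by (intro mult_mono) (auto simp: less_imp_le)
    finally have e: "(super_kernel y - kern y) * (?a - ?d) \<le> 1200 * (1 / (bracket y) ^ 3)" by simp
    have gw: "kern_pos y * ?a + kern_neg y * ?d \<le> (if y \<in> set h then budget y else 0)"
    proof (cases "y \<in> set h")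
      case True
      have "kern_pos y * ?a + kern_neg y * ?d \<le> kern_pos y * A + kern_neg y * B"
        using eaten_le by (intro add_mono mult_left_mono) auto
      then show ?thesis using True by (simp add: budget_def mult.commute)
    qed (simp add: eaten_unvisited)
    have "super_kernel y * (?a - ?d) = (super_kernel y - kern y) * (?a - ?d) + (kern_pos y * ?a + kern_neg y * ?d) - (kern_neg y * ?a + kern_pos y * ?d)"
      unfolding kern_eq by (simp add: algebra_simps)
    then show ?thesis using e gw by linarith
  qed
  have "home_drift h \<le> (\<Sum>y\<in>box R. (if y \<in> set h then budget y else 0) - (kern_neg y * eaten pos \<beta> y h + kern_pos y * eaten neg \<beta> y h)
     + 1200 * (1 / (bracket y) ^ 3))"
    unfolding home_drift_eq[OF h] by (intro sum_mono bound)
  also have "\<dots> = (\<Sum>y\<in>box R. if y \<in> set h then budget y else 0)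
    - (\<Sum>y\<in>box R. kern_neg y * eaten pos \<beta> y h + kern_pos y * eaten neg \<beta> y h) + 1200 * (\<Sum>y\<in>box R. 1 / (bracket y) ^ 3)"
    by (simp only: sum.distrib sum_subtractf sum_distrib_left)
  finally show ?thesis using sum_inverse_bracket3_le[of R] by linarith
qed

text \<open>In a far pair the push is the one relative to the origin, and what is eaten before the
  visit to \<open>z\<close> is at most what is eaten at all. So each target charges at most its
  share of the inward loss at \<open>y\<close>.\<close>

lemma sum_far_ge:
  assumes R: "R \<ge> 3"
  shows "(\<Sum>z\<in>box R. if far y z then target_mass R z * kern y *
      (eaten_before pos \<beta> z y h - eaten_before neg \<beta> z y h) else 0)
    \<ge> - ((kern_neg y * eaten pos \<beta> y h + kern_pos y * eaten neg \<beta> y h) * (\<Sum>z\<in>box R. target_mass R z))"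
proof -
  let ?c = "kern_neg y * eaten pos \<beta> y h + kern_pos y * eaten neg \<beta> y h"
  have nn: "0 \<le> ?c"
    using eaten_before_le[of pos \<beta> y y h] eaten_before_le[of neg \<beta> y y h] by auto
  have "- (?c * target_mass R z) \<le> (if far y z then target_mass R z * kern y *
      (eaten_before pos \<beta> z y h - eaten_before neg \<beta> z y h) else 0)" for z
  proof -
    let ?a = "eaten_before pos \<beta> z y h" and ?d = "eaten_before neg \<beta> z y h"
    have m0: "target_mass R z \<ge> 0" using target_mass_nonneg[of R z] R by simp
    have "kern_neg y * ?a + kern_pos y * ?d \<le> ?c"
      using eaten_before_le[of pos \<beta> z y h] eaten_before_le[of neg \<beta> z y h]
      by (intro add_mono mult_left_mono) auto
    moreover have "0 \<le> kern_pos y * ?a + kern_neg y * ?d" using eaten_before_bounds by simp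
    moreover have "kern y * (?a - ?d) = (kern_pos y * ?a + kern_neg y * ?d) - (kern_neg y * ?a + kern_pos y * ?d)"
      unfolding kern_eq by (simp add: algebra_simps)
    ultimately have "- ?c \<le> kern y * (?a - ?d)" by linarith
    then have "target_mass R z * - ?c \<le> target_mass R z * (kern y * (?a - ?d))" using m0 by (rule mult_left_mono)
    moreover have "0 \<le> ?c * target_mass R z" using nn m0 by simp
    moreover have "target_mass R z * - ?c = - (?c * target_mass R z)" by (simp only: mult_minus_right mult.commute)
    ultimately show ?thesis by (simp only: mult.assoc) (cases "far y z", auto)
  qed
  then have "(\<Sum>z\<in>box R. - (?c * target_mass R z)) \<le> (\<Sum>z\<in>box R. if far y z then target_mass R z * kern y *
      (eaten_before pos \<beta> z y h - eaten_before neg \<beta> z y h) else 0)"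
    by (rule sum_mono)
  then show ?thesis by (simp only: sum_negf sum_distrib_left)
qed

text \<open>Far pairs cost the inward loss, near pairs half of the trivial bound, and the kernel
  errors a constant: \<open>2023968 * 17 + 48 + 2000000\<close> is below the stated one.\<close>

lemma target_drift_ge:
  assumes R: "R \<ge> 3" and h: "set (tl h) \<subseteq> box R"
  shows "target_drift R h \<ge> - (\<Sum>y\<in>box R. kern_neg y * eaten pos \<beta> y h + kern_pos y * eaten neg \<beta> y h)
    - (A + B) / 2 * Q R - 38000000"
proof -
  have L: "ln (real R) \<ge> 1" using ln_ge_1[OF R] .
  let ?c = "\<lambda>y z. eaten_before pos \<beta> z y h - eaten_before neg \<beta> z y h"
  let ?N = "\<Sum>y\<in>box R. kern_neg y * eaten pos \<beta> y h + kern_pos y * eaten neg \<beta> y h"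
  let ?M = "\<Sum>z\<in>box R. target_mass R z"
  have err: "target_mass R z * kernel_error y z * ?c y z \<ge> - (4 / ln R * (\<bar>kernel_error y z\<bar> / (bracket z)\<^sup>2))" for y z
  proof -
    have "\<bar>?c y z\<bar> \<le> 2" using eaten_before_bounds[of z y h] A_plus_B by (auto simp: abs_le_iff)
    moreover have "\<bar>target_mass R z * kernel_error y z\<bar> \<le> 2 / ln R * (1 / (bracket z)\<^sup>2) * \<bar>kernel_error y z\<bar>"
    proof -
      have "\<bar>target_mass R z\<bar> = target_mass R z" using target_mass_nonneg[of R z] R by simp
      then show ?thesis
        unfolding abs_mult by (simp only:) (rule mult_right_mono[OF target_mass_le(2)[OF R]], simp)
    qed
    ultimately have "\<bar>target_mass R z * kernel_error y z * ?c y z\<bar> \<le> 2 / ln R * (1 / (bracket z)\<^sup>2) * \<bar>kernel_error y z\<bar> * 2"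
      unfolding abs_mult[of "target_mass R z * kernel_error y z"] using L by (intro mult_mono) auto
    then show ?thesis by (simp add: abs_le_iff)
  qed
  have nr: "(if near y z then target_mass R z * kern (y - z) * ?c y z else 0) \<ge>
     - (if near y z then target_mass R z * (kern_neg (y - z) * eaten_before pos \<beta> z y h + kern_pos (y - z) * eaten_before neg \<beta> z y h) else 0)" for y z
  proof -
    have "0 \<le> target_mass R z * (kern_pos (y - z) * eaten_before pos \<beta> z y h + kern_neg (y - z) * eaten_before neg \<beta> z y h)"
      using target_mass_nonneg[of R z] R eaten_before_bounds by simp
    then show ?thesis by (simp add: kern_eq algebra_simps)
  qed
  have split: "target_mass R z * sub_kernel (y - z) * ?c y z = target_mass R z * kernel_error y z * ?c y z
     + (if far y z then target_mass R z * kern y * ?c y z else 0) + (if near y z then target_mass R z * kern (y - z) * ?c y z else 0)" for y z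
    by (simp add: kernel_error_def algebra_simps)
  have "(\<Sum>y\<in>box R. - (2023968 * (1 / ln R * (1 / (bracket y)\<^sup>2))) - (kern_neg y * eaten pos \<beta> y h + kern_pos y * eaten neg \<beta> y h) * ?M
      - (\<Sum>z\<in>box R. if near y z then target_mass R z *
      (kern_neg (y - z) * eaten_before pos \<beta> z y h + kern_pos (y - z) * eaten_before neg \<beta> z y h) else 0)) \<le> target_drift R h"
    unfolding target_drift_eq[OF h]
  proof (rule sum_mono)
    fix y assume y: "y \<in> box R"
    have "(\<Sum>z\<in>box R. target_mass R z * kernel_error y z * ?c y z) \<ge> (\<Sum>z\<in>box R. - (4 / ln R * (\<bar>kernel_error y z\<bar> / (bracket z)\<^sup>2)))"
      by (intro sum_mono err)
    moreover have "(\<Sum>z\<in>box R. - (4 / ln R * (\<bar>kernel_error y z\<bar> / (bracket z)\<^sup>2))) = - (4 / ln R * (\<Sum>z\<in>box R. \<bar>kernel_error y z\<bar> / (bracket z)\<^sup>2))"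
      by (simp only: sum_negf sum_distrib_left)
    moreover have "4 / ln R * (\<Sum>z\<in>box R. \<bar>kernel_error y z\<bar> / (bracket z)\<^sup>2) \<le> 4 / ln R * (505992 / (bracket y)\<^sup>2)"
      using sum_kernel_error[OF y] L by (intro mult_left_mono) auto
    moreover have "4 / ln R * (505992 / (bracket y)\<^sup>2) = 2023968 * (1 / ln R * (1 / (bracket y)\<^sup>2))" by simp
    ultimately have 1: "(\<Sum>z\<in>box R. target_mass R z * kernel_error y z * ?c y z) \<ge> - (2023968 * (1 / ln R * (1 / (bracket y)\<^sup>2)))"
      by linarith
    have 2: "(\<Sum>z\<in>box R. if near y z then target_mass R z * kern (y - z) * ?c y z else 0) \<ge>
      - (\<Sum>z\<in>box R. if near y z then target_mass R z * (kern_neg (y - z) * eaten_before pos \<beta> z y h + kern_pos (y - z) * eaten_before neg \<beta> z y h) else 0)"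
      unfolding sum_negf[symmetric] by (intro sum_mono nr)
    show "- (2023968 * (1 / ln R * (1 / (bracket y)\<^sup>2))) - (kern_neg y * eaten pos \<beta> y h + kern_pos y * eaten neg \<beta> y h) * ?M
      - (\<Sum>z\<in>box R. if near y z then target_mass R z *
      (kern_neg (y - z) * eaten_before pos \<beta> z y h + kern_pos (y - z) * eaten_before neg \<beta> z y h) else 0)
      \<le> (\<Sum>z\<in>box R. target_mass R z * sub_kernel (y - z) * ?c y z)"
      unfolding split sum.distrib using 1 2 sum_far_ge[OF R, of y h] by linarith
  qed
  then have "- (2023968 * (\<Sum>y\<in>box R. 1 / ln R * (1 / (bracket y)\<^sup>2))) - ?N * ?M
    - (\<Sum>y\<in>box R. \<Sum>z\<in>box R. if near y z then target_mass R z *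
      (kern_neg (y - z) * eaten_before pos \<beta> z y h + kern_pos (y - z) * eaten_before neg \<beta> z y h) else 0) \<le> target_drift R h"
    by (simp only: sum_subtractf sum_negf sum_distrib_left[symmetric] sum_distrib_right[symmetric])
  \<comment> \<open>The coefficient of the loss has to be 1 to cancel against
    \<open>home_drift_le\<close>. The mass exceeds 1 by at most \<open>3 / ln R\<close> and the loss
    is at most \<open>16 ln R\<close>, so replacing the mass by 1 costs at most 48.\<close>
  moreover have "?N * ?M \<le> ?N + 48"
  proof -
    have N0: "?N \<ge> 0"
    proof (rule sum_nonneg)
      fix y show "0 \<le> kern_neg y * eaten pos \<beta> y h + kern_pos y * eaten neg \<beta> y h"
        using eaten_before_le[of pos \<beta> y y h] eaten_before_le[of neg \<beta> y y h] by auto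
    qed
    have "?N \<le> (\<Sum>y\<in>box R. kern_neg y * A + kern_pos y * B)"
      using eaten_le by (intro sum_mono add_mono mult_left_mono) auto
    also have "\<dots> = A * (\<Sum>y\<in>box R. kern_neg y) + B * (\<Sum>y\<in>box R. kern_pos y)"
      by (simp add: sum.distrib sum_distrib_left mult.commute)
    also have "\<dots> \<le> A * (2 * ln R + 6) + B * (2 * ln R + 6)"
      using sum_kern_pos_box_le[of R] sum_kern_neg_box_le[of R] R by (intro add_mono mult_left_mono) auto
    also have "\<dots> = 8 / 7 * (2 * ln R + 6)" unfolding A_plus_B[symmetric] by (simp only: distrib_right)
    also have "\<dots> \<le> 16 * ln R" using L by simp
    finally have "?N * (3 / ln R) \<le> 16 * ln R * (3 / ln R)" using L by (intro mult_right_mono) auto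
    also have "\<dots> = 48" using L by simp
    finally have "?N * (3 / ln R) \<le> 48" .
    moreover have "?N * ?M \<le> ?N * (1 + 3 / ln R)"
      using sum_target_mass_le[OF R] N0 by (rule mult_left_mono)
    ultimately show ?thesis by (simp only: distrib_left mult_1_right)
  qed
  ultimately show ?thesis
    using near_pairs_le[OF R, of h] sum_bracket2_over_ln[OF R] by linarith
qed

section \<open>The potential at the start and at the end\<close>

lemma sub_log_le_ln:
  assumes R: "R \<ge> 3" and "sup_norm y \<le> R + 1" "sup_norm z \<le> R"
  shows "sub_log (y - z) \<le> 2 * ln R + 37"
proof -
  have "sup_norm (y - z) \<le> 3 * R" using sup_norm_triangle_diff[of y z] assms by linarith
  then have "(real (sup_norm (y - z)))\<^sup>2 \<le> (real (3 * R))\<^sup>2" by (intro power_mono) auto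
  then have "2 * norm_sq (y - z) \<le> 36 * (real R)\<^sup>2" using norm_sq_le_sup_norm[of "y - z"] by (simp add: power_mult_distrib)
  moreover have "1 \<le> (real R)\<^sup>2" using R by simp
  ultimately have "2 * norm_sq (y - z) + 1 \<le> 37 * (real R)\<^sup>2" by linarith
  then have "sub_log (y - z) \<le> ln (37 * (real R)\<^sup>2)"
    unfolding sub_log_def using norm_sq_nonneg[of "y - z"] R by (subst ln_le_cancel_iff) (auto intro: add_nonneg_pos simp del: norm_sq_nonneg)
  also have "\<dots> = ln 37 + ln ((real R)\<^sup>2)" using R by (intro ln_mult_pos) auto
  also have "ln ((real R)\<^sup>2) = 2 * ln R" using R by (simp add: ln_realpow)
  also have "ln (37::real) \<le> 37" using ln_le_minus_one[of 37] by simp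
  finally show ?thesis by simp
qed

text \<open>An unvisited target contributes at most its mass times \<open>2 ln R + 37\<close>.
  Because \<open>A + B \<ge> 1\<close>, its own budget covers the leading part; the rest sums to at
  most \<open>37 * 4\<close>.\<close>

lemma target_potential_le:
  assumes R: "R \<ge> 3" and h: "sup_norm (hd h) \<le> R + 1"
  shows "target_potential R h \<le> (\<Sum>z\<in>box R. if z \<in> set h then 0 else budget z) + 148"
proof -
  have L: "ln (real R) \<ge> 1" using ln_ge_1[OF R] .
  have "target_potential R h \<le> (\<Sum>z\<in>box R. (if z \<in> set h then 0 else budget z) + 37 * target_mass R z)"
    unfolding target_potential_def
  proof (rule sum_mono)
    fix z assume z: "z \<in> box R"
    have m0: "target_mass R z \<ge> 0" using target_mass_nonneg[of R z] R by simp
    have "budget z = target_mass R z * (2 * ln R) * (8 / 7)"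
      using L unfolding target_mass_def A_plus_B by simp
    moreover have "0 \<le> target_mass R z * (2 * ln R)" using m0 L by simp
    ultimately have mw: "target_mass R z * (2 * ln R) \<le> budget z" by linarith
    have "target_mass R z * sub_log (hd h - z) \<le> target_mass R z * (2 * ln R + 37)"
      using sub_log_le_ln[OF R h, of z] z m0 by (intro mult_left_mono) (auto simp: box_def)
    then have "target_mass R z * sub_log (hd h - z) \<le> budget z + 37 * target_mass R z" using mw by (simp add: distrib_left)
    then show "target_mass R z * (if z \<in> set h then 0 else sub_log (hd h - z)) \<le> (if z \<in> set h then 0 else budget z) + 37 * target_mass R z"
      using m0 by simp
  qed
  also have "\<dots> = (\<Sum>z\<in>box R. if z \<in> set h then 0 else budget z) + 37 * (\<Sum>z\<in>box R. target_mass R z)"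
    by (simp only: sum.distrib sum_distrib_left)
  finally show ?thesis using sum_target_mass_le_4[OF R] by linarith
qed

text \<open>The inward losses of the two drifts cancel, and visited and unvisited sites together use
  the total budget once. The errors \<open>20400 + 38000000 + 148\<close> fit into the
  constant.\<close>

lemma potential_ge:
  assumes R: "R \<ge> 3" and h: "set (tl h) \<subseteq> box R" "sup_norm (hd h) \<le> R + 1"
  shows "- home_drift h + target_drift R h - target_potential R h \<ge> - (\<Sum>z\<in>box R. budget z) - 4 / 7 * Q R - 39000000"
proof -
  have "(\<Sum>y\<in>box R. if y \<in> set h then budget y else 0) + (\<Sum>y\<in>box R. if y \<in> set h then 0 else budget y) = (\<Sum>z\<in>box R. budget z)"
    unfolding sum.distrib[symmetric] by (intro sum.cong) auto
  then show ?thesis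
    using home_drift_le[OF h(1)] target_drift_ge[OF R h(1)] target_potential_le[OF R h(2)] unfolding A_plus_B by simp
qed

text \<open>Applied to the initial history only: the crude value \<open>604 * 4\<close> per past
  step is harmless because it does not depend on \<open>R\<close>.\<close>

lemma target_drift_le:
  assumes R: "R \<ge> 3"
  shows "target_drift R h \<le> 2416 * real (length h)"
proof -
  have "target_drift R h \<le> accumulate (\<lambda>_. 2416) h"
    unfolding target_drift_def
  proof (rule accumulate_mono)
    fix h :: "site list" assume "h \<noteq> []"
    let ?s = "\<Sum>z\<in>box R. target_mass R z * (if z \<in> set h then 0 else sub_kernel (hd h - z))"
    have "\<bar>?s\<bar> \<le> (\<Sum>z\<in>box R. \<bar>target_mass R z * (if z \<in> set h then 0 else sub_kernel (hd h - z))\<bar>)" by (rule sum_abs)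
    also have "\<dots> \<le> (\<Sum>z\<in>box R. target_mass R z * 604)"
    proof (rule sum_mono)
      fix z
      have "1 \<le> (bracket (hd h - z))\<^sup>2" by (simp add: bracket_def)
      then have "604 / (bracket (hd h - z))\<^sup>2 \<le> 604" by (simp add: divide_le_eq)
      then have "\<bar>sub_kernel (hd h - z)\<bar> \<le> 604" using abs_sub_kernel_le[of "hd h - z"] by linarith
      then show "\<bar>target_mass R z * (if z \<in> set h then 0 else sub_kernel (hd h - z))\<bar> \<le> target_mass R z * 604"
        using target_mass_nonneg[of R z] R by (auto simp: abs_mult intro: mult_left_mono)
    qed
    also have "\<dots> = (\<Sum>z\<in>box R. target_mass R z) * 604" by (simp only: sum_distrib_right)
    also have "\<dots> \<le> 2416" using sum_target_mass_le_4[OF R] by simp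
    finally have "\<bar>?s\<bar> \<le> 2416" .
    then have "\<bar>cookie \<beta> h\<bar> * \<bar>?s\<bar> \<le> 1 * 2416" using abs_cookie[OF \<open>h \<noteq> []\<close>] by (intro mult_mono) auto
    then have "\<bar>cookie \<beta> h * ?s\<bar> \<le> 2416" by (simp only: abs_mult mult_1)
    then show "cookie \<beta> h * ?s \<le> 2416" by (rule order_trans[OF abs_ge_self])
  qed
  then show ?thesis using accumulate_const_le[of 2416 h] by simp
qed

text \<open>Moving the centre from the origin to the walker costs a logarithm of the walker's
  position, times a total mass of at most 4. A target already visited loses at most 1, hence the
  length of the history. Neither loss depends on \<open>R\<close>.\<close>

lemma target_potential_ge:
  assumes R: "R \<ge> 3"
  shows "target_potential R h \<ge> Q R - 4 * ln (1 + 2 * norm_sq (hd h)) - real (length h)"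
proof -
  have L: "ln (real R) \<ge> 1" using ln_ge_1[OF R] .
  let ?k = "ln (1 + 2 * norm_sq (hd h))"
  have k0: "?k \<ge> 0" by simp
  have bound: "target_mass R z * ln (norm_sq z) - ?k * target_mass R z - of_bool (z \<in> set h)
     \<le> target_mass R z * (if z \<in> set h then 0 else sub_log (hd h - z))" for z
  proof (cases "z = 0")
    case False
    have r: "norm_sq z \<ge> 1" using norm_sq_ge_1[OF False] .
    have m0: "target_mass R z \<ge> 0" using target_mass_nonneg[of R z] R by simp
    show ?thesis
    proof (cases "z \<in> set h")
      case True
      have "target_mass R z \<le> \<bar>kern z\<bar> / 2"
        using target_mass_le(1)[OF R, of z] divide_left_mono[of 2 "2 * ln R" "\<bar>kern z\<bar>"] L by simp
      also have "\<dots> \<le> 1 / norm_sq z" using abs_kern_le_norm_sq[of z] r by simp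
      finally have "target_mass R z * ln (norm_sq z) \<le> 1 / norm_sq z * norm_sq z"
        using r ln_le_minus_one[of "norm_sq z"] by (intro mult_mono) auto
      also have "\<dots> = 1" using False by simp
      finally have "target_mass R z * ln (norm_sq z) \<le> 1" .
      moreover have "?k * target_mass R z \<ge> 0" using k0 m0 by simp
      ultimately show ?thesis using True by simp
    next
      case F: False
      have "norm_sq z \<le> (2 * norm_sq (hd h - z) + 1) * (1 + 2 * norm_sq (hd h))"
      proof -
        have sq: "t\<^sup>2 \<le> 2 * (s - t)\<^sup>2 + 2 * s\<^sup>2" for s t :: real
          using zero_le_power2[of "2 * s - t"] by (simp add: power2_eq_square algebra_simps)
        have "norm_sq z \<le> 2 * norm_sq (hd h - z) + 2 * norm_sq (hd h)"
          using sq[of "of_int (fst z)" "of_int (fst (hd h))"] sq[of "of_int (snd z)" "of_int (snd (hd h))"]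
          by (simp add: norm_sq_def)
        also have "\<dots> \<le> (2 * norm_sq (hd h - z) + 1) * (1 + 2 * norm_sq (hd h))"
          by (simp add: algebra_simps)
        finally show ?thesis .
      qed
      then have "ln (norm_sq z) \<le> ln ((2 * norm_sq (hd h - z) + 1) * (1 + 2 * norm_sq (hd h)))"
        using r by (subst ln_le_cancel_iff) auto
      also have "\<dots> = sub_log (hd h - z) + ?k"
        unfolding sub_log_def by (rule ln_mult_pos) (auto intro: add_nonneg_pos add_pos_nonneg)
      finally have "target_mass R z * ln (norm_sq z) \<le> target_mass R z * (sub_log (hd h - z) + ?k)" using m0 by (rule mult_left_mono)
      then show ?thesis using F by (simp add: algebra_simps)
    qed
  qed simp
  have "(\<Sum>z\<in>box R. target_mass R z * ln (norm_sq z) - ?k * target_mass R z - of_bool (z \<in> set h)) \<le> target_potential R h"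
    unfolding target_potential_def by (intro sum_mono bound)
  then have "Q R - ?k * (\<Sum>z\<in>box R. target_mass R z) - (\<Sum>z\<in>box R. of_bool (z \<in> set h)) \<le> target_potential R h"
    by (simp only: sum_subtractf sum_distrib_left)
  moreover have "?k * (\<Sum>z\<in>box R. target_mass R z) \<le> ?k * 4"
    using sum_target_mass_le_4[OF R] k0 by (rule mult_left_mono)
  moreover have "(\<Sum>z\<in>box R. of_bool (z \<in> set h) :: real) \<le> length h"
  proof -
    have "(\<Sum>z\<in>box R. of_bool (z \<in> set h) :: real) = real (card (box R \<inter> set h))"
      by (simp add: of_bool_def sum.If_cases Int_def)
    also have "\<dots> \<le> real (card (set h))" by (intro of_nat_mono card_mono) auto
    also have "\<dots> \<le> length h" by (simp add: card_length)
    finally show ?thesis .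
  qed
  ultimately show ?thesis by linarith
qed

lemma escape_probability:
  assumes h0: "h \<noteq> []" and far0: "sup_norm (hd h) > 3"
  obtains R n where "stopped_exp \<beta> (stops R) (\<lambda>h. of_bool (sup_norm (hd h) > 3)) n h \<le> 19 / 20"
proof -
  \<comment> \<open>All that the past contributes, independent of \<open>R\<close>. The extra 10
    absorbs \<open>6 * 8 / 7 + 6 * 3 / 7\<close>, the additive constants of
    \<open>sum_budget_le\<close> and \<open>log_mass_ge\<close>.\<close>
  define C0 where "C0 = super_log (hd h) - home_drift h + 2416 * real (length h) + 4 * ln (1 + 2 * norm_sq (hd h)) + real (length h) + 39000010"
  obtain R0 where R0: "\<And>z. z \<in> set h \<Longrightarrow> sup_norm z \<le> R0"
    using finite_set[of h] by (metis finite_imageI finite_nat_set_iff_bounded_le imageI)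
  have "eventually (\<lambda>R. ln (real R) \<ge> 50 * C0) sequentially"
    by (rule filterlim_at_top[THEN iffD1, rule_format, OF filterlim_compose[OF ln_at_top filterlim_real_sequentially]])
  then obtain R where R: "R \<ge> R0" "R \<ge> 3" "ln (real R) \<ge> 50 * C0"
    using eventually_conj[OF _ eventually_ge_at_top[of "max R0 3"]]
    by (metis (mono_tags, lifting) eventually_at_top_linorder max.bounded_iff nle_le)
  have L: "ln (real R) \<ge> 1" using ln_ge_1[OF R(2)] .
  \<comment> \<open>Steps have length 1, so the stopped walk overshoots the outer box by at most 1
    and does not get inside radius 3, where \<open>super_log\<close> could be negative. All
    departures are made inside the outer box.\<close>
  define I where "I h \<longleftrightarrow> h \<noteq> [] \<and> set (tl h) \<subseteq> box R \<and> sup_norm (hd h) \<le> R + 1 \<and> sup_norm (hd h) \<ge> 3" for h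
  have I0: "I h"
  proof -
    obtain x xs where xs: "h = x # xs" using h0 by (cases h) auto
    have "sup_norm z \<le> R" if "z \<in> set h" for z using R0[OF that] R(1) by simp
    then show ?thesis using far0 by (auto simp: I_def box_def xs le_SucI)
  qed
  have I: "closed_under_steps (stops R) I"
    unfolding closed_under_steps_def
  proof (intro allI impI conjI ballI)
    fix h e assume h: "I h" "\<not> stops R h" "e \<in> dirs"
    obtain x xs where xs: "h = x # xs" using h(1) by (cases h) (auto simp: I_def)
    show "I ((hd h + e) # h)"
      using h(1,2) sup_norm_neighbour[OF h(3), of "hd h"] by (auto simp: I_def stops_def box_def xs)
  qed (auto simp: I_def)
  let ?\<Phi> = "\<lambda>h. super_log (hd h) - home_drift h + target_drift R h - target_potential R h"
  define c where "c = (\<Sum>z\<in>box R. budget z) + 4 / 7 * Q R + 39000000"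
  have low: "2 * ln R * of_bool (sup_norm (hd h) > R) - c \<le> ?\<Phi> h" if "I h" for h
  proof -
    have n3: "sup_norm (hd h) \<ge> 3" using that by (simp add: I_def)
    have "(real (sup_norm (hd h)))\<^sup>2 \<ge> 3\<^sup>2" using n3 by (intro power_mono) auto
    then have r9: "norm_sq (hd h) \<ge> 9" using norm_sq_ge_sup_norm[of "hd h"] by simp
    have "2 * ln R * of_bool (sup_norm (hd h) > R) \<le> super_log (hd h)"
    proof (cases "sup_norm (hd h) > R")
      case True
      then have "(real (sup_norm (hd h)))\<^sup>2 \<ge> (real R + 1)\<^sup>2" by (intro power_mono) auto
      then have "(real R)\<^sup>2 \<le> norm_sq (hd h) - 1" using norm_sq_ge_sup_norm[of "hd h"] by (simp add: power2_sum)
      then have "ln ((real R)\<^sup>2) \<le> super_log (hd h)"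
        unfolding super_log_def using R(2) r9 by (subst ln_le_cancel_iff) auto
      then show ?thesis using True R(2) by (simp add: ln_realpow)
    next
      case False
      then show ?thesis using r9 by (simp add: super_log_def)
    qed
    then show ?thesis
      using potential_ge[OF R(2), of h] that unfolding c_def I_def by simp
  qed
  have "stopped_exp \<beta> (stops R) (\<lambda>h. 2 * ln R * of_bool (sup_norm (hd h) > R) - c) n h \<le> C0 - 39000010 - Q R" for n
  proof -
    have "stopped_exp \<beta> (stops R) (\<lambda>h. 2 * ln R * of_bool (sup_norm (hd h) > R) - c) n h \<le> stopped_exp \<beta> (stops R) ?\<Phi> n h"
      by (rule stopped_exp_mono[OF I I0 low])
    also have "\<dots> \<le> ?\<Phi> h"
      by (rule stopped_exp_supermartingale[OF I I0]) (use potential_supermartingale[of R] R(2) in \<open>auto simp: I_def\<close>)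
    also have "\<dots> \<le> C0 - 39000010 - Q R"
      using target_drift_le[OF R(2), of h] target_potential_ge[OF R(2), of h] by (simp add: C0_def)
    finally show ?thesis .
  qed
  moreover have "stopped_exp \<beta> (stops R) (\<lambda>h. 2 * ln R * of_bool (sup_norm (hd h) > R) - c) n h
     = 2 * ln R * stopped_exp \<beta> (stops R) (\<lambda>h. of_bool (sup_norm (hd h) > R)) n h - c" for n
    using stopped_exp_add[of "stops R" "\<lambda>h. 2 * ln R * of_bool (sup_norm (hd h) > R)" "\<lambda>_. - c" n h]
    by (simp add: stopped_exp_cmult stopped_exp_const)
  \<comment> \<open>The budget gives \<open>16 / 7\<close>, and \<open>Q R\<close> enters with
    coefficient \<open>4 / 7 - 1\<close>, which gives \<open>- 3 / 7\<close>.\<close>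
  moreover have "C0 - 39000010 - Q R + c \<le> 13 / 7 * ln R + C0"
    using sum_budget_le[of R] log_mass_ge[OF R(2)] R(2) unfolding c_def A_plus_B by simp
  ultimately have "2 * ln R * stopped_exp \<beta> (stops R) (\<lambda>h. of_bool (sup_norm (hd h) > R)) n h \<le> 13 / 7 * ln R + C0" for n
    by (smt (verit))
  also have "13 / 7 * ln R + C0 \<le> 2 * ln R * (13 / 14 + 1 / 100)" using R(3) by simp
  finally have exit: "stopped_exp \<beta> (stops R) (\<lambda>h. of_bool (sup_norm (hd h) > R)) n h \<le> 13 / 14 + 1 / 100" for n
    using L by (subst (asm) mult_le_cancel_left_pos) auto
  define K where "K = 2 * (real (R + 1))\<^sup>2"
  have K: "norm_sq (hd h) \<le> K" if "I h" for h
  proof -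
    have "(real (sup_norm (hd h)))\<^sup>2 \<le> (real (R + 1))\<^sup>2" using that by (intro power_mono) (auto simp: I_def)
    then show ?thesis using norm_sq_le_sup_norm[of "hd h"] unfolding K_def by linarith
  qed
  \<comment> \<open>Long enough for the unstopped walk to have probability at most
    \<open>1 / 100\<close>. Together with the \<open>1 / 100\<close> from \<open>C0\<close>, the
    total \<open>13 / 14 + 2 / 100\<close> stays below \<open>19 / 20\<close>.\<close>
  define n where "n = nat \<lceil>100 * K\<rceil> + 1"
  have n: "real n \<ge> 100 * K" "real n > 0" by (auto simp: n_def) linarith
  have "real n * stopped_exp \<beta> (stops R) (\<lambda>h. of_bool (\<not> stops R h)) n h \<le> K"
    using stopped_exp_unstopped_le[OF I I0 K, of n] norm_sq_nonneg[of "hd h"] by linarith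
  then have "real n * stopped_exp \<beta> (stops R) (\<lambda>h. of_bool (\<not> stops R h)) n h \<le> real n * (1 / 100)"
    using n by linarith
  then have uns: "stopped_exp \<beta> (stops R) (\<lambda>h. of_bool (\<not> stops R h)) n h \<le> 1 / 100"
    using n(2) by simp
  have "stopped_exp \<beta> (stops R) (\<lambda>h. of_bool (sup_norm (hd h) > 3)) n h
    \<le> stopped_exp \<beta> (stops R) (\<lambda>h. of_bool (sup_norm (hd h) > R) + of_bool (\<not> stops R h)) n h"
    by (rule stopped_exp_mono[OF I I0]) (auto simp: stops_def)
  also have "\<dots> \<le> 13 / 14 + 1 / 100 + 1 / 100"
    unfolding stopped_exp_add using exit[of n] uns by linarith
  finally show ?thesis by (intro that[of R n]) simp
qed

end

section \<open>The walk as a process on histories\<close>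

primrec hist :: "(nat \<Rightarrow> 'a \<Rightarrow> site) \<Rightarrow> nat \<Rightarrow> 'a \<Rightarrow> site list" where
  "hist S 0 \<omega> = [S 0 \<omega>]"
| "hist S (Suc n) \<omega> = S (Suc n) \<omega> # hist S n \<omega>"

lemma length_hist [simp]: "length (hist S n \<omega>) = Suc n"
  by (induction n) auto

lemma hd_hist [simp]: "hd (hist S n \<omega>) = S n \<omega>"
  by (cases n) auto

lemma nth_hist: "k \<le> n \<Longrightarrow> hist S n \<omega> ! (n - k) = S k \<omega>"
proof (induction n)
  case (Suc n)
  show ?case
  proof (cases "k = Suc n")
    case False
    then have "Suc n - k = Suc (n - k)" using Suc by simp
    then show ?thesis using Suc False by simp
  qed simp
qed simp

lemma count_hist: "count_list (hist S n \<omega>) z = card {k. k \<le> n \<and> S k \<omega> = z}"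
proof (induction n)
  case (Suc n)
  have "{k. k \<le> Suc n \<and> S k \<omega> = z} = (if S (Suc n) \<omega> = z then insert (Suc n) {k. k \<le> n \<and> S k \<omega> = z}
      else {k. k \<le> n \<and> S k \<omega> = z})"
    by (auto simp: le_Suc_eq)
  moreover have "Suc n \<notin> {k. k \<le> n \<and> S k \<omega> = z}" "finite {k. k \<le> n \<and> S k \<omega> = z}" by auto
  ultimately show ?case using Suc by simp
next
  case 0
  have "{k. k \<le> 0 \<and> S k \<omega> = z} = (if S 0 \<omega> = z then {0} else {})" by auto
  then show ?case by simp
qed

lemma tl_hist: "tl (hist S (Suc n) \<omega>) = hist S n \<omega>"
  by simp

lemma current_cookie_hist: "current_cookie \<beta> S n \<omega> = cookie \<beta> (hist S n \<omega>)"
proof -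
  have "{k. k \<le> n \<and> S k \<omega> = S n \<omega>} = insert n {k. k < n \<and> S k \<omega> = S n \<omega>}" by auto
  then show ?thesis
    by (simp add: current_cookie_def departures_def cookie_def count_hist)
qed

text \<open>There are only countably many histories, so bounds given the history can be added up
  cylinder by cylinder.\<close>

lemma (in finite_measure) measure_le_by_countable_partition:
  fixes H :: "'a \<Rightarrow> 'b::countable"
  assumes H: "\<And>h. {\<omega>\<in>space M. H \<omega> = h} \<in> sets M" and E: "E \<in> sets M" "E' \<in> sets M"
    and le: "\<And>h. measure M ({\<omega>\<in>space M. H \<omega> = h} \<inter> E) \<le> c * measure M ({\<omega>\<in>space M. H \<omega> = h} \<inter> E')"
  shows "measure M E \<le> c * measure M E'"
proof -
  define G where "G n = {\<omega>\<in>space M. to_nat (H \<omega>) = n}" for n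
  have G: "G n = {} \<or> (\<exists>h. G n = {\<omega>\<in>space M. H \<omega> = h})" for n
    by (cases "\<exists>h. to_nat (h::'b) = n") (auto simp: G_def)
  have Gs: "G n \<in> sets M" for n using G[of n] H by auto
  have sums: "(\<lambda>n. measure M (G n \<inter> D)) sums measure M D" if D: "D \<in> sets M" for D
  proof -
    have "(\<Union>n. G n \<inter> D) = D" using sets.sets_into_space[OF D] by (auto simp: G_def)
    then show ?thesis
      using finite_measure_UNION[of "\<lambda>n. G n \<inter> D"] Gs D by (auto simp: disjoint_family_on_def G_def)
  qed
  have "measure M (G n \<inter> E) \<le> c * measure M (G n \<inter> E')" for n
    using G[of n] le by auto
  then show ?thesis
    using sums_le[OF _ sums[OF E(1)] sums_mult[OF sums[OF E(2)], of c]] by blast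
qed

section \<open>From conditional step laws to cylinder probabilities\<close>

locale walk_process = cookie_walk \<beta> A B + prob_space M
  for \<beta> :: "site \<Rightarrow> nat \<Rightarrow> real" and A B :: real and M :: "'a measure" +
  fixes S :: "nat \<Rightarrow> 'a \<Rightarrow> site"
  assumes measurable_S [measurable]: "\<And>n. S n \<in> M \<rightarrow>\<^sub>M count_space UNIV"
    and cond_horizontal: "\<And>n e. e \<in> {(1, 0), (-1, 0)} \<Longrightarrow>
        AE \<omega> in M. cond_step_prob M S n e \<omega> = (1 + current_cookie \<beta> S n \<omega>) / 4"
    and cond_vertical: "\<And>n e. e \<in> {(0, 1), (0, -1)} \<Longrightarrow>
        AE \<omega> in M. cond_step_prob M S n e \<omega> = (1 - current_cookie \<beta> S n \<omega>) / 4"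
begin

text \<open>A history with \<open>n + 1\<close> entries is complete at time \<open>n\<close>. For
  the empty list the set is empty.\<close>

definition cyl :: "site list \<Rightarrow> 'a set" where
  "cyl h = {\<omega>\<in>space M. hist S (length h - 1) \<omega> = h}"

lemma space_natural: "space (natural_sigma M S n) = space M"
  unfolding natural_sigma_def by (rule space_measure_of) auto

lemma sets_natural:
  "sets (natural_sigma M S n) = sigma_sets (space M) {S k -` C \<inter> space M | k C. k \<le> n}"
  unfolding natural_sigma_def by (rule sets_measure_of) auto

lemma subalgebra_natural: "subalgebra M (natural_sigma M S n)"
proof -
  have "{S k -` C \<inter> space M | k C. k \<le> n} \<subseteq> sets M"
    using measurable_sets[OF measurable_S] by auto
  then show ?thesis
    unfolding subalgebra_def space_natural sets_natural by (auto intro: sets.sigma_sets_subset[THEN subsetD])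
qed

lemma hist_natural: "{\<omega>\<in>space M. hist S n \<omega> = h} \<in> sets (natural_sigma M S n)"
proof (cases "length h = Suc n")
  case True
  have "{\<omega>\<in>space M. hist S n \<omega> = h} = (\<Inter>k\<in>{..n}. S k -` {h ! (n - k)} \<inter> space M)"
  proof (intro equalityI subsetI)
    fix \<omega> assume \<omega>: "\<omega> \<in> (\<Inter>k\<in>{..n}. S k -` {h ! (n - k)} \<inter> space M)"
    have "hist S n \<omega> = h"
    proof (rule nth_equalityI)
      fix i assume "i < length (hist S n \<omega>)"
      then have i: "i \<le> n" by simp
      then have "S (n - i) \<omega> = h ! (n - (n - i))" using \<omega> by auto
      then show "hist S n \<omega> ! i = h ! i" using nth_hist[of "n - i" n S \<omega>] i by simp
    qed (simp add: True)
    then show "\<omega> \<in> {\<omega>\<in>space M. hist S n \<omega> = h}" using \<omega> by auto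
  qed (auto simp: nth_hist)
  also have "\<dots> \<in> sets (natural_sigma M S n)"
    by (rule sets.finite_INT) (auto simp: sets_natural intro!: sigma_sets.Basic)
  finally show ?thesis .
next
  case False
  then have "{\<omega>\<in>space M. hist S n \<omega> = h} = {}" by auto
  then show ?thesis by (simp only: sets.empty_sets)
qed

lemma hist_sets [measurable]: "{\<omega>\<in>space M. hist S n \<omega> = h} \<in> sets M"
  using hist_natural[of n h] subalgebra_natural[of n] unfolding subalgebra_def by blast

lemma cyl_sets [measurable]: "cyl h \<in> sets M"
  unfolding cyl_def by (rule hist_sets)

lemma cond_step_prob_eq:
  assumes "e \<in> dirs"
  shows "AE \<omega> in M. cond_step_prob M S n e \<omega> = step_prob \<beta> (hist S n \<omega>) e"
proof (cases "e \<in> {(1, 0), (-1, 0)}")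
  case True
  then show ?thesis using cond_horizontal[OF True, of n] by (simp add: step_prob_def current_cookie_hist)
next
  case False
  then have "e \<in> {(0, 1), (0, -1)}" using assms by auto
  then show ?thesis using cond_vertical[of e n] False by (simp add: step_prob_def current_cookie_hist)
qed

lemma cyl_Cons:
  assumes "h \<noteq> []"
  shows "cyl ((hd h + e) # h) = cyl h \<inter> {\<omega>\<in>space M. S (length h) \<omega> - S (length h - 1) \<omega> = e}"
proof -
  obtain n where n: "length h = Suc n" using assms by (cases h) auto
  show ?thesis
  proof (rule set_eqI)
    fix \<omega>
    have "S (Suc n) \<omega> = S n \<omega> + e \<longleftrightarrow> S (Suc n) \<omega> - S n \<omega> = e"
      by (simp add: diff_eq_eq add.commute)
    moreover have "hd h = S n \<omega>" if "hist S n \<omega> = h" using that[symmetric] by simp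
    ultimately show "\<omega> \<in> cyl ((hd h + e) # h) \<longleftrightarrow>
        \<omega> \<in> cyl h \<inter> {\<omega>\<in>space M. S (length h) \<omega> - S (length h - 1) \<omega> = e}"
      by (cases "hist S n \<omega> = h") (simp_all add: cyl_def n)
  qed
qed

text \<open>A cylinder belongs to the natural sigma-algebra, and the conditional step probability is
  almost surely constant on it; integrating over the cylinder yields the product.\<close>

lemma prob_cyl_Cons:
  assumes h: "h \<noteq> []" and e: "e \<in> dirs"
  shows "prob (cyl ((hd h + e) # h)) = step_prob \<beta> h e * prob (cyl h)"
proof -
  obtain n where n: "length h = Suc n" using h by (cases h) auto
  define D where "D = {\<omega>\<in>space M. S (Suc n) \<omega> - S n \<omega> = e}"
  have D: "D \<in> sets M" unfolding D_def by measurable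
  interpret F: finite_measure_subalgebra M "natural_sigma M S n"
    by unfold_locales (rule subalgebra_natural)
  have cyl: "cyl h = {\<omega>\<in>space M. hist S n \<omega> = h}" by (simp add: cyl_def n)
  have "prob (cyl ((hd h + e) # h)) = prob (cyl h \<inter> D)" by (simp add: cyl_Cons[OF h] n D_def)
  also have "\<dots> = (\<integral>\<omega>\<in>cyl h. indicator D \<omega> \<partial>M)"
  proof -
    have "(\<integral>\<omega>\<in>cyl h. indicator D \<omega> \<partial>M) = (\<integral>\<omega>. indicator (cyl h \<inter> D) \<omega> \<partial>M :: real)"
      unfolding set_lebesgue_integral_def
      by (rule Bochner_Integration.integral_cong) (auto simp: indicator_def)
    then show ?thesis using cyl_sets[of h] D by simp
  qed
  also have "\<dots> = (\<integral>\<omega>\<in>cyl h. real_cond_exp M (natural_sigma M S n) (indicator D) \<omega> \<partial>M)"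
    by (rule F.real_cond_exp_intA) (use D hist_natural cyl in \<open>auto simp: less_top[symmetric]\<close>)
  also have "\<dots> = (\<integral>\<omega>\<in>cyl h. step_prob \<beta> h e \<partial>M)"
    unfolding set_lebesgue_integral_def
  proof (rule integral_cong_AE)
    show "AE \<omega> in M. indicator (cyl h) \<omega> *\<^sub>R real_cond_exp M (natural_sigma M S n) (indicator D) \<omega>
        = indicator (cyl h) \<omega> *\<^sub>R step_prob \<beta> h e"
      using cond_step_prob_eq[OF e, of n]
      by eventually_elim (auto simp: cond_step_prob_def D_def cyl indicator_def)
  qed (use cyl_sets[of h] in auto)
  also have "\<dots> = step_prob \<beta> h e * prob (cyl h)"
    unfolding set_lebesgue_integral_def using cyl_sets[of h] by simp
  finally show ?thesis .
qed

text \<open>The probabilities of the four continuations add up to that of the cylinder, so other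
  steps have probability 0.\<close>

lemma prob_cyl_le_sum:
  assumes h: "h \<noteq> []" and E: "E \<in> sets M"
  shows "prob (cyl h \<inter> E) \<le> (\<Sum>e\<in>dirs. prob (cyl ((hd h + e) # h) \<inter> E))"
proof -
  let ?V = "\<lambda>e. cyl ((hd h + e) # h)"
  have fin: "finite dirs" by simp
  have disj: "disjoint_family_on ?V dirs"
    by (auto simp: disjoint_family_on_def cyl_def)
  have "prob (\<Union>e\<in>dirs. ?V e) = (\<Sum>e\<in>dirs. prob (?V e))"
    using disj by (intro finite_measure_finite_Union) auto
  also have "\<dots> = (\<Sum>e\<in>dirs. step_prob \<beta> h e * prob (cyl h))"
    by (intro sum.cong refl prob_cyl_Cons[OF h])
  also have "\<dots> = prob (cyl h)" by (simp only: sum_distrib_right[symmetric] sum_step_prob mult_1)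
  finally have tot: "prob (\<Union>e\<in>dirs. ?V e) = prob (cyl h)" .
  have sub: "(\<Union>e\<in>dirs. ?V e) \<subseteq> cyl h" using cyl_Cons[OF h] by blast
  have meas: "(\<Union>e\<in>dirs. ?V e) \<in> sets M" by (intro sets.finite_UN) auto
  have "prob (cyl h - (\<Union>e\<in>dirs. ?V e)) = 0"
    using finite_measure_Diff[OF cyl_sets meas sub] tot by simp
  moreover have "prob (cyl h \<inter> E) \<le> prob ((\<Union>e\<in>dirs. ?V e \<inter> E) \<union> (cyl h - (\<Union>e\<in>dirs. ?V e)))"
    using meas E by (intro finite_measure_mono) (auto intro!: sets.finite_UN)
  moreover have "\<dots> \<le> prob (\<Union>e\<in>dirs. ?V e \<inter> E) + prob (cyl h - (\<Union>e\<in>dirs. ?V e))"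
    using meas E by (intro measure_Un_le) (auto intro!: sets.finite_UN)
  moreover have "prob (\<Union>e\<in>dirs. ?V e \<inter> E) \<le> (\<Sum>e\<in>dirs. prob (?V e \<inter> E))"
    using E by (intro finite_measure_subadditive_finite) auto
  ultimately show ?thesis by linarith
qed

text \<open>The bridge from histories to the process: a bound on stopped or final cylinders
  propagates backward along the recursion of \<open>stopped_exp\<close>.\<close>

lemma prob_cyl_le_stopped_exp:
  assumes E: "E \<in> sets M"
    and bound: "\<And>h. length h \<ge> l \<Longrightarrow> stp h \<or> length h = N \<Longrightarrow> prob (cyl h \<inter> E) \<le> prob (cyl h) * F h"
  shows "h \<noteq> [] \<Longrightarrow> length h \<ge> l \<Longrightarrow> length h + k = N \<Longrightarrow> prob (cyl h \<inter> E) \<le> prob (cyl h) * stopped_exp \<beta> stp F k h"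
proof (induction k arbitrary: h)
  case 0
  then show ?case using bound[of h] by simp
next
  case (Suc k)
  show ?case
  proof (cases "stp h")
    case True
    then show ?thesis using bound[of h] Suc by simp
  next
    case False
    have "prob (cyl h \<inter> E) \<le> (\<Sum>e\<in>dirs. prob (cyl ((hd h + e) # h) \<inter> E))"
      by (rule prob_cyl_le_sum[OF Suc.prems(1) E])
    also have "\<dots> \<le> (\<Sum>e\<in>dirs. prob (cyl ((hd h + e) # h)) * stopped_exp \<beta> stp F k ((hd h + e) # h))"
      using Suc by (intro sum_mono) simp
    also have "\<dots> = (\<Sum>e\<in>dirs. prob (cyl h) * (step_prob \<beta> h e * stopped_exp \<beta> stp F k ((hd h + e) # h)))"
      by (rule sum.cong[OF refl]) (simp only: prob_cyl_Cons[OF Suc.prems(1)] mult.assoc mult.commute mult.left_commute)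
    also have "\<dots> = prob (cyl h) * step_exp \<beta> (stopped_exp \<beta> stp F k) h"
      by (simp only: step_exp_def sum_distrib_left)
    finally show ?thesis using False by simp
  qed
qed

section \<open>Recurrence of the small box\<close>

definition never :: "site set \<Rightarrow> nat \<Rightarrow> 'a set" where
  "never T n = {\<omega>\<in>space M. \<forall>k\<ge>n. S k \<omega> \<notin> T}"

lemma never_sets [measurable]: "never T n \<in> sets M"
proof -
  have "S k -` T \<inter> space M \<in> sets M" for k using measurable_sets[OF measurable_S] by simp
  then have "space M - (\<Union>k\<in>{n..}. S k -` T \<inter> space M) \<in> sets M" by (intro sets.Diff sets.top sets.countable_UN') auto
  also have "space M - (\<Union>k\<in>{n..}. S k -` T \<inter> space M) = never T n" by (auto simp: never_def)
  finally show ?thesis .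
qed

lemma never_cyl:
  assumes "length h \<ge> Suc n" "hd h \<in> T"
  shows "cyl h \<inter> never T n = {}"
proof -
  have "S (length h - 1) \<omega> \<in> T" if "\<omega> \<in> cyl h" for \<omega>
    using that assms(2) hd_hist[of S "length h - 1" \<omega>] by (simp add: cyl_def)
  then show ?thesis using assms by (force simp: never_def)
qed

text \<open>On the event the stopped walk must end outside the small box, whether by escape or by
  lack of time, and \<open>escape_probability\<close> bounds both together.\<close>

lemma prob_never_box_le:
  assumes h: "h \<noteq> []" and n: "length h = Suc n"
  shows "prob (cyl h \<inter> never (box 3) n) \<le> 19 / 20 * prob (cyl h)"
proof (cases "sup_norm (hd h) > 3")
  case True
  obtain R k where Rk: "stopped_exp \<beta> (stops R) (\<lambda>h. of_bool (sup_norm (hd h) > 3)) k h \<le> 19 / 20"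
    using escape_probability[OF h True] by blast
  have "prob (cyl h \<inter> never (box 3) n) \<le> prob (cyl h) * stopped_exp \<beta> (stops R) (\<lambda>h. of_bool (sup_norm (hd h) > 3)) k h"
  proof (rule prob_cyl_le_stopped_exp[where l = "Suc n" and N = "length h + k"])
    fix h' :: "site list" assume "length h' \<ge> Suc n"
    then show "prob (cyl h' \<inter> never (box 3) n) \<le> prob (cyl h') * of_bool (sup_norm (hd h') > 3)"
      using never_cyl[of n h' "box 3"] by (cases "sup_norm (hd h') > 3") (auto simp: box_def intro!: finite_measure_mono)
  qed (use h n in auto)
  also have "\<dots> \<le> prob (cyl h) * (19 / 20)" using Rk by (intro mult_left_mono) auto
  finally show ?thesis by simp
next
  case False
  then show ?thesis using never_cyl[of n h "box 3"] n by (simp add: box_def)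
qed

text \<open>Given avoidance up to time \<open>n + k\<close>, avoidance forever has probability at
  most \<open>19 / 20\<close>. As \<open>k\<close> grows, the conditioning event decreases to
  avoidance forever, so its probability \<open>p\<close> satisfies
  \<open>p \<le> 19 / 20 * p\<close>.\<close>

lemma prob_never_box: "prob (never (box 3) n) = 0"
proof -
  define V where "V k = {\<omega>\<in>space M. \<forall>j\<in>{n..n + k}. S j \<omega> \<notin> box 3}" for k
  have V_eq: "V k = space M - (\<Union>j\<in>{n..n + k}. S j -` box 3 \<inter> space M)" for k
    by (auto simp: V_def)
  have V: "V k \<in> sets M" for k
    unfolding V_eq using measurable_sets[OF measurable_S] by (intro sets.Diff sets.finite_UN) auto
  have "prob (never (box 3) n) \<le> 19 / 20 * prob (V k)" for k
  proof (rule measure_le_by_countable_partition[where H = "hist S (n + k)"])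
    fix h
    let ?H = "{\<omega>\<in>space M. hist S (n + k) \<omega> = h}"
    show "?H \<in> sets M" by simp
    show "prob (?H \<inter> never (box 3) n) \<le> 19 / 20 * prob (?H \<inter> V k)"
    proof (cases "?H \<inter> V k = {}")
      case True
      then have "?H \<inter> never (box 3) n = {}" by (auto simp: V_def never_def)
      then show ?thesis using True by simp
    next
      case False
      then obtain \<omega>0 where \<omega>0: "\<omega>0 \<in> V k" "hist S (n + k) \<omega>0 = h" by auto
      have len: "length h = Suc (n + k)" using \<omega>0(2) by auto
      then have cyl: "?H = cyl h" by (simp add: cyl_def)
      have "?H \<subseteq> V k"
      proof
        fix \<omega> assume \<omega>: "\<omega> \<in> ?H"
        have "S j \<omega> = S j \<omega>0" if "j \<le> n + k" for j
          using nth_hist[OF that, of S \<omega>] nth_hist[OF that, of S \<omega>0] \<omega> \<omega>0(2) by simp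
        then show "\<omega> \<in> V k" using \<omega> \<omega>0(1) by (auto simp: V_def)
      qed
      then have "?H \<inter> V k = cyl h" using cyl by auto
      moreover have "prob (?H \<inter> never (box 3) n) \<le> prob (cyl h \<inter> never (box 3) (n + k))"
        unfolding cyl by (intro finite_measure_mono) (auto simp: never_def intro: cyl_sets never_sets[unfolded never_def])
      moreover have "h \<noteq> []" using len by auto
      ultimately show ?thesis using prob_never_box_le[OF _ len] by simp
    qed
  qed (use V in auto)
  moreover have "(\<lambda>k. prob (V k)) \<longlonglongrightarrow> prob (\<Inter>k. V k)"
    using V by (intro finite_Lim_measure_decseq) (auto simp: decseq_def V_def)
  moreover have "(\<Inter>k. V k) = never (box 3) n"
  proof (intro equalityI subsetI)
    fix \<omega> assume \<omega>: "\<omega> \<in> (\<Inter>k. V k)"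
    have "S j \<omega> \<notin> box 3" if "j \<ge> n" for j
    proof -
      have "\<omega> \<in> V (j - n)" using \<omega> by blast
      then show ?thesis using that by (auto simp: V_def)
    qed
    moreover have "\<omega> \<in> space M" using \<omega> by (auto simp: V_def)
    ultimately show "\<omega> \<in> never (box 3) n" by (auto simp: never_def)
  qed (auto simp: never_def V_def)
  ultimately have "prob (never (box 3) n) \<le> 19 / 20 * prob (never (box 3) n)"
    using LIMSEQ_le_const[OF tendsto_mult_left[of "\<lambda>k. prob (V k)" _ _ "19 / 20"]] by auto
  then show ?thesis using measure_nonneg[of M "never (box 3) n"] by linarith
qed

section \<open>From one recurrent site to all sites\<close>

lemma cookies_eventually_small: "\<exists>j0. \<forall>j>j0. \<bar>\<beta> y j\<bar> \<le> 1 / 2"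
proof (rule ccontr)
  assume "\<not> ?thesis"
  then have "\<forall>j0. \<exists>j>j0. j \<in> {j. j \<ge> 1 \<and> \<bar>\<beta> y j\<bar> > 1 / 2}"
    by (metis (mono_tags, lifting) One_nat_def Suc_leI bot_nat_0.extremum_strict mem_Collect_eq not_le zero_less_iff_neq_zero)
  then have "infinite {j. j \<ge> 1 \<and> \<bar>\<beta> y j\<bar> > 1 / 2}"
    by (simp add: infinite_nat_iff_unbounded)
  \<comment> \<open>Three cookies of absolute value above \<open>1 / 2\<close> already exceed the
    total \<open>8 / 7\<close>.\<close>
  then obtain T where T: "finite T" "card T = 3" "T \<subseteq> {j. j \<ge> 1 \<and> \<bar>\<beta> y j\<bar> > 1 / 2}"
    using infinite_arbitrarily_large by blast
  define n where "n = Max T"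
  have "T \<subseteq> {1..n}" using T by (auto simp: n_def)
  have "3 * (1 / 2) \<le> (\<Sum>j\<in>T. \<bar>\<beta> y j\<bar>)"
    using T sum_bounded_below[of T "1 / 2" "\<lambda>j. \<bar>\<beta> y j\<bar>"] by fastforce
  also have "\<dots> \<le> (\<Sum>j=1..n. \<bar>\<beta> y j\<bar>)"
    using \<open>T \<subseteq> {1..n}\<close> by (intro sum_mono2) auto
  also have "\<dots> = (\<Sum>j=1..n. max (\<beta> y j) 0) + (\<Sum>j=1..n. max (- \<beta> y j) 0)"
    unfolding sum.distrib[symmetric] by (intro sum.cong) (auto simp: max_def)
  also have "\<dots> \<le> A + B" by (intro add_mono A_bound B_bound)
  finally show False using A_plus_B by simp
qed

text \<open>Each late departure from \<open>y\<close> misses \<open>y + e\<close> with probability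
  at most \<open>7 / 8\<close>, so missing it at many departures is exponentially unlikely. The
  factor \<open>(8 / 7) ^ length h\<close> allows for departures made before the avoidance
  starts.\<close>

lemma neighbour_avoided:
  assumes e: "e \<in> dirs" and small: "\<And>j. j > j0 \<Longrightarrow> \<bar>\<beta> y j\<bar> \<le> 1 / 2"
    and h: "h \<noteq> []" "length h = Suc n"
  shows "prob (cyl h \<inter> (never {y + e} n \<inter> {\<omega>\<in>space M. count_list (tl (hist S (n + k) \<omega>)) y \<ge> c}))
     \<le> (7 / 8) ^ (c - j0) * (8 / 7) ^ length h"
proof -
  \<comment> \<open>A supermartingale: it is killed at \<open>y + e\<close> and multiplied by
    \<open>8 / 7\<close>, the inverse of the survival bound, at each departure from \<open>y\<close>
    after the first \<open>j0\<close>. Counting in \<open>tl h\<close> counts completed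
    departures.\<close>
  define G where "G h = (if hd h = y + e then 0 else (8 / 7 :: real) ^ (count_list (tl h) y - j0))" for h
  define F where "F h = (if hd h \<noteq> y + e \<and> count_list (tl h) y \<ge> c then 1 else 0 :: real)" for h
  define stp where "stp h \<longleftrightarrow> hd h = y + e" for h :: "site list"
  let ?E = "never {y + e} n \<inter> {\<omega>\<in>space M. count_list (tl (hist S (n + k) \<omega>)) y \<ge> c}"
  have C: "{\<omega>\<in>space M. count_list (tl (hist S (n + k) \<omega>)) y \<ge> c} \<in> sets M"
  proof -
    have "{\<omega>\<in>space M. count_list (tl (hist S (n + k) \<omega>)) y \<ge> c}
      = (\<Union>h\<in>{h. count_list (tl h) y \<ge> c}. {\<omega>\<in>space M. hist S (n + k) \<omega> = h})" by auto
    also have "\<dots> \<in> sets M" by (rule sets.countable_UN') auto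
    finally show ?thesis .
  qed
  have I: "closed_under_steps stp (\<lambda>h. h \<noteq> [])" by (simp add: closed_under_steps_def)
  have G0: "G h \<ge> 0" for h by (simp add: G_def)
  have FG: "F h \<le> (7 / 8) ^ (c - j0) * G h" for h
  proof (cases "hd h \<noteq> y + e \<and> count_list (tl h) y \<ge> c")
    case True
    have "(1::real) = (7 / 8 * (8 / 7)) ^ (c - j0)" by simp
    also have "\<dots> = (7 / 8) ^ (c - j0) * (8 / 7) ^ (c - j0)" by (simp only: power_mult_distrib)
    also have "\<dots> \<le> (7 / 8) ^ (c - j0) * (8 / 7) ^ (count_list (tl h) y - j0)"
      using True by (intro mult_left_mono power_increasing) auto
    finally show ?thesis using True by (simp add: F_def G_def)
  qed (auto simp: F_def G0)
  have super: "step_exp \<beta> G h \<le> G h" if h: "h \<noteq> []" "\<not> stp h" for h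
  proof -
    let ?d = "count_list (tl h) y"
    have cnt: "count_list h y = (if hd h = y then Suc ?d else ?d)" using h by (cases h) auto
    have Gh: "G h = (8 / 7) ^ (?d - j0)" using h by (simp add: G_def stp_def)
    show ?thesis
    proof (cases "hd h = y \<and> ?d \<ge> j0")
      case False
      then have "count_list h y - j0 = ?d - j0" using cnt by auto
      then have "step_exp \<beta> G h \<le> step_exp \<beta> (\<lambda>_. G h) h"
        using h by (intro step_mono) (auto simp: G_def stp_def)
      then show ?thesis by simp
    next
      case True
      \<comment> \<open>A cookie of absolute value at most \<open>1 / 2\<close> leaves every
        direction at least \<open>(1 - 1 / 2) / 4\<close>.\<close>
      have pr: "step_prob \<beta> h e \<ge> 1 / 8"
        using small[of "Suc ?d"] True cnt by (auto simp: step_prob_def cookie_def abs_le_iff)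
      have "step_exp \<beta> G h = (\<Sum>e'\<in>dirs - {e}. step_prob \<beta> h e' * G ((hd h + e') # h))"
        unfolding step_exp_def using e True by (subst sum.remove[OF _ e]) (auto simp: G_def)
      also have "\<dots> \<le> (\<Sum>e'\<in>dirs - {e}. step_prob \<beta> h e' * (8 / 7 * G h))"
      proof (intro sum_mono mult_left_mono step_prob_nonneg[OF h(1)])
        fix e' assume "e' \<in> dirs - {e}"
        then have "G ((hd h + e') # h) = (8 / 7) ^ (Suc ?d - j0)" using True cnt by (auto simp: G_def)
        then show "G ((hd h + e') # h) \<le> 8 / 7 * G h" using True by (simp add: Gh Suc_diff_le)
      qed
      also have "\<dots> = (\<Sum>e'\<in>dirs - {e}. step_prob \<beta> h e') * (8 / 7 * G h)"
        by (simp only: sum_distrib_right)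
      also have "(\<Sum>e'\<in>dirs - {e}. step_prob \<beta> h e') = 1 - step_prob \<beta> h e"
        using sum.remove[of dirs e "step_prob \<beta> h"] e sum_step_prob[of \<beta> h] by simp
      also have "(1 - step_prob \<beta> h e) * (8 / 7 * G h) \<le> 7 / 8 * (8 / 7 * G h)"
        using pr G0[of h] by (intro mult_right_mono) auto
      finally show ?thesis by simp
    qed
  qed
  have "prob (cyl h \<inter> ?E) \<le> prob (cyl h) * stopped_exp \<beta> stp F k h"
  proof (rule prob_cyl_le_stopped_exp[where l = "Suc n" and N = "length h + k"])
    fix h' :: "site list" assume h': "length h' \<ge> Suc n" "stp h' \<or> length h' = length h + k"
    show "prob (cyl h' \<inter> ?E) \<le> prob (cyl h') * F h'"
    proof (cases "hd h' = y + e")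
      case True
      then have "cyl h' \<inter> ?E = {}" using never_cyl[OF h'(1), of "{y + e}"] by auto
      then show ?thesis by (simp add: F_def)
    next
      case False
      then have len: "length h' = Suc (n + k)" using h' h by (auto simp: stp_def)
      show ?thesis
      proof (cases "count_list (tl h') y \<ge> c")
        case True
        then show ?thesis using False by (auto simp: F_def intro!: finite_measure_mono)
      next
        case nc: False
        have "cyl h' \<inter> ?E = {}" using nc len by (auto simp: cyl_def)
        then show ?thesis by (simp add: F_def)
      qed
    qed
  qed (use h C in auto)
  also have "\<dots> \<le> prob (cyl h) * stopped_exp \<beta> stp (\<lambda>h. (7 / 8) ^ (c - j0) * G h) k h"
    by (intro mult_left_mono stopped_exp_mono[OF I h(1) FG]) auto
  also have "\<dots> \<le> prob (cyl h) * ((7 / 8) ^ (c - j0) * G h)"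
    unfolding stopped_exp_cmult by (intro mult_left_mono stopped_exp_supermartingale[OF I h(1) super]) auto
  also have "\<dots> \<le> 1 * ((7 / 8) ^ (c - j0) * (8 / 7) ^ length h)"
  proof (intro mult_mono mult_left_mono)
    have "count_list (tl h) y - j0 \<le> length h"
      using count_le_length[of "tl h" y] by simp
    then show "G h \<le> (8 / 7) ^ length h" by (auto simp: G_def intro: power_increasing)
  qed (auto simp: G0)
  finally show ?thesis by simp
qed

text \<open>If \<open>y + e\<close> is visited finitely often, it is avoided from some time on.
  There are countably many histories at such times, and after each one, infinitely many departures
  from \<open>y\<close> that all miss \<open>y + e\<close> form a null event.\<close>

lemma AE_neighbour:
  assumes e: "e \<in> dirs"
  shows "AE \<omega> in M. infinite {n. S n \<omega> = y} \<longrightarrow> infinite {n. S n \<omega> = y + e}"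
proof -
  obtain j0 where small: "\<And>j. j > j0 \<Longrightarrow> \<bar>\<beta> y j\<bar> \<le> 1 / 2" using cookies_eventually_small[of y] by blast
  have "AE \<omega> in M. \<not> (\<omega> \<in> cyl h \<and> \<omega> \<in> never {y + e} n \<and> infinite {n. S n \<omega> = y})"
    if h: "length h = Suc n" for h n
  proof -
    have hn: "h \<noteq> []" using h by auto
    define C where "C c k = cyl h \<inter> (never {y + e} n \<inter> {\<omega>\<in>space M. count_list (tl (hist S (n + k) \<omega>)) y \<ge> c})" for c k
    have C: "C c k \<in> sets M" for c k
    proof -
      have "{\<omega>\<in>space M. count_list (tl (hist S (n + k) \<omega>)) y \<ge> c}
        = (\<Union>h\<in>{h. count_list (tl h) y \<ge> c}. {\<omega>\<in>space M. hist S (n + k) \<omega> = h})" by auto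
      also have "\<dots> \<in> sets M" by (rule sets.countable_UN') auto
      finally show ?thesis unfolding C_def by auto
    qed
    have UC: "(\<Union>k. C c k) \<in> sets M" for c using C by auto
    have mono: "C c k \<subseteq> C c (Suc k)" for c k
      by (cases "n + k") (auto simp: C_def)
    have "prob (\<Union>k. C c k) \<le> (7 / 8) ^ (c - j0) * (8 / 7) ^ length h" for c
    proof -
      have "(\<lambda>k. prob (C c k)) \<longlonglongrightarrow> prob (\<Union>k. C c k)"
        using C mono by (intro finite_Lim_measure_incseq incseq_SucI) auto
      then show ?thesis
        by (rule LIMSEQ_le_const2) (use neighbour_avoided[OF e small hn h] in \<open>auto simp: C_def\<close>)
    qed
    then have le: "prob (\<Inter>c. \<Union>k. C c k) \<le> (7 / 8) ^ (c - j0) * (8 / 7) ^ length h" for c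
      using finite_measure_mono[of "\<Inter>c. \<Union>k. C c k" "\<Union>k. C c k"] UC[of c] by (meson INT_lower UNIV_I order_trans)
    have "(\<lambda>c. (7 / 8 :: real) ^ c * (8 / 7) ^ length h) \<longlonglongrightarrow> 0"
      by (intro tendsto_mult_left_zero LIMSEQ_power_zero) simp
    then have "prob (\<Inter>c. \<Union>k. C c k) \<le> 0"
      by (rule LIMSEQ_le_const) (use le[of "_ + j0"] in auto)
    then have z: "prob (\<Inter>c. \<Union>k. C c k) = 0" using measure_nonneg[of M] by (metis order_antisym)
    have "(\<Inter>c. \<Union>k. C c k) \<in> null_sets M"
      using UC z by (auto simp: null_sets_def emeasure_eq_measure)
    then have "AE \<omega> in M. \<omega> \<notin> (\<Inter>c. \<Union>k. C c k)" by (rule AE_not_in)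
    then show ?thesis
    proof eventually_elim
      case (elim \<omega>)
      show ?case
      proof
        assume \<omega>: "\<omega> \<in> cyl h \<and> \<omega> \<in> never {y + e} n \<and> infinite {n. S n \<omega> = y}"
        have "\<exists>k. \<omega> \<in> C c k" for c
        proof -
          obtain T where T: "finite T" "card T = c" "T \<subseteq> {n. S n \<omega> = y}"
            using infinite_arbitrarily_large \<omega> by blast
          obtain N where N: "\<And>t. t \<in> T \<Longrightarrow> t \<le> N" using T(1) finite_nat_set_iff_bounded_le by auto
          have "T \<subseteq> {k. k \<le> n + N \<and> S k \<omega> = y}" using N T(3) by fastforce
          then have "card T \<le> card {k. k \<le> n + N \<and> S k \<omega> = y}" by (intro card_mono) auto
          then have "c \<le> count_list (tl (hist S (n + Suc N) \<omega>)) y"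
            unfolding add_Suc_right tl_hist count_hist T(2) .
          then have "\<omega> \<in> C c (Suc N)" using \<omega> sets.sets_into_space[OF cyl_sets[of h]] by (auto simp: C_def)
          then show ?thesis by blast
        qed
        then show False using elim by auto
      qed
    qed
  qed
  then have "AE \<omega> in M. \<forall>n h. length h = Suc n \<longrightarrow> \<not> (\<omega> \<in> cyl h \<and> \<omega> \<in> never {y + e} n \<and> infinite {n. S n \<omega> = y})"
    by (simp add: AE_all_countable)
  then show ?thesis
  proof (rule AE_mp, intro AE_I2 impI)
    fix \<omega> assume \<omega>: "\<omega> \<in> space M" "infinite {n. S n \<omega> = y}"
      and *: "\<forall>n h. length h = Suc n \<longrightarrow> \<not> (\<omega> \<in> cyl h \<and> \<omega> \<in> never {y + e} n \<and> infinite {n. S n \<omega> = y})"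
    show "infinite {n. S n \<omega> = y + e}"
    proof
      assume "finite {n. S n \<omega> = y + e}"
      then obtain N where N: "\<And>n. S n \<omega> = y + e \<Longrightarrow> n < N"
        using finite_nat_set_iff_bounded by auto
      then have "\<omega> \<in> never {y + e} N" using \<omega> by (force simp: never_def)
      moreover have "\<omega> \<in> cyl (hist S N \<omega>)" using \<omega> by (simp add: cyl_def)
      ultimately show False using * \<omega> length_hist[of S N \<omega>] by blast
    qed
  qed
qed

lemma AE_some_site: "AE \<omega> in M. \<exists>y. infinite {n. S n \<omega> = y}"
proof -
  have "AE \<omega> in M. \<omega> \<notin> never (box 3) n" for n
    using prob_never_box[of n] by (intro AE_not_in) (auto simp: null_sets_def emeasure_eq_measure)
  then have "AE \<omega> in M. \<forall>n. \<omega> \<notin> never (box 3) n" by (simp add: AE_all_countable)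
  then show ?thesis
  proof (rule AE_mp, intro AE_I2 impI)
    fix \<omega> assume \<omega>: "\<omega> \<in> space M" and *: "\<forall>n. \<omega> \<notin> never (box 3) n"
    have "infinite {n. S n \<omega> \<in> box 3}"
      using * \<omega> by (auto simp: never_def infinite_nat_iff_unbounded_le)
    moreover have "{n. S n \<omega> \<in> box 3} = (\<Union>y\<in>box 3. {n. S n \<omega> = y})" by auto
    ultimately show "\<exists>y. infinite {n. S n \<omega> = y}" by auto
  qed
qed

lemma AE_all_sites: "AE \<omega> in M. \<forall>z. infinite {n. S n \<omega> = z}"
proof -
  have "AE \<omega> in M. \<forall>y. \<forall>e\<in>dirs. infinite {n. S n \<omega> = y} \<longrightarrow> infinite {n. S n \<omega> = y + e}"
    unfolding AE_all_countable
    by (intro allI, subst AE_ball_countable, simp, intro ballI AE_neighbour)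
  with AE_some_site show ?thesis
  proof eventually_elim
    case (elim \<omega>)
    define V where "V = {y. infinite {n. S n \<omega> = y}}"
    have closed: "y + e \<in> V" if "y \<in> V" "e \<in> dirs" for y e using elim(2) that unfolding V_def by blast
    obtain a b where ab: "(a, b) \<in> V" using elim(1) by (auto simp: V_def)
    have 1: "(i, b) \<in> V" for i
    proof (induction i rule: int_induct[where k = a])
      case (step1 i) then show ?case using closed[of "(i, b)" "(1, 0)"] by simp
    next
      case (step2 i) then show ?case using closed[of "(i, b)" "(-1, 0)"] by simp
    qed (rule ab)
    have "(i, j) \<in> V" for i j
    proof (induction j rule: int_induct[where k = b])
      case (step1 j) then show ?case using closed[of "(i, j)" "(0, 1)"] by simp
    next
      case (step2 j) then show ?case using closed[of "(i, j)" "(0, -1)"] by simp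
    qed (rule 1)
    then show ?case by (auto simp: V_def)
  qed
qed

end

section \<open>Reduction to the case \<open>A + B = 8 / 7\<close>\<close>

lemma kappa_star_le: "kappa_star \<le> 8 / 7"
proof -
  \<comment> \<open>Since \<open>sin (pi / 6) = 1 / 2\<close>, this yields
    \<open>pi \<ge> 3\<close>, which is exactly what \<open>8 / 7\<close> needs.\<close>
  have "sin (pi / 6) \<le> pi / 6" by (rule sin_x_le_x) simp
  then have "pi \<ge> 3" by (simp add: sin_30)
  then show ?thesis by (simp add: kappa_star_def field_simps)
qed

lemma sum_le_infsum_bound:
  fixes f :: "nat \<Rightarrow> real"
  assumes "f summable_on {1..}" "infsum f {1..} \<le> c" "\<And>j. f j \<ge> 0"
  shows "(\<Sum>j=1..n. f j) \<le> c"
  using finite_sum_le_infsum[OF assms(1), of "{1..n}"] assms by auto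

theorem theorem1p2:
  fixes A B :: real
    and \<beta> :: "int \<times> int \<Rightarrow> nat \<Rightarrow> real"
    and x :: "int \<times> int"
    and M :: "'a measure"
    and S :: "nat \<Rightarrow> 'a \<Rightarrow> int \<times> int"
  assumes "A \<ge> 0" and "B \<ge> 0" and "A + B < kappa_star"
    and "\<beta> \<in> env_class A B"
    and "balanced_excited_walk \<beta> x M S"
  shows "AE \<omega> in M. \<forall>z. infinite {n. S n \<omega> = z}"
proof -
  interpret prob_space M using assms(5) by (simp add: balanced_excited_walk_def)
  have A': "A \<le> 8 / 7 - B" using assms(3) kappa_star_le by simp
  have env: "(\<lambda>j. max (\<beta> z j) 0) summable_on {1..}" "(\<Sum>\<^sub>\<infinity>j\<in>{1..}. max (\<beta> z j) 0) \<le> A"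
    "(\<lambda>j. max (- \<beta> z j) 0) summable_on {1..}" "(\<Sum>\<^sub>\<infinity>j\<in>{1..}. max (- \<beta> z j) 0) \<le> B" for z
    using assms(4) unfolding env_class_def by blast+
  interpret walk_process \<beta> "8 / 7 - B" B M S
  proof
    show "\<bar>\<beta> z j\<bar> \<le> 1" if "j \<ge> 1" for z j
    proof -
      have "\<beta> z j \<in> {-1..1}"
        using assms(4) that unfolding env_class_def cookie_environment_def by blast
      then show ?thesis by auto
    qed
    show "(\<Sum>j = 1..n. max (\<beta> z j) 0) \<le> 8 / 7 - B" for z n
      by (rule order_trans[OF sum_le_infsum_bound[OF env(1,2)] A']) simp
    show "(\<Sum>j = 1..n. max (- \<beta> z j) 0) \<le> B" for z n
      by (rule sum_le_infsum_bound[OF env(3,4)]) simp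
  qed (use assms(5) in \<open>auto simp: balanced_excited_walk_def\<close>)
  show ?thesis by (rule AE_all_sites)
qed

end
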